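(* There is an isomorphism of $\mathbb Z[\delta^{\pm1}]$-algebras $\phi:\mathrm{Br}(\mathrm{F}_4)\to \mathrm{SBr}(\mathrm{E}_6)$ determined by $\phi(r_1)=R_1R_6$, $\phi(r_2)=R_3R_5$, $\phi(r_3)=R_4$, $\phi(r_4)=R_2$, $\phi(e_1)=E_1E_6$, $\phi(e_2)=E_3E_5$, $\phi(e_3)=E_4$, $\phi(e_4)=E_2$. Moreover, $\mathrm{Br}(\mathrm{F}_4)$ is a free $\mathbb Z[\delta^{\pm1}]$-module of rank $14985$.
   Context: Let $\delta$ be an indeterminate. $\mathrm{Br}(\mathrm{F}_4)$ is the unital associative $\mathbb Z[\delta^{\pm1}]$-algebra generated by $r_1,r_2,r_3,r_4,e_1,e_2,e_3,e_4$ subject to the relations: $r_i^2=1$ and $r_ie_i=e_ir_i=e_i$ for all $i$; $e_i^2=\delta e_i$ for $i\in\{3,4\}$; $e_i^2=\delta^2e_i$ for $i\in\{1,2\}$; for $\{i,j\}\in\{\{1,3\},\{1,4\},\{2,4\}\}$: $r_ir_j=r_jr_i$, $e_ir_j=r_je_i$, $e_ie_j=e_je_i$; for $(i,j)\in\{(1,2),(2,1),(3,4),(4,3)\}$: $r_ir_jr_i=r_jr_ir_j$, $r_jr_ie_j=e_ie_j$, $r_ie_jr_i=r_je_ir_j$; and $r_2r_3r_2r_3=r_3r_2r_3r_2$, $r_2r_3e_2=r_3e_2$, $r_2e_3r_2e_3=e_3e_2e_3$, $(r_2r_3r_2)e_3=e_3(r_2r_3r_2)$, $e_2r_3e_2=\delta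 e_2$, $e_2e_3e_2=\delta e_2$, $e_2r_3r_2=e_2r_3$, $e_2e_3r_2=e_2e_3$. (This is the presentation attached to the $\mathrm{F}_4$ Dynkin diagram $1-2\Rightarrow 3-4$ with nodes $1,2$ short and $3,4$ long.) $\mathrm{BrM}(\mathrm{F}_4)$ denotes the submonoid of the multiplicative monoid of $\mathrm{Br}(\mathrm{F}_4)$ generated by $\delta^{\pm1}$ and the $r_i,e_i$. The Brauer algebra $\mathrm{Br}(\mathrm{E}_6)$ (Cohen–Frenk–Wales) is the unital $\mathbb Z[\delta^{\pm1}]$-algebra generated by $R_1,\dots,R_6,E_1,\dots,E_6$, where the nodes $1,\dots,6$ form the $\mathrm{E}_6$ Dynkin diagram with edges $1-3$, $3-4$, $4-5$, $5-6$, $2-4$, subject to: $R_i^2=1$, $R_iE_i=E_iR_i=E_i$, $E_i^2=\delta E_i$ for all $i$; for distinct non-adjacent $i,j$: $R_iR_j=R_jR_i$, $E_iR_j=R_jE_i$, $E_iE_j=E_jE_i$; for adjacent $i,j$: $R_iR_jR_i=R_jR_iR_j$, $R_jR_iE_j=E_iE_j$, $R_iE_jR_i=R_jE_iR_j$. $\mathrm{BrM}(\mathrm{E}_6)$ is the monoid generated by $\delta^{\pm1}$, the $R_i$ and the $E_i$ (its elements are the monomials). Let $\sigma$ be the algebra automorphism of $\mathrm{Br}(\mathrm{E}_6)$ induced by the diagram automorphism $(1,6)(3,5)$, i.e. $\sigma(R_i)=R_{\sigma(i)}$, $\sigma(E_i)=E_{\sigma(i)}$, $\sigma(\delta)=\delta$.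 $\mathrm{SBr}(\mathrm{E}_6)$ is the $\mathbb Z[\delta^{\pm1}]$-subalgebra of $\mathrm{Br}(\mathrm{E}_6)$ generated by the $\sigma$-invariant elements of $\mathrm{BrM}(\mathrm{E}_6)$. *)

theory Defs
  imports "HOL-Library.Poly_Mapping"
begin

datatype 'g word = Word (letters: "'g list")

instantiation word :: (type) monoid_add
begin
definition zero_word :: "'g word" where "zero_word = Word []"
definition plus_word :: "'g word \<Rightarrow> 'g word \<Rightarrow> 'g word"
  where "plus_word u v = Word (letters u @ letters v)"
instance
  by standard (simp_all add: zero_word_def plus_word_def)
end

type_synonym laurent = "int \<Rightarrow>\<^sub>0 int"

definition dpow :: "int \<Rightarrow> laurent"
  where "dpow k = Poly_Mapping.single k 1"

type_synonym 'g falg = "'g word \<Rightarrow>\<^sub>0 laurent"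

definition scal :: "laurent \<Rightarrow> 'g falg \<Rightarrow> 'g falg"
  where "scal c p = Poly_Mapping.single 0 c * p"

definition gen :: "'g \<Rightarrow> 'g falg"
  where "gen x = Poly_Mapping.single (Word [x]) 1"

definition dl :: "'g falg"
  where "dl = scal (dpow 1) 1"

definition hom :: "('g \<Rightarrow> 'h falg) \<Rightarrow> 'g falg \<Rightarrow> 'h falg"
  where "hom img p = (\<Sum>w\<in>Poly_Mapping.keys p. scal (Poly_Mapping.lookup p w) (prod_list (map img (letters w))))"

definition monomials :: "'g falg set"
  where "monomials = {Poly_Mapping.single w (dpow k) | w k. True}"

inductive_set ideal_gen :: "'a::ring_1 set \<Rightarrow> 'a set" for S where
  gen_in: "s \<in> S \<Longrightarrow> a * s * b \<in> ideal_gen S"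
| zero_in: "0 \<in> ideal_gen S"
| add_in: "x \<in> ideal_gen S \<Longrightarrow> y \<in> ideal_gen S \<Longrightarrow> x + y \<in> ideal_gen S"
| neg_in: "x \<in> ideal_gen S \<Longrightarrow> - x \<in> ideal_gen S"

inductive_set subalg_gen :: "'g falg set \<Rightarrow> 'g falg set" for G where
  one_in: "1 \<in> subalg_gen G"
| base_in: "g \<in> G \<Longrightarrow> g \<in> subalg_gen G"
| add_in: "x \<in> subalg_gen G \<Longrightarrow> y \<in> subalg_gen G \<Longrightarrow> x + y \<in> subalg_gen G"
| scal_in: "x \<in> subalg_gen G \<Longrightarrow> scal c x \<in> subalg_gen G"
| mult_in: "x \<in> subalg_gen G \<Longrightarrow> y \<in> subalg_gen G \<Longrightarrow> x * y \<in> subalg_gen G"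

datatype F4node = f1 | f2 | f3 | f4
datatype F4gen = Fr F4node | Fe F4node

definition r :: "F4node \<Rightarrow> F4gen falg" where "r i = gen (Fr i)"
definition e :: "F4node \<Rightarrow> F4gen falg" where "e i = gen (Fe i)"

text \<open>Each relation x = y is encoded as the element x - y.\<close>
definition relF4 :: "F4gen falg set" where
  "relF4 =
     {r i * r i - 1 | i. True}
   \<union> {r i * e i - e i | i. True} \<union> {e i * r i - e i | i. True}
   \<union> {e i * e i - dl * e i | i. i \<in> {f3, f4}}
   \<union> {e i * e i - dl * dl * e i | i. i \<in> {f1, f2}}
   \<union> (\<Union>(i,j)\<in>{(f1,f3),(f3,f1),(f1,f4),(f4,f1),(f2,f4),(f4,f2)}.
        {r i * r j - r j * r i, e i * r j - r j * e i, e i * e j - e j * e i})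
   \<union> (\<Union>(i,j)\<in>{(f1,f2),(f2,f1),(f3,f4),(f4,f3)}.
        {r i * r j * r i - r j * r i * r j,
         r j * r i * e j - e i * e j,
         r i * e j * r i - r j * e i * r j})
   \<union> {r f2 * r f3 * r f2 * r f3 - r f3 * r f2 * r f3 * r f2,
      r f2 * r f3 * e f2 - r f3 * e f2,
      r f2 * e f3 * r f2 * e f3 - e f3 * e f2 * e f3,
      (r f2 * r f3 * r f2) * e f3 - e f3 * (r f2 * r f3 * r f2),
      e f2 * r f3 * e f2 - dl * e f2,
      e f2 * e f3 * e f2 - dl * e f2,
      e f2 * r f3 * r f2 - e f2 * r f3,
      e f2 * e f3 * r f2 - e f2 * e f3}"

definition IF4 :: "F4gen falg set" where "IF4 = ideal_gen relF4"

datatype E6node = n1 | n2 | n3 | n4 | n5 | n6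
datatype E6gen = ER E6node | EE E6node

definition adjE6 :: "E6node \<Rightarrow> E6node \<Rightarrow> bool" where
  "adjE6 i j \<longleftrightarrow> {i, j} \<in> {{n1,n3}, {n3,n4}, {n4,n5}, {n5,n6}, {n2,n4}}"

definition R :: "E6node \<Rightarrow> E6gen falg" where "R i = gen (ER i)"
definition E :: "E6node \<Rightarrow> E6gen falg" where "E i = gen (EE i)"

definition relE6 :: "E6gen falg set" where
  "relE6 =
     {R i * R i - 1 | i. True}
   \<union> {R i * E i - E i | i. True} \<union> {E i * R i - E i | i. True}
   \<union> {E i * E i - dl * E i | i. True}
   \<union> (\<Union>(i,j)\<in>{(i,j). i \<noteq> j \<and> \<not> adjE6 i j}.
        {R i * R j - R j * R i, E i * R j - R j * E i, E i * E j - E j * E i})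
   \<union> (\<Union>(i,j)\<in>{(i,j). adjE6 i j}.
        {R i * R j * R i - R j * R i * R j,
         R j * R i * E j - E i * E j,
         R i * E j * R i - R j * E i * R j})"

definition IE6 :: "E6gen falg set" where "IE6 = ideal_gen relE6"

fun sigma_node :: "E6node \<Rightarrow> E6node" where
  "sigma_node n1 = n6" | "sigma_node n6 = n1"
| "sigma_node n3 = n5" | "sigma_node n5 = n3"
| "sigma_node n2 = n2" | "sigma_node n4 = n4"

fun sigma_gen :: "E6gen \<Rightarrow> E6gen" where
  "sigma_gen (ER i) = ER (sigma_node i)" | "sigma_gen (EE i) = EE (sigma_node i)"

definition sigma :: "E6gen falg \<Rightarrow> E6gen falg"
  where "sigma = hom (\<lambda>x. gen (sigma_gen x))"

text \<open>Representatives (in the free algebra) of the elements of SBr(E6): the subalgebra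
  generated by monomials whose class in Br(E6) is sigma-invariant.\<close>
definition SBrE6 :: "E6gen falg set" where
  "SBrE6 = subalg_gen {m \<in> monomials. sigma m - m \<in> IE6}"

fun phi_gen :: "F4gen \<Rightarrow> E6gen falg" where
  "phi_gen (Fr f1) = R n1 * R n6"
| "phi_gen (Fr f2) = R n3 * R n5"
| "phi_gen (Fr f3) = R n4"
| "phi_gen (Fr f4) = R n2"
| "phi_gen (Fe f1) = E n1 * E n6"
| "phi_gen (Fe f2) = E n3 * E n5"
| "phi_gen (Fe f3) = E n4"
| "phi_gen (Fe f4) = E n2"

definition phi :: "F4gen falg \<Rightarrow> E6gen falg" where "phi = hom phi_gen"

end

theory Submission
  imports Defs
begin

text \<open>Modulo powers of \<open>\<delta>\<close> both algebras are spanned by words, and a word is determined by its correspondence (a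
  Lagrangian relation) on the root lattice of type \<open>E\<^sub>6\<close> modulo 2, together with the power of \<open>\<delta>\<close>.  A
  rewriting system for \<open>Br(F\<^sub>4)\<close> reduces every word to one of
  \<open>24 \<cdot> 48 + 12 \<cdot> 48 \<cdot> 12 + 30 \<cdot> 6 \<cdot> 30 + 39 \<cdot> 39 = 14985\<close> normal forms, sorted into four strata by the dimension of
  the image of 0.  The correspondences of their images under \<open>\<phi>\<close> are pairwise distinct, which gives
  the linear independence of the normal forms and the injectivity of \<open>\<phi>\<close> at once.  For surjectivity every word of
  \<open>Br(E\<^sub>6)\<close> is written as \<open>u Y v\<close> with \<open>u, v\<close> in the Weyl group and \<open>Y\<close> one of four idempotents up to scalars;
  modulo the Weyl group of type \<open>F\<^sub>4\<close> there are only 45 choices for \<open>u\<close> and \<open>v\<close>, and the correspondence of the word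
  excludes all but those that lead into the image of \<open>\<phi>\<close>.\<close>

section \<open>Rewriting in the algebra of type F4\<close>

text \<open>Residues modulo 2 suffice because an idempotent sees its root only up to sign, and the
  Weyl group of type E6, which does not contain -1, acts faithfully on the lattice modulo 2. The
  determinant 3 of the lattice is odd, so the form stays nondegenerate and the image of 0, being
  isotropic, has dimension at most 3. Four orthogonal roots of a D4 become dependent modulo 2, so
  the fourth opens no new stratum. The numbers 12, 30 and 39 count the \<sigma>-invariant sets of
  orthogonal roots up to sign: 12 fixed roots; 12 exchanged pairs and 18 pairs of fixed roots; 36
  quadruples with one exchanged pair and 3 quadruples of fixed roots. The Weyl group of type F4 is
  not transitive on the last two families, and only relations such as \<open>r2e3r2e3\<close> join
  the orbits. Hence the representatives cannot all be Weyl words, and completion is used to find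
  enough consequences of the presentation. For surjectivity only the invariance of the
  correspondence of a monomial is used; that the monomial comes from \<open>Br(F4)\<close> is then a
  conclusion.\<close>

text \<open>Words are written with the digits \<open>1, \<dots>, 4\<close> for the \<open>r\<^sub>i\<close>, \<open>5\<close> for \<open>e\<^sub>1\<close> and \<open>6\<close> for the conjugate \<open>t\<close> of
  \<open>e\<^sub>4\<close> belonging to the highest long root, which commutes with \<open>r\<^sub>1, r\<^sub>2, r\<^sub>3\<close>.\<close>

primrec act :: "('g \<Rightarrow> 'b \<Rightarrow> 'b) \<Rightarrow> 'g list \<Rightarrow> 'b \<Rightarrow> 'b" where
  "act f [] x = x"
| "act f (g # w) x = f g (act f w x)"

lemma act_append [simp]: "act f (u @ v) x = act f u (act f v x)"
  by (induction u) simp_all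

text \<open>The reflections to the left of \<open>Fe f4\<close> carry the root of the fourth node to
  the highest long root. The word is a palindrome, so reversing digits reverses the words that they
  denote.\<close>

definition tword :: "F4gen list" where
  "tword = map Fr [f4,f3,f2,f1,f3,f2,f3] @ [Fe f4] @ map Fr [f3,f2,f3,f1,f2,f3,f4]"

definition letter_word :: "nat \<Rightarrow> F4gen list" where
  "letter_word n = (if n = 1 then [Fr f1] else if n = 2 then [Fr f2] else if n = 3 then [Fr f3]
     else if n = 4 then [Fr f4] else if n = 5 then [Fe f1] else tword)"

definition wd :: "nat list \<Rightarrow> F4gen list" where
  "wd ns = concat (map letter_word ns)"

text \<open>\<open>C48\<close> is the group generated by \<open>r\<^sub>1, r\<^sub>2, r\<^sub>3\<close>, and \<open>W24\<close> represents its left cosets in the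
  Weyl group.\<close>

definition W24 :: "nat list list" where
  "W24 = [[], [4], [3,4], [2,3,4], [1,2,3,4], [3,2,3,4], [1,3,2,3,4], [4,3,2,3,4], [2,1,3,2,3,4],
    [1,4,3,2,3,4], [3,2,1,3,2,3,4], [2,1,4,3,2,3,4], [4,3,2,1,3,2,3,4], [3,2,1,4,3,2,3,4],
    [3,4,3,2,1,3,2,3,4], [2,3,2,1,4,3,2,3,4], [2,3,4,3,2,1,3,2,3,4], [1,2,3,2,1,4,3,2,3,4],
    [1,2,3,4,3,2,1,3,2,3,4], [3,2,3,4,3,2,1,3,2,3,4], [1,3,2,3,4,3,2,1,3,2,3,4],
    [2,1,3,2,3,4,3,2,1,3,2,3,4], [3,2,1,3,2,3,4,3,2,1,3,2,3,4],
    [4,3,2,1,3,2,3,4,3,2,1,3,2,3,4]]"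

definition C48 :: "nat list list" where
  "C48 = [[], [1], [2], [3], [2,1], [1,3], [1,2], [3,2], [2,3], [1,2,1], [3,2,1], [2,1,3], [1,3,2],
    [2,3,2], [1,2,3], [3,2,3], [1,3,2,1], [2,3,2,1], [1,2,1,3], [3,2,1,3], [2,1,3,2],
    [1,2,3,2], [2,3,2,3], [1,3,2,3], [2,1,3,2,1], [1,2,3,2,1], [2,3,2,1,3], [1,3,2,1,3],
    [1,2,1,3,2], [3,2,1,3,2], [1,2,3,2,3], [2,1,3,2,3], [1,2,1,3,2,1], [2,3,2,1,3,2],
    [1,2,3,2,1,3], [2,1,3,2,1,3], [1,3,2,1,3,2], [1,2,1,3,2,3], [3,2,1,3,2,3],
    [1,2,3,2,1,3,2], [1,2,1,3,2,1,3], [2,3,2,1,3,2,3], [2,1,3,2,1,3,2], [1,3,2,1,3,2,3],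
    [1,2,1,3,2,1,3,2], [1,2,3,2,1,3,2,3], [2,1,3,2,1,3,2,3], [1,2,1,3,2,1,3,2,3]]"

definition S6 :: "nat list list" where
  "S6 = [[], [3], [4], [4,3], [3,4], [3,4,3]]"

text \<open>The members of \<open>W24\<close> correspond to the 24 long roots. Opposite roots share
  their idempotent, and the first twelve members meet every pair of opposite roots.\<close>

definition A1 :: "nat list list" where
  "A1 = take 12 W24"

text \<open>Pairs exchanged by \<sigma> and pairs of fixed roots lie in different orbits of the Weyl
  group. The 12 words without the letter 6 give the pairs of the first kind; the other 18 begin
  their way from the right with \<open>[6,4,3,2]\<close>, which leads from the first kind to the
  second.\<close>

definition A2 :: "nat list list" where
  "A2 = [[], [2], [1,2], [3,2], [1,3,2], [2,3,2], [4,3,2], [1,4,3,2], [2,4,3,2], [6,4,3,2],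
    [3,2,4,3,2], [1,6,4,3,2], [2,6,4,3,2], [4,6,4,3,2], [2,3,2,4,3,2], [1,4,6,4,3,2],
    [2,4,6,4,3,2], [3,4,6,4,3,2], [1,2,3,2,4,3,2], [3,2,4,6,4,3,2], [1,3,4,6,4,3,2],
    [2,3,4,6,4,3,2], [2,3,2,4,6,4,3,2], [3,2,3,4,6,4,3,2], [1,2,3,2,4,6,4,3,2],
    [2,3,2,3,4,6,4,3,2], [4,3,2,3,4,6,4,3,2], [1,2,3,2,3,4,6,4,3,2], [2,4,3,2,3,4,6,4,3,2],
    [1,2,4,3,2,3,4,6,4,3,2]]"

text \<open>Here 36 words are Weyl words, for the quadruples with an exchanged pair; the three words
  through \<open>[6,4,3,2,3,4]\<close> give the quadruples of fixed roots.\<close>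

definition A3 :: "nat list list" where
  "A3 = [[], [2], [4], [1,2], [3,2], [2,4], [3,4], [1,3,2], [2,3,2], [4,3,2], [1,2,4], [3,2,4],
    [2,3,4], [1,4,3,2], [2,4,3,2], [3,4,3,2], [1,3,2,4], [2,3,2,4], [1,2,3,4], [3,2,3,4],
    [3,2,4,3,2], [1,3,4,3,2], [2,3,4,3,2], [1,3,2,3,4], [2,3,2,3,4], [4,3,2,3,4],
    [2,3,2,4,3,2], [3,2,3,4,3,2], [1,4,3,2,3,4], [2,4,3,2,3,4], [6,4,3,2,3,4],
    [1,2,3,2,4,3,2], [2,3,2,3,4,3,2], [3,2,4,3,2,3,4], [4,6,4,3,2,3,4], [1,2,3,2,3,4,3,2],
    [2,3,2,4,3,2,3,4], [3,4,6,4,3,2,3,4], [1,2,3,2,4,3,2,3,4]]"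

text \<open>The strata below the group: one long root, two short roots and both together, with the left representatives
  \<open>lreps\<close> and the group \<open>stab\<close> in the middle.\<close>

definition eps :: "nat \<Rightarrow> nat list" where
  "eps d = (if d = 1 then [6] else if d = 2 then [5] else [5,6])"

definition lreps :: "nat \<Rightarrow> nat list list" where
  "lreps d = (if d = 1 then A1 else if d = 2 then A2 else A3)"

definition stab :: "nat \<Rightarrow> nat list list" where
  "stab d = (if d = 1 then C48 else if d = 2 then S6 else [[]])"

text \<open>The short \<open>e2\<close> is a conjugate of \<open>e1\<close>, the long
  \<open>e3\<close> and \<open>e4\<close> are conjugates of \<open>t\<close>. The entry for
  \<open>e3\<close> is conjugated in two stages and left unreduced, whence the doubled letter
  3.\<close>

definition gen_digits :: "F4gen \<Rightarrow> nat list" where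
  "gen_digits g = (case g of Fr f1 \<Rightarrow> [1] | Fr f2 \<Rightarrow> [2] | Fr f3 \<Rightarrow> [3] | Fr f4 \<Rightarrow> [4]
    | Fe f1 \<Rightarrow> [5] | Fe f2 \<Rightarrow> [1,2,5,2,1]
    | Fe f3 \<Rightarrow> [4,3,3,2,3,1,2,3,4,6,4,3,2,1,3,2,3,3,4] | Fe f4 \<Rightarrow> [3,2,3,1,2,3,4,6,4,3,2,1,3,2,3])"

definition digits :: "F4gen list \<Rightarrow> nat list" where
  "digits w = concat (map gen_digits w)"
text \<open>Relations are stated for operators with a trailing argument: words become nested
  applications, and the simplifier rewrites them modulo associativity. The operators will be left
  and right multiplications on a quotient, and also words of type E6; \<open>dd\<close> stands for
  multiplication by \<delta>.\<close>

locale brauer_F4 =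
  fixes f :: "F4gen \<Rightarrow> 'b \<Rightarrow> 'b" and dd di :: "'b \<Rightarrow> 'b"
  assumes dd_di [simp]: "dd (di x) = x" and di_dd [simp]: "di (dd x) = x"
    and f_dd [simp]: "f g (dd x) = dd (f g x)"
    and rr: "f (Fr i) (f (Fr i) x) = x"
    and re: "f (Fr i) (f (Fe i) x) = f (Fe i) x"
    and er: "f (Fe i) (f (Fr i) x) = f (Fe i) x"
    and ee_long: "i \<in> {f3, f4} \<Longrightarrow> f (Fe i) (f (Fe i) x) = dd (f (Fe i) x)"
    and ee_short: "i \<in> {f1, f2} \<Longrightarrow> f (Fe i) (f (Fe i) x) = dd (dd (f (Fe i) x))"
    and comm: "(i, j) \<in> {(f1,f3),(f3,f1),(f1,f4),(f4,f1),(f2,f4),(f4,f2)} \<Longrightarrow>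
        f (Fr i) (f (Fr j) x) = f (Fr j) (f (Fr i) x)
      \<and> f (Fe i) (f (Fr j) x) = f (Fr j) (f (Fe i) x)
      \<and> f (Fe i) (f (Fe j) x) = f (Fe j) (f (Fe i) x)"
    and braid: "(i, j) \<in> {(f1,f2),(f2,f1),(f3,f4),(f4,f3)} \<Longrightarrow>
        f (Fr i) (f (Fr j) (f (Fr i) x)) = f (Fr j) (f (Fr i) (f (Fr j) x))
      \<and> f (Fr j) (f (Fr i) (f (Fe j) x)) = f (Fe i) (f (Fe j) x)
      \<and> f (Fr i) (f (Fe j) (f (Fr i) x)) = f (Fr j) (f (Fe i) (f (Fr j) x))"
    and r2323: "f (Fr f2) (f (Fr f3) (f (Fr f2) (f (Fr f3) x))) = f (Fr f3) (f (Fr f2) (f (Fr f3) (f (Fr f2) x)))"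
    and r23e2: "f (Fr f2) (f (Fr f3) (f (Fe f2) x)) = f (Fr f3) (f (Fe f2) x)"
    and r2e3r2e3: "f (Fr f2) (f (Fe f3) (f (Fr f2) (f (Fe f3) x))) = f (Fe f3) (f (Fe f2) (f (Fe f3) x))"
    and r232e3: "f (Fr f2) (f (Fr f3) (f (Fr f2) (f (Fe f3) x))) = f (Fe f3) (f (Fr f2) (f (Fr f3) (f (Fr f2) x)))"
    and e2r3e2: "f (Fe f2) (f (Fr f3) (f (Fe f2) x)) = dd (f (Fe f2) x)"
    and e2e3e2: "f (Fe f2) (f (Fe f3) (f (Fe f2) x)) = dd (f (Fe f2) x)"
    and e2r32: "f (Fe f2) (f (Fr f3) (f (Fr f2) x)) = f (Fe f2) (f (Fr f3) x)"
    and e2e3r2: "f (Fe f2) (f (Fe f3) (f (Fr f2) x)) = f (Fe f2) (f (Fe f3) x)"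
begin

abbreviation "r1 \<equiv> f (Fr f1)"
abbreviation "r2 \<equiv> f (Fr f2)"
abbreviation "r3 \<equiv> f (Fr f3)"
abbreviation "r4 \<equiv> f (Fr f4)"
abbreviation "e1 \<equiv> f (Fe f1)"
abbreviation "e2 \<equiv> f (Fe f2)"
abbreviation "e3 \<equiv> f (Fe f3)"
abbreviation "e4 \<equiv> f (Fe f4)"

lemma dd_inject [simp]: "dd x = dd y \<longleftrightarrow> x = y"
  by (metis di_dd)

lemmas [simp] = rr

text \<open>The following rules result from Knuth-Bendix completion for the letters \<open>1, 2, 3, 4, e\<^sub>1, t\<close>; the name of a rule
  spells its left-hand side.\<close>

lemma w31 [simp]: "r3 (r1 x) = r1 (r3 x)"
  using comm[of f1 f3] by simp

lemma w41 [simp]: "r4 (r1 x) = r1 (r4 x)"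
  using comm[of f1 f4] by simp

lemma w42 [simp]: "r4 (r2 x) = r2 (r4 x)"
  using comm[of f2 f4] by simp

lemma w212 [simp]: "r2 (r1 (r2 x)) = r1 (r2 (r1 x))"
  using braid[of f1 f2] by simp

lemma w434 [simp]: "r4 (r3 (r4 x)) = r3 (r4 (r3 x))"
  using braid[of f3 f4] by simp

lemma w3232 [simp]: "r3 (r2 (r3 (r2 x))) = r2 (r3 (r2 (r3 x)))"
  using r2323 by simp

lemma w4324 [simp]: "r4 (r3 (r2 (r4 x))) = r3 (r4 (r3 (r2 x)))"
  using w434[of "r2 x"] by simp

lemma w43214 [simp]: "r4 (r3 (r2 (r1 (r4 x)))) = r3 (r4 (r3 (r2 (r1 x))))"
  using w4324[of "r1 x"] by simp

lemma w321321 [simp]: "r3 (r2 (r1 (r3 (r2 (r1 x))))) = r2 (r3 (r2 (r1 (r3 (r2 x)))))"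
  using w3232[of "r1 (r2 x)"] by simp

lemma w432343 [simp]: "r4 (r3 (r2 (r3 (r4 (r3 x))))) = r3 (r4 (r3 (r2 (r3 (r4 x)))))"
  using w4324[of "r3 (r4 x)"] by simp

lemma w4321343 [simp]: "r4 (r3 (r2 (r1 (r3 (r4 (r3 x)))))) = r3 (r4 (r3 (r2 (r1 (r3 (r4 x))))))"
  using w43214[of "r3 (r4 x)"] by simp

lemma w4321324323 [simp]: "r4 (r3 (r2 (r1 (r3 (r2 (r4 (r3 (r2 (r3 x))))))))) = r3 (r4 (r3 (r2 (r1 (r3 (r2 (r4 (r3 (r2 x)))))))))"
  using w4321343[of "r2 (r3 (r2 x))"] by simp

lemma w43213243213 [simp]: "r4 (r3 (r2 (r1 (r3 (r2 (r4 (r3 (r2 (r1 (r3 x)))))))))) = r3 (r4 (r3 (r2 (r1 (r3 (r2 (r4 (r3 (r2 (r1 x))))))))))"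
  using w4321324323[of "r1 x"] by simp

lemma w4321323432134 [simp]: "r4 (r3 (r2 (r1 (r3 (r2 (r3 (r4 (r3 (r2 (r1 (r3 (r4 x)))))))))))) = r3 (r4 (r3 (r2 (r1 (r3 (r2 (r3 (r4 (r3 (r2 (r1 (r3 x))))))))))))"
  using w43213243213[of "r4 (r3 x)"] by simp

lemma w43213234321324 [simp]: "r4 (r3 (r2 (r1 (r3 (r2 (r3 (r4 (r3 (r2 (r1 (r3 (r2 (r4 x))))))))))))) = r3 (r4 (r3 (r2 (r1 (r3 (r2 (r3 (r4 (r3 (r2 (r1 (r3 (r2 x)))))))))))))"
  using w4321323432134[of "r2 x"] by simp

lemma w4321323432132343 [simp]: "r4 (r3 (r2 (r1 (r3 (r2 (r3 (r4 (r3 (r2 (r1 (r3 (r2 (r3 (r4 (r3 x))))))))))))))) = r3 (r4 (r3 (r2 (r1 (r3 (r2 (r3 (r4 (r3 (r2 (r1 (r3 (r2 (r3 (r4 x)))))))))))))))"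
  using w43213234321324[of "r3 (r4 x)"] by simp

section \<open>The idempotent of the highest long root\<close>

definition t :: "'b \<Rightarrow> 'b" where
  "t x = r4 (r3 (r2 (r1 (r3 (r2 (r3 (e4 (r3 (r2 (r3 (r1 (r2 (r3 (r4 x))))))))))))))"

lemma e2_eq: "e2 x = r1 (r2 (e1 (r2 (r1 x))))"
proof -
  have "r1 (e2 x) = r2 (e1 (r2 (r1 x)))"
    using braid[of f1 f2 "r1 x"] by simp
  from arg_cong[OF this, of r1] show ?thesis
    by simp
qed

lemma e3_eq: "e3 x = r4 (r3 (e4 (r3 (r4 x))))"
proof -
  have "r4 (e3 x) = r3 (e4 (r3 (r4 x)))"
    using braid[of f3 f4 "r4 x"] by simp
  from arg_cong[OF this, of r4] show ?thesis
    by simp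
qed

lemma e4_eq: "e4 x = r3 (r2 (r3 (r1 (r2 (r3 (r4 (t (r4 (r3 (r2 (r1 (r3 (r2 (r3 x))))))))))))))"
  by (simp add: t_def)

lemma t_dd [simp]: "t (dd x) = dd (t x)"
  by (simp add: t_def)

text \<open>Conjugating \<open>r232e3\<close> by \<open>r3\<close> and \<open>r4\<close> turns
  \<open>e3\<close> into \<open>e4\<close> and \<open>r2 r3 r2\<close> into the palindrome around
  \<open>r4\<close>, a reflection in a root orthogonal to that of \<open>e4\<close>.\<close>

lemma e4_comm: "r3 (r2 (r3 (r4 (r3 (r2 (r3 (e4 x))))))) = e4 (r3 (r2 (r3 (r4 (r3 (r2 (r3 x)))))))"
proof -
  have "r2 (r3 (r2 (r4 (r3 (e4 x))))) = r4 (r3 (e4 (r3 (r4 (r2 (r3 (r2 (r4 (r3 x)))))))))"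
    using r232e3[of "r4 (r3 x)"] by (simp add: e3_eq)
  from arg_cong[OF this, of "\<lambda>z. r3 (r4 z)"] show ?thesis
    by simp
qed

lemma e4_r3_e4: "e4 (r3 (e4 x)) = e4 x"
proof -
  have "e4 (r3 (e4 x)) = e4 (r4 (r3 (e4 x)))"
    by (simp only: er)
  also have "\<dots> = e4 (e3 (e4 x))"
    using braid[of f3 f4 x] by simp
  also have "\<dots> = r3 (r4 (e3 (e4 x)))"
    using braid[of f4 f3 "e4 x"] by simp
  also have "e3 (e4 x) = r4 (r3 (e4 x))"
    using braid[of f3 f4 x] by simp
  finally show ?thesis
    by simp
qed

text \<open>The conjugator that defines \<open>t\<close> from \<open>e4\<close> also takes
  \<open>e2\<close> to \<open>e1\<close>. Thus \<open>t\<close> and \<open>e1\<close> will commute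
  because \<open>e4\<close> and \<open>e2\<close> do.\<close>

lemma e1_u: "e1 (r4 (r3 (r2 (r1 (r3 (r2 (r3 x))))))) = r4 (r3 (r2 (r1 (r3 (r2 (r3 (e2 x)))))))"
proof -
  have e1_r3: "e1 (r3 y) = r3 (e1 y)" and e1_r4: "e1 (r4 y) = r4 (e1 y)" for y
    using comm[of f1 f3] comm[of f1 f4] by simp_all
  have e1_21: "e1 (r2 (r1 y)) = r2 (r1 (e2 y))" for y
    by (simp add: e2_eq)
  have e2_323: "e2 (r3 (r2 (r3 y))) = r3 (r2 (r3 (e2 y)))" for y
  proof -
    have "e2 (r3 (r2 (r3 y))) = e2 y"
      using e2r32[of "r3 y"] by simp
    also have "\<dots> = r3 (r2 (r3 (e2 y)))"
      using r23e2[of y] by simp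
    finally show ?thesis .
  qed
  show ?thesis
    by (simp only: e1_r3 e1_r4 e1_21 e2_323)
qed

lemma r2_r1_e2: "r2 (r1 (e2 x)) = e1 (e2 x)"
  using braid[of f1 f2 x] by simp

text \<open>Passing through the conjugator turns \<open>r1\<close> into \<open>r2\<close>, which
  commutes with \<open>e4\<close>; the other half of the conjugator turns it back. The next two
  lemmas do the same with \<open>r1\<close> and with the reflection of
  \<open>e4_comm\<close>.\<close>

lemma wt1 [simp]: "t (r1 x) = r1 (t x)"
  proof -
  have "r3 (r2 (r3 (r1 (r2 (r3 (r4 (r1 x))))))) = r2 (r3 (r2 (r3 (r1 (r2 (r3 (r4 x)))))))"
    by simp
  moreover have "e4 (r2 z) = r2 (e4 z)" for z
    using comm[of f4 f2] by simp
  moreover have "r4 (r3 (r2 (r1 (r3 (r2 (r3 (r2 z))))))) = r1 (r4 (r3 (r2 (r1 (r3 (r2 (r3 z)))))))" for z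
    by simp
  ultimately show ?thesis
    by (simp only: t_def)
qed

lemma wt2 [simp]: "t (r2 x) = r2 (t x)"
  proof -
  have "r3 (r2 (r3 (r1 (r2 (r3 (r4 (r2 x))))))) = r1 (r3 (r2 (r3 (r1 (r2 (r3 (r4 x)))))))"
    by simp
  moreover have "e4 (r1 z) = r1 (e4 z)" for z
    using comm[of f4 f1] by simp
  moreover have "r4 (r3 (r2 (r1 (r3 (r2 (r3 (r1 z))))))) = r2 (r4 (r3 (r2 (r1 (r3 (r2 (r3 z)))))))" for z
    by simp
  ultimately show ?thesis
    by (simp only: t_def)
qed

lemma wt3 [simp]: "t (r3 x) = r3 (t x)"
  proof -
  have "r3 (r2 (r3 (r1 (r2 (r3 (r4 (r3 x))))))) = r3 (r2 (r3 (r4 (r3 (r2 (r3 (r3 (r2 (r3 (r1 (r2 (r3 (r4 x)))))))))))))"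
    by simp
  moreover have "e4 (r3 (r2 (r3 (r4 (r3 (r2 (r3 z))))))) = r3 (r2 (r3 (r4 (r3 (r2 (r3 (e4 z)))))))" for z
    by (rule e4_comm[symmetric])
  moreover have "r4 (r3 (r2 (r1 (r3 (r2 (r3 (r3 (r2 (r3 (r4 (r3 (r2 (r3 z))))))))))))) = r3 (r4 (r3 (r2 (r1 (r3 (r2 (r3 z)))))))" for z
    by simp
  ultimately show ?thesis
    by (simp only: t_def)
qed

lemma wtt [simp]: "t (t x) = dd (t x)"
  by (simp only: t_def rr ee_long insert_iff simp_thms f_dd)

lemma wt4t [simp]: "t (r4 (t x)) = t x"
  proof -
  \<comment> \<open>Conjugated back to \<open>e4\<close>, the letter \<open>r4\<close> becomes
    \<open>w r3 w'\<close> with \<open>w\<close> and its inverse \<open>w'\<close> commuting with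
    \<open>e4\<close>. So the claim reduces to \<open>e4 r3 e4 = e4\<close>.\<close>
  have conj: "r3 (r2 (r3 (r1 (r2 (r3 (r4 (r4 (r4 (r3 (r2 (r1 (r3 (r2 (r3 z)))))))))))))) = r3 (r2 (r3 (r4 (r3 (r2 (r3 (r1 (r2 (r3 (r2 (r1 (r3 (r2 (r3 (r4 (r3 (r2 (r3 z))))))))))))))))))" for z
    by simp
  have e4_r1: "e4 (r1 z) = r1 (e4 z)" and e4_r2: "e4 (r2 z) = r2 (e4 z)" for z
    using comm[of f4 f1] comm[of f4 f2] by simp_all
  have left: "e4 (r3 (r2 (r3 (r4 (r3 (r2 (r3 (r1 (r2 z))))))))) = r3 (r2 (r3 (r4 (r3 (r2 (r3 (r1 (r2 (e4 z)))))))))" for z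
    by (simp only: e4_comm[symmetric] e4_r1 e4_r2)
  have right: "r2 (r1 (r3 (r2 (r3 (r4 (r3 (r2 (r3 (e4 z))))))))) = e4 (r2 (r1 (r3 (r2 (r3 (r4 (r3 (r2 (r3 z)))))))))" for z
    by (simp only: e4_comm e4_r1[symmetric] e4_r2[symmetric])
  have "e4 (r3 (r2 (r3 (r4 (r3 (r2 (r3 (r1 (r2 (r3 (r2 (r1 (r3 (r2 (r3 (r4 (r3 (r2 (r3 (e4 z)))))))))))))))))))) = e4 z" for z
  proof -
    have "e4 (r3 (r2 (r3 (r4 (r3 (r2 (r3 (r1 (r2 (r3 (r2 (r1 (r3 (r2 (r3 (r4 (r3 (r2 (r3 (e4 z)))))))))))))))))))) = r3 (r2 (r3 (r4 (r3 (r2 (r3 (r1 (r2 (e4 (r2 (r1 (r3 (r2 (r3 (r4 (r3 (r2 (r3 z))))))))))))))))))"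
      by (simp only: left right e4_r3_e4)
    also have "\<dots> = e4 (r3 (r2 (r3 (r4 (r3 (r2 (r3 (r1 (r2 (r2 (r1 (r3 (r2 (r3 (r4 (r3 (r2 (r3 z))))))))))))))))))"
      by (simp only: left)
    finally show ?thesis
      by simp
  qed
  then show ?thesis
    by (simp only: t_def conj)
qed

lemma wte [simp]: "t (e1 x) = e1 (t x)"
  proof -
  have "e1 x = r4 (r3 (r2 (r1 (r3 (r2 (r3 (e2 (r3 (r2 (r3 (r1 (r2 (r3 (r4 x))))))))))))))"
    using e1_u[of "r3 (r2 (r3 (r1 (r2 (r3 (r4 x))))))"] by simp
  then have "r3 (r2 (r3 (r1 (r2 (r3 (r4 (e1 x))))))) = e2 (r3 (r2 (r3 (r1 (r2 (r3 (r4 x)))))))"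
    by simp
  moreover have "e4 (e2 z) = e2 (e4 z)" for z
    using comm[of f4 f2] by simp
  ultimately show ?thesis
    by (simp only: t_def e1_u)
qed

section \<open>The remaining relations in the letters \<open>e1\<close> and \<open>t\<close>\<close>

lemma w1e [simp]: "r1 (e1 x) = e1 x"
  by (rule re)

lemma we1 [simp]: "e1 (r1 x) = e1 x"
  by (rule er)

lemma wee [simp]: "e1 (e1 x) = dd (dd (e1 x))"
  by (simp add: ee_short)

lemma we3 [simp]: "e1 (r3 x) = r3 (e1 x)"
  using comm[of f1 f3] by simp

lemma we4 [simp]: "e1 (r4 x) = r4 (e1 x)"
  using comm[of f1 f4] by simp

text \<open>In this and the following rules the argument given to the relation, and the context
  added by \<open>arg_cong\<close>, cancel the reflections that conjugate \<open>e2\<close> to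
  \<open>e1\<close> and \<open>e3\<close> to \<open>t\<close>.\<close>

lemma we2e [simp]: "e1 (r2 (e1 x)) = e1 x"
  using r2_r1_e2[of "r1 (r2 x)"]
  by (simp add: e2_eq e3_eq e4_eq)

lemma w2132e [simp]: "r2 (r1 (r3 (r2 (e1 x)))) = r1 (r3 (r2 (e1 x)))"
  using r23e2[of "r1 (r2 x)"]
  by (simp add: e2_eq e3_eq e4_eq)

lemma we2132 [simp]: "e1 (r2 (r1 (r3 (r2 x)))) = e1 (r2 (r1 (r3 x)))"
  using arg_cong[OF e2r32[of "x"], of "\<lambda>z. r2 (r1 z)"]
  by (simp add: e2_eq e3_eq e4_eq)

lemma we232e [simp]: "e1 (r2 (r3 (r2 (e1 x)))) = dd (e1 x)"
  using arg_cong[OF e2r3e2[of "r1 (r2 x)"], of "\<lambda>z. r2 (r1 z)"]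
  by (simp add: e2_eq e3_eq e4_eq)

lemma w32143234t [simp]: "r3 (r2 (r1 (r4 (r3 (r2 (r3 (r4 (t x)))))))) = r2 (r1 (r4 (r3 (r2 (r3 (r4 (t x)))))))"
  using re[of f3 "r4 (r3 (r3 (r2 (r3 (r1 (r2 (r3 (r4 x))))))))"]
  by (simp add: e2_eq e3_eq e4_eq)

lemma wt43213243 [simp]: "t (r4 (r3 (r2 (r1 (r3 (r2 (r4 (r3 x)))))))) = t (r4 (r3 (r2 (r1 (r3 (r2 (r4 x)))))))"
  using arg_cong[OF er[of f3 "x"], of "\<lambda>z. r4 (r3 (r2 (r1 (r3 (r2 (r3 (r3 (r4 z))))))))"]
  by (simp add: e2_eq e3_eq e4_eq)

lemma w12143234t432134e243234t [simp]: "r1 (r2 (r1 (r4 (r3 (r2 (r3 (r4 (t (r4 (r3 (r2 (r1 (r3 (r4 (e1 (r2 (r4 (r3 (r2 (r3 (r4 (t x)))))))))))))))))))))) = r1 (r2 (r4 (r3 (r2 (r1 (r3 (r4 (t (r4 (r3 (r2 (r1 (r3 (r2 (r4 (t x))))))))))))))))"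
  using r2e3r2e3[of "r4 (r3 (r3 (r2 (r3 (r1 (r2 (r3 (r4 x))))))))"]
  by (simp add: e2_eq e3_eq e4_eq)

lemma w43e234t432134e [simp]: "r4 (r3 (e1 (r2 (r3 (r4 (t (r4 (r3 (r2 (r1 (r3 (r4 (e1 x))))))))))))) = dd (e1 x)"
  using arg_cong[OF e2e3e2[of "r1 (r2 x)"], of "\<lambda>z. r2 (r1 z)"]
  by (simp add: e2_eq e3_eq e4_eq)

lemma w43e2134t4321324 [simp]: "r4 (r3 (e1 (r2 (r1 (r3 (r4 (t (r4 (r3 (r2 (r1 (r3 (r2 (r4 x)))))))))))))) = e1 (r2 (r4 (r3 (r2 (r3 (r4 (t x)))))))"
  using arg_cong[OF e2e3r2[of "r4 (r3 (r3 (r2 (r3 (r1 (r2 (r3 (r4 x))))))))"], of "\<lambda>z. r2 (r1 z)"]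
  by (simp add: e2_eq e3_eq e4_eq)

section \<open>Critical pairs of the rules of type F4\<close>

lemma w13e [simp]: "r1 (r3 (e1 x)) = r3 (e1 x)"
  using w31[of "e1 x", symmetric] by simp

lemma w14e [simp]: "r1 (r4 (e1 x)) = r4 (e1 x)"
  using w41[of "e1 x", symmetric] by simp

lemma we24 [simp]: "e1 (r2 (r4 x)) = r4 (e1 (r2 x))"
  using we4[of "r2 x"] by simp

text \<open>The newer rules have made the left side of the older rule reducible. Deleting the older
  rule from the simpset lets both of its sides be reduced, which gives its replacement.\<close>

lemma w12143234t4323e23234t [simp]: "r1 (r2 (r1 (r4 (r3 (r2 (r3 (r4 (t (r4 (r3 (r2 (r3 (e1 (r2 (r3 (r2 (r3 (r4 (t x))))))))))))))))))) = r1 (r2 (r4 (r3 (r2 (r1 (r3 (r4 (t (r4 (r3 (r2 (r1 (r3 (r2 (r4 (t x))))))))))))))))"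
  using w12143234t432134e243234t by (simp del: w12143234t432134e243234t)

lemma wt4e [simp]: "t (r4 (e1 x)) = e1 (t (r4 x))"
  using wte[of "r4 x"] by simp

lemma wt43t [simp]: "t (r4 (r3 (t x))) = r3 (t x)"
  using wt4t[of "r3 x"] by simp

lemma we23e [simp]: "e1 (r2 (r3 (e1 x))) = r3 (e1 x)"
  using we2e[of "r3 x"] by simp

lemma w134e [simp]: "r1 (r3 (r4 (e1 x))) = r3 (r4 (e1 x))"
  using w13e[of "r4 x"] by simp

lemma w43e234t43234e [simp]: "r4 (r3 (e1 (r2 (r3 (r4 (t (r4 (r3 (r2 (r3 (r4 (e1 x)))))))))))) = dd (e1 x)"
  using w43e234t432134e by (simp del: w43e234t432134e)

lemma we214 [simp]: "e1 (r2 (r1 (r4 x))) = r4 (e1 (r2 (r1 x)))"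
  using we24[of "r1 x"] by simp

lemma wt43e [simp]: "t (r4 (r3 (e1 x))) = e1 (t (r4 (r3 x)))"
  using wt4e[of "r3 x"] by simp

lemma we2323 [simp]: "e1 (r2 (r3 (r2 (r3 x)))) = r3 (e1 (r2 (r3 (r2 x))))"
  using we3[of "r2 (r3 (r2 x))"] by simp

lemma w12143234t432e2324t [simp]: "r1 (r2 (r1 (r4 (r3 (r2 (r3 (r4 (t (r4 (r3 (r2 (e1 (r2 (r3 (r2 (r4 (t x))))))))))))))))) = r1 (r2 (r4 (r3 (r2 (r1 (r3 (r4 (t (r4 (r3 (r2 (r1 (r3 (r2 (r4 (t x))))))))))))))))"
  using w12143234t4323e23234t by (simp del: w12143234t4323e23234t)

lemma we2343 [simp]: "e1 (r2 (r3 (r4 (r3 x)))) = r4 (e1 (r2 (r3 (r4 x))))"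
  using we24[of "r3 (r4 x)"] by simp

lemma wt432t [simp]: "t (r4 (r3 (r2 (t x)))) = r3 (r2 (t x))"
  using wt43t[of "r2 x"] by simp

lemma we234e [simp]: "e1 (r2 (r3 (r4 (e1 x)))) = r3 (r4 (e1 x))"
  using we23e[of "r4 x"] by simp

lemma w21432e [simp]: "r2 (r1 (r4 (r3 (r2 (e1 x))))) = r1 (r4 (r3 (r2 (e1 x))))"
  using w42[of "r1 (r3 (r2 (e1 x)))", symmetric] by simp

lemma w21323e [simp]: "r2 (r1 (r3 (r2 (r3 (e1 x))))) = r1 (r3 (r2 (r3 (e1 x))))"
  using w2132e[of "r3 x"] by simp

lemma w21324e [simp]: "r2 (r1 (r3 (r2 (r4 (e1 x))))) = r1 (r3 (r2 (r4 (e1 x))))"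
  using w2132e[of "r4 x"] by simp

lemma we2324e [simp]: "e1 (r2 (r3 (r2 (r4 (e1 x))))) = dd (r4 (e1 x))"
  using we232e[of "r4 x"] by simp

lemma wet432e [simp]: "e1 (t (r4 (r3 (r2 (e1 x))))) = e1 (t (r4 (r3 x)))"
  using wt43e[of "r2 (e1 x)", symmetric] by simp

lemma wt4321t [simp]: "t (r4 (r3 (r2 (r1 (t x))))) = r3 (r2 (r1 (t x)))"
  using wt432t[of "r1 x"] by simp

lemma wt4323t [simp]: "t (r4 (r3 (r2 (r3 (t x))))) = r3 (r2 (r3 (t x)))"
  using wt432t[of "r3 x"] by simp

lemma wt432et [simp]: "t (r4 (r3 (r2 (e1 (t x))))) = r3 (r2 (e1 (t x)))"
  using wt432t[of "e1 x"] by simp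

lemma w1232e [simp]: "r1 (r2 (r3 (r2 (e1 x)))) = r2 (r3 (r2 (e1 x)))"
  using w212[of "r1 (r3 (r2 (e1 x)))", symmetric] by simp

lemma w12323e [simp]: "r1 (r2 (r3 (r2 (r3 (e1 x))))) = r2 (r3 (r2 (r3 (e1 x))))"
  using w31[of "r2 (r3 (r2 (e1 x)))", symmetric] by simp

lemma w12432e [simp]: "r1 (r2 (r4 (r3 (r2 (e1 x))))) = r2 (r4 (r3 (r2 (e1 x))))"
  using w41[of "r2 (r3 (r2 (e1 x)))", symmetric] by simp

lemma w12324e [simp]: "r1 (r2 (r3 (r2 (r4 (e1 x))))) = r2 (r3 (r2 (r4 (e1 x))))"
  using w1232e[of "r4 x"] by simp

lemma we2321 [simp]: "e1 (r2 (r3 (r2 (r1 x)))) = e1 (r2 (r3 (r2 x)))"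
  using we2132[of "r1 (r2 x)"] by simp

lemma we2t432e [simp]: "e1 (r2 (t (r4 (r3 (r2 (e1 x)))))) = dd (e1 (t (r4 x)))"
  using wt4e[of "r2 (r3 (r2 (e1 x)))", symmetric] by simp

lemma w21t432e [simp]: "r2 (r1 (t (r4 (r3 (r2 (e1 x)))))) = r1 (t (r4 (r3 (r2 (e1 x)))))"
  using wt2[of "r1 (r4 (r3 (r2 (e1 x))))", symmetric] by simp

lemma w214323e [simp]: "r2 (r1 (r4 (r3 (r2 (r3 (e1 x)))))) = r1 (r4 (r3 (r2 (r3 (e1 x)))))"
  using w21432e[of "r3 x"] by simp

lemma w213432e [simp]: "r2 (r1 (r3 (r4 (r3 (r2 (e1 x)))))) = r1 (r3 (r4 (r3 (r2 (e1 x)))))"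
  using w21432e[of "r4 x"] by simp

lemma w213234e [simp]: "r2 (r1 (r3 (r2 (r3 (r4 (e1 x)))))) = r1 (r3 (r2 (r3 (r4 (e1 x)))))"
  using w21323e[of "r4 x"] by simp

lemma w124323e [simp]: "r1 (r2 (r4 (r3 (r2 (r3 (e1 x)))))) = r2 (r4 (r3 (r2 (r3 (e1 x)))))"
  using w41[of "r2 (r3 (r2 (r3 (e1 x))))", symmetric] by simp

lemma w123234e [simp]: "r1 (r2 (r3 (r2 (r3 (r4 (e1 x)))))) = r2 (r3 (r2 (r3 (r4 (e1 x)))))"
  using w12323e[of "r4 x"] by simp

lemma w132432e [simp]: "r1 (r3 (r2 (r4 (r3 (r2 (e1 x)))))) = r3 (r2 (r4 (r3 (r2 (e1 x)))))"
  using w31[of "r2 (r4 (r3 (r2 (e1 x))))", symmetric] by simp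

lemma w12t432e [simp]: "r1 (r2 (t (r4 (r3 (r2 (e1 x)))))) = r2 (t (r4 (r3 (r2 (e1 x)))))"
  using wt1[of "r2 (r4 (r3 (r2 (e1 x))))", symmetric] by simp

lemma w123432e [simp]: "r1 (r2 (r3 (r4 (r3 (r2 (e1 x)))))) = r2 (r3 (r4 (r3 (r2 (e1 x)))))"
  using w12432e[of "r4 x"] by simp

lemma we2324323 [simp]: "e1 (r2 (r3 (r2 (r4 (r3 (r2 (r3 x))))))) = r4 (e1 (r2 (r3 (r2 (r4 (r3 (r2 x)))))))"
  using we2343[of "r2 (r3 (r2 x))"] by simp

lemma wet43234e [simp]: "e1 (t (r4 (r3 (r2 (r3 (r4 (e1 x))))))) = e1 (t x)"
  using wt43e[of "r2 (r3 (r4 (e1 x)))", symmetric] by simp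

lemma w214t432e [simp]: "r2 (r1 (r4 (t (r4 (r3 (r2 (e1 x))))))) = r1 (r4 (t (r4 (r3 (r2 (e1 x))))))"
  using w42[of "r1 (t (r4 (r3 (r2 (e1 x)))))", symmetric] by simp

lemma w21t4323e [simp]: "r2 (r1 (t (r4 (r3 (r2 (r3 (e1 x))))))) = r1 (t (r4 (r3 (r2 (r3 (e1 x))))))"
  using w21t432e[of "r3 x"] by simp

lemma w2143234e [simp]: "r2 (r1 (r4 (r3 (r2 (r3 (r4 (e1 x))))))) = r1 (r4 (r3 (r2 (r3 (r4 (e1 x))))))"
  using w214323e[of "r4 x"] by simp

lemma w1324323e [simp]: "r1 (r3 (r2 (r4 (r3 (r2 (r3 (e1 x))))))) = r3 (r2 (r4 (r3 (r2 (r3 (e1 x))))))"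
  using w31[of "r2 (r4 (r3 (r2 (r3 (e1 x)))))", symmetric] by simp

lemma w1243234e [simp]: "r1 (r2 (r4 (r3 (r2 (r3 (r4 (e1 x))))))) = r2 (r4 (r3 (r2 (r3 (r4 (e1 x))))))"
  using w124323e[of "r4 x"] by simp

lemma w1323432e [simp]: "r1 (r3 (r2 (r3 (r4 (r3 (r2 (e1 x))))))) = r3 (r2 (r3 (r4 (r3 (r2 (e1 x))))))"
  using w132432e[of "r4 x"] by simp

lemma w124t432e [simp]: "r1 (r2 (r4 (t (r4 (r3 (r2 (e1 x))))))) = r2 (r4 (t (r4 (r3 (r2 (e1 x))))))"
  using w41[of "r2 (t (r4 (r3 (r2 (e1 x)))))", symmetric] by simp

lemma w123t432e [simp]: "r1 (r2 (r3 (t (r4 (r3 (r2 (e1 x))))))) = r2 (r3 (t (r4 (r3 (r2 (e1 x))))))"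
  using w12t432e[of "r4 x"] by simp

lemma we232432e [simp]: "e1 (r2 (r3 (r2 (r4 (r3 (r2 (e1 x))))))) = r3 (r4 (r3 (e1 x)))"
  using we2321[of "r4 (r3 (r2 (e1 x)))", symmetric] by simp

lemma w21t43234e [simp]: "r2 (r1 (t (r4 (r3 (r2 (r3 (r4 (e1 x)))))))) = r1 (t (r4 (r3 (r2 (r3 (r4 (e1 x)))))))"
  using w21t4323e[of "r4 x"] by simp

lemma w13243234e [simp]: "r1 (r3 (r2 (r4 (r3 (r2 (r3 (r4 (e1 x)))))))) = r3 (r2 (r4 (r3 (r2 (r3 (r4 (e1 x)))))))"
  using w1324323e[of "r4 x"] by simp

lemma w1324t432e [simp]: "r1 (r3 (r2 (r4 (t (r4 (r3 (r2 (e1 x)))))))) = r3 (r2 (r4 (t (r4 (r3 (r2 (e1 x)))))))"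
  using w31[of "r2 (r4 (t (r4 (r3 (r2 (e1 x))))))", symmetric] by simp

lemma w343213234t [simp]: "r3 (r4 (r3 (r2 (r1 (r3 (r2 (r3 (r4 (t x))))))))) = r2 (r1 (r3 (r2 (r3 (r4 (t x))))))"
  using w43214[of "r3 (r2 (r3 (r4 (t x))))", symmetric] by simp

lemma w3e21t [simp]: "r3 (e1 (r2 (r1 (t x)))) = e1 (r2 (r1 (t x)))"
  using we3[of "r2 (r1 (r4 (r3 (r2 (r3 (r4 (t x)))))))", symmetric] by simp

lemma w3e2t [simp]: "r3 (e1 (r2 (t x))) = e1 (r2 (t x))"
  using w3e21t[of "r1 x"] by simp

lemma w3et [simp]: "r3 (e1 (t x)) = e1 (t x)"
  using w3e2t[of "r2 x"] by simp

lemma w343234et [simp]: "r3 (r4 (r3 (r2 (r3 (r4 (e1 (t x))))))) = r4 (r3 (r2 (r3 (r4 (e1 (t x))))))"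
  using w432343[of "e1 (t x)", symmetric] by simp

lemma w3t43234et [simp]: "r3 (t (r4 (r3 (r2 (r3 (r4 (e1 (t x)))))))) = t (r4 (r3 (r2 (r3 (r4 (e1 (t x)))))))"
  using wt3[of "r4 (r3 (r2 (r3 (r4 (e1 (t x))))))", symmetric] by simp

lemma w232t43234e [simp]: "r2 (r3 (r2 (t (r4 (r3 (r2 (r3 (r4 (e1 x))))))))) = t (r4 (r3 (r2 (r3 (r4 (e1 x))))))"
  using wt43213243[of "r2 (e1 x)"] by simp

lemma we2324t432e [simp]: "e1 (r2 (r3 (r2 (r4 (t (r4 (r3 (r2 (e1 x))))))))) = e1 (r2 (r1 (r3 (r4 (t (r4 (r3 (r2 (e1 x)))))))))"
  using we2321[of "r4 (t (r4 (r3 (r2 (e1 x)))))", symmetric] by simp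

text \<open>Inserting \<open>r3 r3\<close> in front and applying \<open>w343213234t\<close> strips
  the leading reflection of that rule. Most later uses of \<open>rr\<close> shorten a left side in
  this way.\<close>

lemma w43213234t [simp]: "r4 (r3 (r2 (r1 (r3 (r2 (r3 (r4 (t x)))))))) = r3 (r2 (r1 (r3 (r2 (r3 (r4 (t x)))))))"
  using rr[of f3 "r4 (r3 (r2 (r1 (r3 (r2 (r3 (r4 (t x))))))))", symmetric] by simp

lemma w32t43234e [simp]: "r3 (r2 (t (r4 (r3 (r2 (r3 (r4 (e1 x)))))))) = r2 (t (r4 (r3 (r2 (r3 (r4 (e1 x)))))))"
  using rr[of f2 "r3 (r2 (t (r4 (r3 (r2 (r3 (r4 (e1 x))))))))", symmetric] by simp

lemma w32t4323e [simp]: "r3 (r2 (t (r4 (r3 (r2 (r3 (e1 x))))))) = r2 (t (r4 (r3 (r2 (r3 (e1 x))))))"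
  using w32t43234e[of "r4 x"] by simp

lemma w32t432e [simp]: "r3 (r2 (t (r4 (r3 (r2 (e1 x)))))) = r2 (t (r4 (r3 (r2 (e1 x)))))"
  using w32t4323e[of "r3 x"] by simp

lemma w323t432e [simp]: "r3 (r2 (r3 (t (r4 (r3 (r2 (e1 x))))))) = r2 (r3 (t (r4 (r3 (r2 (e1 x))))))"
  using w32t432e[of "r4 x"] by simp

lemma w3243234t432e [simp]: "r3 (r2 (r4 (r3 (r2 (r3 (r4 (t (r4 (r3 (r2 (e1 x))))))))))) = r2 (r4 (r3 (r2 (r3 (r4 (t (r4 (r3 (r2 (e1 x))))))))))"
  using w432343[of "r2 (t (r4 (r3 (r2 (e1 x)))))", symmetric] by simp

lemma w3e234t43234e [simp]: "r3 (e1 (r2 (r3 (r4 (t (r4 (r3 (r2 (r3 (r4 (e1 x))))))))))) = dd (r4 (e1 x))"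
  using rr[of f4 "r3 (e1 (r2 (r3 (r4 (t (r4 (r3 (r2 (r3 (r4 (e1 x)))))))))))", symmetric] by simp

lemma we234t43234e [simp]: "e1 (r2 (r3 (r4 (t (r4 (r3 (r2 (r3 (r4 (e1 x)))))))))) = dd (r3 (r4 (e1 x)))"
  using rr[of f3 "e1 (r2 (r3 (r4 (t (r4 (r3 (r2 (r3 (r4 (e1 x))))))))))", symmetric] by simp

lemma we234t4323e [simp]: "e1 (r2 (r3 (r4 (t (r4 (r3 (r2 (r3 (e1 x))))))))) = dd (r3 (e1 x))"
  using we234t43234e[of "r4 x"] by simp

lemma we234t432e [simp]: "e1 (r2 (r3 (r4 (t (r4 (r3 (r2 (e1 x)))))))) = dd (e1 x)"
  using we234t4323e[of "r3 x"] by simp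

lemma w3e2134t4321324 [simp]: "r3 (e1 (r2 (r1 (r3 (r4 (t (r4 (r3 (r2 (r1 (r3 (r2 (r4 x))))))))))))) = r3 (e1 (r2 (r3 (r2 (r4 (t x))))))"
  using rr[of f4 "r3 (e1 (r2 (r1 (r3 (r4 (t (r4 (r3 (r2 (r1 (r3 (r2 (r4 x)))))))))))))", symmetric] by simp

lemma we2134t4321324 [simp]: "e1 (r2 (r1 (r3 (r4 (t (r4 (r3 (r2 (r1 (r3 (r2 (r4 x)))))))))))) = e1 (r2 (r3 (r2 (r4 (t x)))))"
  using rr[of f3 "e1 (r2 (r1 (r3 (r4 (t (r4 (r3 (r2 (r1 (r3 (r2 (r4 x))))))))))))", symmetric] by simp

lemma we2134t432132 [simp]: "e1 (r2 (r1 (r3 (r4 (t (r4 (r3 (r2 (r1 (r3 (r2 x))))))))))) = e1 (r2 (r3 (r2 (r4 (t (r4 x))))))"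
  using we2134t4321324[of "r4 x"] by simp

lemma we2134t43213 [simp]: "e1 (r2 (r1 (r3 (r4 (t (r4 (r3 (r2 (r1 (r3 x)))))))))) = e1 (r2 (r3 (r4 (t (r4 x)))))"
  using we2134t432132[of "r2 x"] by simp

lemma we2134t4321 [simp]: "e1 (r2 (r1 (r3 (r4 (t (r4 (r3 (r2 (r1 x))))))))) = e1 (r2 (r3 (r4 (t (r4 (r3 x))))))"
  using we2134t43213[of "r3 x"] by simp

lemma we2134t432 [simp]: "e1 (r2 (r1 (r3 (r4 (t (r4 (r3 (r2 x)))))))) = e1 (r2 (r1 (r3 (r4 (t (r4 (r3 x)))))))"
  using we2134t4321[of "r1 x"] by simp

lemma we234t4321 [simp]: "e1 (r2 (r3 (r4 (t (r4 (r3 (r2 (r1 x)))))))) = e1 (r2 (r3 (r4 (t (r4 (r3 (r2 x)))))))"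
  using we2134t432[of "r1 (r2 x)"] by simp

lemma we2324t432132 [simp]: "e1 (r2 (r3 (r2 (r4 (t (r4 (r3 (r2 (r1 (r3 (r2 x))))))))))) = e1 (r2 (r3 (r2 (r4 (t (r4 (r3 (r2 (r1 (r3 x))))))))))"
  using we234t4321[of "r3 (r2 (r1 x))"] by simp

lemma w2143234t432e2324t [simp]: "r2 (r1 (r4 (r3 (r2 (r3 (r4 (t (r4 (r3 (r2 (e1 (r2 (r3 (r2 (r4 (t x)))))))))))))))) = r2 (r4 (r3 (r2 (r1 (r3 (r4 (t (r4 (r3 (r2 (r1 (r3 (r2 (r4 (t x)))))))))))))))"
  using rr[of f1 "r2 (r1 (r4 (r3 (r2 (r3 (r4 (t (r4 (r3 (r2 (e1 (r2 (r3 (r2 (r4 (t x))))))))))))))))", symmetric] by simp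

lemma w143234t432e2324t [simp]: "r1 (r4 (r3 (r2 (r3 (r4 (t (r4 (r3 (r2 (e1 (r2 (r3 (r2 (r4 (t x))))))))))))))) = r4 (r3 (r2 (r1 (r3 (r4 (t (r4 (r3 (r2 (r1 (r3 (r2 (r4 (t x))))))))))))))"
  using rr[of f2 "r1 (r4 (r3 (r2 (r3 (r4 (t (r4 (r3 (r2 (e1 (r2 (r3 (r2 (r4 (t x)))))))))))))))", symmetric] by simp

lemma w13234t432e2324t [simp]: "r1 (r3 (r2 (r3 (r4 (t (r4 (r3 (r2 (e1 (r2 (r3 (r2 (r4 (t x)))))))))))))) = r3 (r2 (r1 (r3 (r4 (t (r4 (r3 (r2 (r1 (r3 (r2 (r4 (t x)))))))))))))"
  using w41[of "r4 (r3 (r2 (r3 (r4 (t (r4 (r3 (r2 (e1 (r2 (r3 (r2 (r4 (t x))))))))))))))", symmetric] by simp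

lemma w132134t4321324t [simp]: "r1 (r3 (r2 (r1 (r3 (r4 (t (r4 (r3 (r2 (r1 (r3 (r2 (r4 (t x)))))))))))))) = r3 (r2 (r3 (r4 (t (r4 (r3 (r2 (e1 (r2 (r3 (r2 (r4 (t x)))))))))))))"
  using rr[of f1 "r3 (r2 (r3 (r4 (t (r4 (r3 (r2 (e1 (r2 (r3 (r2 (r4 (t x)))))))))))))"] by simp

lemma w1234t432e2324t [simp]: "r1 (r2 (r3 (r4 (t (r4 (r3 (r2 (e1 (r2 (r3 (r2 (r4 (t x))))))))))))) = r2 (r1 (r3 (r4 (t (r4 (r3 (r2 (r1 (r3 (r2 (r4 (t x))))))))))))"
  using w31[of "r3 (r2 (r3 (r4 (t (r4 (r3 (r2 (e1 (r2 (r3 (r2 (r4 (t x)))))))))))))", symmetric] by simp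

lemma w12134t432e2324t [simp]: "r1 (r2 (r1 (r3 (r4 (t (r4 (r3 (r2 (e1 (r2 (r3 (r2 (r4 (t x)))))))))))))) = r1 (r3 (r4 (t (r4 (r3 (r2 (r1 (r3 (r2 (r4 (t x)))))))))))"
  using w212[of "r3 (r4 (t (r4 (r3 (r2 (e1 (r2 (r3 (r2 (r4 (t x)))))))))))", symmetric] by simp

lemma w23t432e2324t [simp]: "r2 (r3 (t (r4 (r3 (r2 (e1 (r2 (r3 (r2 (r4 (t x))))))))))) = r2 (r1 (r3 (t (r4 (r3 (r2 (r1 (r3 (r2 (r4 (t x)))))))))))"
  using wt1[of "r2 (r3 (r4 (t (r4 (r3 (r2 (e1 (r2 (r3 (r2 (r4 (t x))))))))))))", symmetric] by simp

lemma w3t432e2324t [simp]: "r3 (t (r4 (r3 (r2 (e1 (r2 (r3 (r2 (r4 (t x)))))))))) = r1 (r3 (t (r4 (r3 (r2 (r1 (r3 (r2 (r4 (t x))))))))))"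
  using rr[of f2 "r3 (t (r4 (r3 (r2 (e1 (r2 (r3 (r2 (r4 (t x))))))))))", symmetric] by simp

lemma wt432e2324t [simp]: "t (r4 (r3 (r2 (e1 (r2 (r3 (r2 (r4 (t x))))))))) = r1 (t (r4 (r3 (r2 (r1 (r3 (r2 (r4 (t x)))))))))"
  using rr[of f3 "t (r4 (r3 (r2 (e1 (r2 (r3 (r2 (r4 (t x)))))))))", symmetric] by simp

lemma w1234t4321324t [simp]: "r1 (r2 (r3 (r4 (t (r4 (r3 (r2 (r1 (r3 (r2 (r4 (t x)))))))))))) = r1 (r3 (r4 (t (r4 (r3 (r2 (r1 (r3 (r2 (r4 (t x)))))))))))"
  using w12134t432e2324t by (simp del: w12134t432e2324t)

text \<open>A descendant of \<open>r2e3r2e3\<close> after all stripping: it trades the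
  \<open>e1\<close> between two conjugates of \<open>t\<close> for reflections, and so ties the
  exchanged pairs to the pairs of fixed roots.\<close>

lemma wt432e234t [simp]: "t (r4 (r3 (r2 (e1 (r2 (r3 (r4 (t x)))))))) = r1 (t (r4 (r3 (r2 (r1 (r3 (r4 (t x))))))))"
  using wt432e2324t[of "r2 x"] by simp

lemma wt432e2134t [simp]: "t (r4 (r3 (r2 (e1 (r2 (r1 (r3 (r4 (t x))))))))) = r1 (t (r4 (r3 (r2 (r3 (r4 (t x)))))))"
  using wt432e234t[of "r1 x"] by simp

lemma w1t43234et [simp]: "r1 (t (r4 (r3 (r2 (r3 (r4 (e1 (t x)))))))) = t (r4 (r3 (r2 (r3 (r4 (e1 (t x)))))))"
  using wt432e234t[of "e1 x", symmetric] by simp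

lemma w14t43234et [simp]: "r1 (r4 (t (r4 (r3 (r2 (r3 (r4 (e1 (t x))))))))) = r4 (t (r4 (r3 (r2 (r3 (r4 (e1 (t x))))))))"
  using w41[of "t (r4 (r3 (r2 (r3 (r4 (e1 (t x)))))))", symmetric] by simp

lemma w2t43234et [simp]: "r2 (t (r4 (r3 (r2 (r3 (r4 (e1 (t x)))))))) = t (r4 (r3 (r2 (r3 (r4 (e1 (t x)))))))"
  using w21t43234e[of "t x"] by simp

lemma w24t43234et [simp]: "r2 (r4 (t (r4 (r3 (r2 (r3 (r4 (e1 (t x))))))))) = r4 (t (r4 (r3 (r2 (r3 (r4 (e1 (t x))))))))"
  using w42[of "t (r4 (r3 (r2 (r3 (r4 (e1 (t x)))))))", symmetric] by simp

lemma w2t432134t [simp]: "r2 (t (r4 (r3 (r2 (r1 (r3 (r4 (t x)))))))) = t (r4 (r3 (r2 (r1 (r3 (r4 (t x)))))))"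
  using w21t432e[of "r2 (r3 (r4 (t x)))"] by simp

lemma w134t43234et [simp]: "r1 (r3 (r4 (t (r4 (r3 (r2 (r3 (r4 (e1 (t x)))))))))) = r3 (r4 (t (r4 (r3 (r2 (r3 (r4 (e1 (t x)))))))))"
  using w31[of "r4 (t (r4 (r3 (r2 (r3 (r4 (e1 (t x))))))))", symmetric] by simp

lemma w1t432134t432e [simp]: "r1 (t (r4 (r3 (r2 (r1 (r3 (r4 (t (r4 (r3 (r2 (e1 x)))))))))))) = dd (t (r4 (r3 (r2 (e1 x)))))"
  using wt432e234t[of "r4 (r3 (r2 (e1 x)))", symmetric] by simp

lemma w1t43234t432 [simp]: "r1 (t (r4 (r3 (r2 (r3 (r4 (t (r4 (r3 (r2 x)))))))))) = r1 (t (r4 (r3 (r2 (r3 (r4 (t (r4 (r3 x)))))))))"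
  using wt432e2134t[of "r4 (r3 (r2 x))", symmetric] by simp

lemma wt43234t432 [simp]: "t (r4 (r3 (r2 (r3 (r4 (t (r4 (r3 (r2 x))))))))) = t (r4 (r3 (r2 (r3 (r4 (t (r4 (r3 x))))))))"
  using rr[of f1 "t (r4 (r3 (r2 (r3 (r4 (t (r4 (r3 (r2 x)))))))))", symmetric] by simp

lemma w234t4321324t [simp]: "r2 (r3 (r4 (t (r4 (r3 (r2 (r1 (r3 (r2 (r4 (t x))))))))))) = r3 (r4 (t (r4 (r3 (r2 (r1 (r3 (r2 (r4 (t x))))))))))"
  using rr[of f1 "r2 (r3 (r4 (t (r4 (r3 (r2 (r1 (r3 (r2 (r4 (t x)))))))))))", symmetric] by simp

lemma w234t432134t [simp]: "r2 (r3 (r4 (t (r4 (r3 (r2 (r1 (r3 (r4 (t x)))))))))) = r3 (r4 (t (r4 (r3 (r2 (r1 (r3 (r4 (t x)))))))))"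
  using w234t4321324t[of "r2 x"] by simp

lemma w234t43234t [simp]: "r2 (r3 (r4 (t (r4 (r3 (r2 (r3 (r4 (t x))))))))) = r3 (r4 (t (r4 (r3 (r2 (r3 (r4 (t x))))))))"
  using w234t432134t[of "r1 x"] by simp

lemma w234t43234et [simp]: "r2 (r3 (r4 (t (r4 (r3 (r2 (r3 (r4 (e1 (t x)))))))))) = r3 (r4 (t (r4 (r3 (r2 (r3 (r4 (e1 (t x)))))))))"
  using w234t43234t[of "e1 x"] by simp

lemma wt432134t432e [simp]: "t (r4 (r3 (r2 (r1 (r3 (r4 (t (r4 (r3 (r2 (e1 x))))))))))) = dd (r1 (t (r4 (r3 (r2 (e1 x))))))"
  using rr[of f1 "t (r4 (r3 (r2 (r1 (r3 (r4 (t (r4 (r3 (r2 (e1 x)))))))))))", symmetric] by simp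

lemma w2134t432e [simp]: "r2 (r1 (r3 (r4 (t (r4 (r3 (r2 (e1 x)))))))) = r1 (r3 (r4 (t (r4 (r3 (r2 (e1 x)))))))"
  using w234t432134t[of "r4 (r3 (r2 (e1 x)))"] by simp

lemma w1234t432e [simp]: "r1 (r2 (r3 (r4 (t (r4 (r3 (r2 (e1 x)))))))) = r2 (r3 (r4 (t (r4 (r3 (r2 (e1 x)))))))"
  using w212[of "r1 (r3 (r4 (t (r4 (r3 (r2 (e1 x)))))))", symmetric] by simp

lemma w13234t432e [simp]: "r1 (r3 (r2 (r3 (r4 (t (r4 (r3 (r2 (e1 x))))))))) = r3 (r2 (r3 (r4 (t (r4 (r3 (r2 (e1 x))))))))"
  using w31[of "r2 (r3 (r4 (t (r4 (r3 (r2 (e1 x)))))))", symmetric] by simp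

lemma w143234t432e [simp]: "r1 (r4 (r3 (r2 (r3 (r4 (t (r4 (r3 (r2 (e1 x)))))))))) = r4 (r3 (r2 (r3 (r4 (t (r4 (r3 (r2 (e1 x)))))))))"
  using w41[of "r3 (r2 (r3 (r4 (t (r4 (r3 (r2 (e1 x))))))))", symmetric] by simp

lemma w13234t4323e [simp]: "r1 (r3 (r2 (r3 (r4 (t (r4 (r3 (r2 (r3 (e1 x)))))))))) = r3 (r2 (r3 (r4 (t (r4 (r3 (r2 (r3 (e1 x)))))))))"
  using w13234t432e[of "r3 x"] by simp

lemma w143234t4323e [simp]: "r1 (r4 (r3 (r2 (r3 (r4 (t (r4 (r3 (r2 (r3 (e1 x))))))))))) = r4 (r3 (r2 (r3 (r4 (t (r4 (r3 (r2 (r3 (e1 x))))))))))"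
  using w143234t432e[of "r3 x"] by simp

lemma w13234t43234e [simp]: "r1 (r3 (r2 (r3 (r4 (t (r4 (r3 (r2 (r3 (r4 (e1 x))))))))))) = r3 (r2 (r3 (r4 (t (r4 (r3 (r2 (r3 (r4 (e1 x))))))))))"
  using w13234t4323e[of "r4 x"] by simp

lemma w143234t43234e [simp]: "r1 (r4 (r3 (r2 (r3 (r4 (t (r4 (r3 (r2 (r3 (r4 (e1 x)))))))))))) = r4 (r3 (r2 (r3 (r4 (t (r4 (r3 (r2 (r3 (r4 (e1 x)))))))))))"
  using w143234t4323e[of "r4 x"] by simp

section \<open>Closure of the strata under multiplication\<close>

definition letter :: "nat \<Rightarrow> 'b \<Rightarrow> 'b" where
  "letter n = (if n = 1 then r1 else if n = 2 then r2 else if n = 3 then r3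
     else if n = 4 then r4 else if n = 5 then e1 else t)"

lemma letter_simps [simp]:
  "letter (Suc 0) = r1" "letter 1 = r1" "letter 2 = r2" "letter 3 = r3" "letter 4 = r4" "letter 5 = e1" "letter 6 = t"
  by (simp_all add: letter_def fun_eq_iff)

primrec actn :: "nat list \<Rightarrow> 'b \<Rightarrow> 'b" where
  "actn [] x = x"
| "actn (n # ns) x = letter n (actn ns x)"

lemma actn_append [simp]: "actn (u @ v) x = actn u (actn v x)"
  by (induction u) simp_all

lemma act_wd: "act f (wd ns) x = actn ns x"
  by (induction ns) (simp_all add: wd_def letter_word_def letter_def tword_def t_def)

text \<open>Since \<open>dd\<close> is invertible this is equality up to an integral power of
  \<delta>; a power on each side avoids negative iterates.\<close>

definition eqd :: "'b \<Rightarrow> 'b \<Rightarrow> bool" (infix "\<sim>" 50) where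
  "y \<sim> z \<longleftrightarrow> (\<exists>k l. (dd ^^ k) y = (dd ^^ l) z)"

lemma letter_dd [simp]: "letter n (dd x) = dd (letter n x)"
  by (simp add: letter_def)

lemma letter_ddn: "letter n ((dd ^^ k) x) = (dd ^^ k) (letter n x)"
  by (induction k) simp_all

lemma actn_ddn: "actn ns ((dd ^^ k) x) = (dd ^^ k) (actn ns x)"
  by (induction ns) (simp_all add: letter_ddn)

lemma eqd_refl [simp]: "y \<sim> y"
  unfolding eqd_def by blast

lemma eqd_trans [trans]:
  assumes "x \<sim> y" "y \<sim> z" shows "x \<sim> z"
proof -
  obtain k l m n where "(dd ^^ k) x = (dd ^^ l) y" "(dd ^^ m) y = (dd ^^ n) z"
    using assms unfolding eqd_def by blast
  then have "(dd ^^ (m + k)) x = (dd ^^ (l + n)) z"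
    by (metis add.commute funpow_add o_apply)
  then show ?thesis
    unfolding eqd_def by blast
qed

lemma eqd_dd [simp]: "dd y \<sim> z \<longleftrightarrow> y \<sim> z" "y \<sim> dd z \<longleftrightarrow> y \<sim> z"
proof -
  have *: "dd y \<sim> y" "y \<sim> dd y" for y
    unfolding eqd_def by (metis funpow_0 funpow_Suc_right o_apply)+
  show "dd y \<sim> z \<longleftrightarrow> y \<sim> z" "y \<sim> dd z \<longleftrightarrow> y \<sim> z"
    using * eqd_trans by blast+
qed

lemma actn_eqd: "y \<sim> z \<Longrightarrow> actn ns y \<sim> actn ns z"
  unfolding eqd_def by (metis actn_ddn)

text \<open>With an arbitrary set \<open>S\<close> the closure becomes a rewriting problem: each
  product of a letter and a listed word is reduced by the rules to a listed word, and the hypothesis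
  is then literally the goal. The closure lemmas below are stated in the same form.\<close>

lemma C48_closed:
  assumes "\<forall>h\<in>set C48. actn h x \<in> S"
  shows "\<forall>h\<in>set C48. r1 (actn h x) \<in> S \<and> r2 (actn h x) \<in> S \<and> r3 (actn h x) \<in> S"
  using assms by (simp add: C48_def)

lemma S6_closed:
  assumes "\<forall>h\<in>set S6. actn h x \<in> S"
  shows "\<forall>h\<in>set S6. r3 (actn h x) \<in> S \<and> r4 (actn h x) \<in> S"
  using assms by (simp add: S6_def)

text \<open>This is Deodhar's lemma: for a minimal coset representative \<open>b\<close> of a
  parabolic subgroup, a simple reflection times \<open>b\<close> is another representative, or
  \<open>b\<close> times a simple reflection of the subgroup.\<close>

lemma W24_closed:
  assumes "\<forall>b\<in>set W24. \<forall>g\<in>{[],[1],[2],[3]}. actn b (actn g x) \<in> S"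
  shows "\<forall>b\<in>set W24. r1 (actn b x) \<in> S \<and> r2 (actn b x) \<in> S \<and> r3 (actn b x) \<in> S \<and> r4 (actn b x) \<in> S"
  using assms by (simp add: W24_def)

lemma A1_closed:
  assumes "\<forall>b\<in>set A1. \<forall>g\<in>{[],[1],[2],[3]}. actn b (actn g (t x)) \<in> S"
  shows "\<forall>b\<in>set A1. r1 (actn b (t x)) \<in> S \<and> r2 (actn b (t x)) \<in> S \<and> r3 (actn b (t x)) \<in> S \<and> r4 (actn b (t x)) \<in> S"
  using assms by (simp add: A1_def W24_def)

text \<open>The factor on the right is only \<open>r3\<close> or \<open>r4\<close>, since
  \<open>e1\<close> absorbs \<open>r1\<close> and the rules for \<open>r2\<close> move the
  representative itself.\<close>

lemma A2_closed:
  assumes "\<forall>b\<in>set A2. \<forall>g\<in>{[],[3],[4]}. actn b (actn g (e1 x)) \<in> S"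
  shows "\<forall>b\<in>set A2. r1 (actn b (e1 x)) \<in> S \<and> r2 (actn b (e1 x)) \<in> S \<and> r3 (actn b (e1 x)) \<in> S \<and> r4 (actn b (e1 x)) \<in> S"
  using assms by (simp add: A2_def)

lemma A3_closed:
  assumes "\<forall>b\<in>set A3. actn b (e1 (t x)) \<in> S"
  shows "\<forall>b\<in>set A3. r1 (actn b (e1 (t x))) \<in> S \<and> r2 (actn b (e1 (t x))) \<in> S \<and> r3 (actn b (e1 (t x))) \<in> S \<and> r4 (actn b (e1 (t x))) \<in> S"
  using assms by (simp add: A3_def)

text \<open>Two long roots are proportional, at an acute or obtuse angle, or orthogonal. The
  products are accordingly a multiple of \<open>t\<close>, a reflection word times \<open>t\<close>,
  or a word through \<open>e1\<close>, which lies in a deeper stratum. \<open>X\<close> collects the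
  arguments that may appear behind an \<open>e1\<close>.\<close>

lemma A1_t:
  assumes dd: "\<And>y. dd y \<in> S \<longleftrightarrow> y \<in> S"
    and r: "\<And>y. y \<in> S \<Longrightarrow> {r1 y, r2 y, r3 y, r4 y} \<subseteq> S"
    and X: "x \<in> X" "\<And>y. y \<in> X \<Longrightarrow> {r1 y, r2 y, r3 y, r4 y, e1 y, t y} \<subseteq> X"
    and "t x \<in> S" "\<And>y. y \<in> X \<Longrightarrow> e1 y \<in> S" and te: "\<And>y. y \<in> X \<Longrightarrow> t (r4 (r3 (r2 (e1 y)))) \<in> S"
  shows "\<forall>b\<in>set A1. t (actn b (t x)) \<in> S"
proof -
  \<comment> \<open>This is the orthogonal case. By \<open>wt432e234t\<close> the two conjugates of
    \<open>t\<close> may be joined through \<open>e1\<close>; the argument \<open>r1 x\<close> and a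
    further \<open>r1\<close> from \<open>r\<close> cancel the extra reflections.\<close>
  have "t (r4 (r3 (r2 (r3 (r4 (t x)))))) \<in> S"
    using r[OF te[of "r2 (r3 (r4 (t (r1 x))))"]] X by simp
  then show ?thesis
    using assms by (simp add: A1_def W24_def)
qed

text \<open>Crossing from an exchanged pair to a pair of fixed roots keeps the stratum, hence the
  hypothesis on \<open>t (r4 (r3 (r2 (e1 x))))\<close>. A third orthogonal root produces
  \<open>e1 t\<close>, with or without the corresponding crossing.\<close>

lemma A2_e:
  assumes dd: "\<And>y. dd y \<in> S \<longleftrightarrow> y \<in> S"
    and r: "\<And>y. y \<in> S \<Longrightarrow> {r1 y, r2 y, r3 y, r4 y} \<subseteq> S"
    and X: "x \<in> X" "\<And>y. y \<in> X \<Longrightarrow> {r1 y, r2 y, r3 y, r4 y, e1 y, t y} \<subseteq> X"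
    and "e1 x \<in> S" "t (r4 (r3 (r2 (e1 x)))) \<in> S" "\<And>y. y \<in> X \<Longrightarrow> e1 (t y) \<in> S" "\<And>y. y \<in> X \<Longrightarrow> t (r4 (r3 (r2 (r3 (r4 (e1 (t y))))))) \<in> S"
  shows "\<forall>b\<in>set A2. t (actn b (e1 x)) \<in> S \<and> e1 (actn b (e1 x)) \<in> S"
  using assms by (simp add: A2_def)

lemma A3_e:
  assumes dd: "\<And>y. dd y \<in> S \<longleftrightarrow> y \<in> S"
    and r: "\<And>y. y \<in> S \<Longrightarrow> {r1 y, r2 y, r3 y, r4 y} \<subseteq> S"
    and "e1 (t x) \<in> S" "t (r4 (r3 (r2 (r3 (r4 (e1 (t x))))))) \<in> S"
  shows "\<forall>b\<in>set A3. t (actn b (e1 (t x))) \<in> S \<and> e1 (actn b (e1 (t x))) \<in> S"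
  using assms by (simp add: A3_def)

text \<open>The outer words \<open>p\<close> and \<open>q\<close> are arbitrary: they are reduced
  later, by induction on the depth, once the deeper idempotent has appeared.\<close>

definition deeper :: "nat \<Rightarrow> 'b \<Rightarrow> 'b set" where
  "deeper d x = {y. \<exists>d'>d. \<exists>p q. d' \<le> 3 \<and> y \<sim> actn p (actn (eps d') (actn q x))}"

definition layer :: "nat \<Rightarrow> 'b \<Rightarrow> 'b set" where
  "layer d x = {y. \<exists>b\<in>set (lreps d). \<exists>h\<in>set (stab d). y \<sim> actn b (actn h (actn (eps d) x))}"

lemma dd_deeper [simp]: "dd y \<in> deeper d x \<longleftrightarrow> y \<in> deeper d x"
  by (simp add: deeper_def)

lemma dd_layer [simp]: "dd y \<in> layer d x \<longleftrightarrow> y \<in> layer d x"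
  by (simp add: layer_def)

lemma letter_deeper:
  assumes "y \<in> deeper d x" shows "letter n y \<in> deeper d x"
proof -
  obtain d' p q where "d' > d" "d' \<le> 3" "y \<sim> actn p (actn (eps d') (actn q x))"
    using assms unfolding deeper_def by blast
  moreover from this actn_eqd[of y _ "[n]"] have "letter n y \<sim> actn (n # p) (actn (eps d') (actn q x))"
    by simp
  ultimately show ?thesis
    unfolding deeper_def by blast
qed

lemma stab_comm:
  assumes "d \<in> {1,2,3}" "h \<in> set (stab d)"
  shows "actn h (actn (eps d) x) = actn (eps d) (actn h x)"
  using assms by (auto simp: stab_def eps_def C48_def S6_def)

lemma deeper_shift: "deeper d (actn h x) \<subseteq> deeper d x"
proof
  fix y assume "y \<in> deeper d (actn h x)"
  then obtain d' p q where "d' > d" "d' \<le> 3" "y \<sim> actn p (actn (eps d') (actn (q @ h) x))"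
    unfolding deeper_def by auto
  then show "y \<in> deeper d x"
    unfolding deeper_def by blast
qed

lemma stab_closed:
  assumes "d \<in> {1,2,3}" "g \<in> set (if d = 1 then [[],[1],[2],[3]] else if d = 2 then [[],[3],[4]] else [[]])"
    "h \<in> set (stab d)"
  shows "\<exists>h'\<in>set (stab d). actn g (actn h x) = actn h' x"
proof -
  \<comment> \<open>Choosing for \<open>S\<close> the elements obtained from \<open>x\<close> by the
    listed words turns the closure lemmas into the statement that the lists are closed under left
    multiplication.\<close>
  have "\<forall>h\<in>set C48. actn h x \<in> (\<lambda>h. actn h x) ` set C48" "\<forall>h\<in>set S6. actn h x \<in> (\<lambda>h. actn h x) ` set S6"
    by simp_all
  note C48_closed[OF this(1)] S6_closed[OF this(2)]
  then show ?thesis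
    using assms by (auto simp: stab_def image_iff split: if_splits)
qed

lemma layer_r:
  assumes "d \<in> {1,2,3}" "y \<in> layer d x" "n \<in> {1,2,3,4}"
  shows "letter n y \<in> layer d x"
proof -
  obtain b h where b: "b \<in> set (lreps d)" and h: "h \<in> set (stab d)"
    and y: "y \<sim> actn b (actn h (actn (eps d) x))"
    using assms unfolding layer_def by blast
  define G where "G = set (if d = 1 then [[],[1],[2],[3]] else if d = 2 then [[],[3],[4]] else [[]::nat list])"
  \<comment> \<open>The group element \<open>h\<close> is moved to the right of the idempotent,
    where the closure lemmas treat it as part of the argument; afterwards it returns and is merged
    with \<open>g\<close>.\<close>
  define S where "S = {z. \<exists>b\<in>set (lreps d). \<exists>g\<in>G. z \<sim> actn b (actn g (actn (eps d) (actn h x)))}"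
  have S: "\<forall>b\<in>set (lreps d). \<forall>g\<in>G. actn b (actn g (actn (eps d) (actn h x))) \<in> S"
    unfolding S_def by (blast intro: eqd_refl)
  have "\<forall>b\<in>set (lreps d). letter n (actn b (actn (eps d) (actn h x))) \<in> S"
  proof -
    consider "d = 1" | "d = 2" | "d = 3"
      using assms(1) by blast
    then show ?thesis
    proof cases
      case 1
      then show ?thesis
        using A1_closed[of "actn h x" S] S assms(3) by (auto simp: lreps_def eps_def G_def)
    next
      case 2
      then show ?thesis
        using A2_closed[of "actn h x" S] S assms(3) by (auto simp: lreps_def eps_def G_def)
    next
      case 3
      then show ?thesis
        using A3_closed[of "actn h x" S] S assms(3) by (auto simp: lreps_def eps_def G_def)
    qed
  qed
  with b have "letter n (actn b (actn (eps d) (actn h x))) \<in> S"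
    by blast
  then obtain b' g where b': "b' \<in> set (lreps d)" and g: "g \<in> G"
    and eq: "letter n (actn b (actn (eps d) (actn h x))) \<sim> actn b' (actn g (actn (eps d) (actn h x)))"
    unfolding S_def by blast
  have "letter n y \<sim> actn b' (actn g (actn (eps d) (actn h x)))"
    using actn_eqd[OF y, of "[n]"] stab_comm[OF assms(1) h] eqd_trans[OF _ eq] by simp
  also have "actn g (actn (eps d) (actn h x)) = actn g (actn h (actn (eps d) x))"
    using stab_comm[OF assms(1) h] by simp
  finally have "letter n y \<sim> actn b' (actn g (actn h (actn (eps d) x)))" .
  moreover obtain h' where "h' \<in> set (stab d)"
    "actn g (actn h (actn (eps d) x)) = actn h' (actn (eps d) x)"
    using stab_closed[of d g h] assms(1) g h unfolding G_def by blast
  ultimately show ?thesis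
    using b' unfolding layer_def by auto
qed

lemma deeperI: "d < d' \<Longrightarrow> d' \<le> 3 \<Longrightarrow> actn (eps d') (actn q x) \<in> deeper d x"
proof -
  have "actn (eps d') (actn q x) \<sim> actn [] (actn (eps d') (actn q x))"
    by simp
  then show "d < d' \<Longrightarrow> d' \<le> 3 \<Longrightarrow> actn (eps d') (actn q x) \<in> deeper d x"
    unfolding deeper_def by blast
qed

lemma stab_Nil: "[] \<in> set (stab d)" and lreps_Nil: "[] \<in> set (lreps d)"
  by (simp_all add: stab_def C48_def S6_def lreps_def A1_def A2_def A3_def W24_def)

lemma lreps_layer: "b \<in> set (lreps d) \<Longrightarrow> actn b (actn (eps d) x) \<in> layer d x"
  unfolding layer_def using stab_Nil by force

lemma stab_letters:
  assumes "h \<in> set (stab d)" "n \<in> set h"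
  shows "[n] \<in> set (if d = 1 then [[],[1],[2],[3]] else if d = 2 then [[],[3],[4]] else [[]])"
proof -
  have "\<forall>h\<in>set C48. set h \<subseteq> {1,2,3}" "\<forall>h\<in>set S6. set h \<subseteq> {3,4}"
    by (simp_all add: C48_def S6_def)
  then show ?thesis
    using assms by (auto simp: stab_def split: if_splits)
qed

lemma stab_word:
  assumes "d \<in> {1,2,3}" "\<forall>n\<in>set ns. [n] \<in> set (if d = 1 then [[],[1],[2],[3]] else if d = 2 then [[],[3],[4]] else [[]])"
    "h \<in> set (stab d)"
  shows "\<exists>h'\<in>set (stab d). actn ns (actn h x) = actn h' x"
  using assms(2)
proof (induction ns)
  case Nil
  then show ?case using assms(3) by auto
next
  case (Cons n ns)
  then obtain h'' where "h'' \<in> set (stab d)" "actn ns (actn h x) = actn h'' x"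
    by auto
  moreover have "\<exists>h3\<in>set (stab d). actn [n] (actn h'' x) = actn h3 x"
    using Cons.prems calculation(1) by (intro stab_closed assms(1)) auto
  ultimately show ?case
    by simp
qed

lemma stab_mult:
  assumes "d \<in> {1,2,3}" "h \<in> set (stab d)" "h' \<in> set (stab d)"
  shows "\<exists>h''\<in>set (stab d). actn h' (actn h x) = actn h'' x"
  using stab_word[OF assms(1) _ assms(2)] stab_letters[OF assms(3)] by blast

lemma stab_mult_rev:
  assumes "d \<in> {1,2,3}" "h \<in> set (stab d)" "h' \<in> set (stab d)"
  shows "\<exists>h''\<in>set (stab d). actn h (actn (eps d) (actn (rev h') x)) = actn h'' (actn (eps d) x)"
proof -
  have "\<exists>h2\<in>set (stab d). actn (rev h') (actn [] y) = actn h2 y" for y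
    using stab_letters[OF assms(3)] by (intro stab_word[OF assms(1) _ stab_Nil]) auto
  then obtain h2 where h2: "h2 \<in> set (stab d)" "actn (rev h') x = actn h2 x"
    by auto
  then have "actn h (actn (eps d) (actn (rev h') x)) = actn h (actn h2 (actn (eps d) x))"
    using stab_comm[OF assms(1)] by simp
  then show ?thesis
    using stab_mult[OF assms(1) h2(1) assms(2)] by metis
qed

lemma layer_shift:
  assumes "d \<in> {1,2,3}" "h \<in> set (stab d)" "y \<in> layer d (actn h x)"
  shows "y \<in> layer d x"
proof -
  obtain b h' where b: "b \<in> set (lreps d)" and h': "h' \<in> set (stab d)"
    and y: "y \<sim> actn b (actn h' (actn (eps d) (actn h x)))"
    using assms unfolding layer_def by blast
  obtain h'' where "h'' \<in> set (stab d)"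
    "actn h' (actn h (actn (eps d) x)) = actn h'' (actn (eps d) x)"
    using stab_mult[OF assms(1,2) h'] by blast
  then show ?thesis
    using b y stab_comm[OF assms(1,2)] unfolding layer_def by auto
qed

lemma eps_layer: "actn (eps d) x \<in> layer d x"
  using lreps_layer[OF lreps_Nil] by simp

lemma layer_e:
  assumes "d \<in> {1,2,3}" "b \<in> set (lreps d)" "n \<in> {5,6}"
  shows "letter n (actn b (actn (eps d) x)) \<in> layer d x \<union> deeper d x"
proof -
  let ?S = "layer d x \<union> deeper d x"
  have dd: "dd y \<in> ?S \<longleftrightarrow> y \<in> ?S" for y
    by simp
  have "letter m y \<in> ?S" if "y \<in> ?S" "m \<in> {1,2,3,4}" for m y
    using layer_r[OF assms(1) _ that(2)] letter_deeper that(1) by blast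
  from this[of _ 1] this[of _ 2] this[of _ 3] this[of _ 4]
  have r: "{r1 y, r2 y, r3 y, r4 y} \<subseteq> ?S" if "y \<in> ?S" for y
    using that by simp_all
  have eps: "actn (eps d) x \<in> ?S"
    using eps_layer by blast
  \<comment> \<open>Everything reachable from \<open>x\<close>: the side conditions of
    \<open>A1_t\<close> and \<open>A2_e\<close> concern arbitrary words to the right of the new
    idempotent.\<close>
  define X where "X = range (\<lambda>q. actn q x)"
  have X: "x \<in> X" "\<And>y. y \<in> X \<Longrightarrow> {r1 y, r2 y, r3 y, r4 y, e1 y, t y} \<subseteq> X"
  proof -
    show "x \<in> X"
      unfolding X_def by (rule range_eqI[of _ _ "[]"]) simp
    have "letter n (actn q x) \<in> X" for n q
      unfolding X_def by (rule range_eqI[of _ _ "n # q"]) simp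
    from this[of 1] this[of 2] this[of 3] this[of 4] this[of 5] this[of 6]
    show "{r1 y, r2 y, r3 y, r4 y, e1 y, t y} \<subseteq> X" if "y \<in> X" for y
      using that unfolding X_def by auto
  qed
  have deep: "actn p (actn (eps d') y) \<in> ?S" if "d < d'" "d' \<le> 3" "y \<in> X" for d' p y
  proof -
    have "actn (eps d') y \<in> deeper d x"
      using that unfolding X_def by (auto intro: deeperI)
    then have "actn p (actn (eps d') y) \<in> deeper d x"
      by (induction p) (simp_all add: letter_deeper)
    then show ?thesis
      by simp
  qed
  consider "d = 1" | "d = 2" | "d = 3"
    using assms(1) by blast
  then show ?thesis
  proof cases
    case 1
    have "\<forall>b\<in>set A1. t (actn b (t x)) \<in> ?S"
      using deep[of 2 _ "[]"] deep[of 2 _ "[6,4,3,2]"] eps 1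
      by (intro A1_t[of ?S x X, OF dd r X]) (auto simp: eps_def)
    moreover have "actn b (t x) \<in> X"
      unfolding X_def by (rule range_eqI[of _ _ "b @ [6]"]) simp
    then have "e1 (actn b (t x)) \<in> ?S"
      using deep[of 2 "actn b (t x)" "[]"] 1 by (simp add: eps_def)
    ultimately show ?thesis
      using assms(2,3) 1 by (auto simp: eps_def lreps_def)
  next
    case 2
    have "actn [6,4,3,2] (actn (eps 2) x) \<in> layer 2 x"
      by (intro lreps_layer) (simp add: lreps_def A2_def)
    then have "\<forall>b\<in>set A2. t (actn b (e1 x)) \<in> ?S \<and> e1 (actn b (e1 x)) \<in> ?S"
      using deep[of 3 _ "[]"] deep[of 3 _ "[6,4,3,2,3,4]"] eps 2
      by (intro A2_e[of ?S x X, OF dd r X]) (auto simp: eps_def)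
    then show ?thesis
      using assms(2,3) 2 by (auto simp: eps_def lreps_def)
  next
    case 3
    have "actn [6,4,3,2,3,4] (actn (eps 3) x) \<in> layer 3 x"
      by (intro lreps_layer) (simp add: lreps_def A3_def)
    then show ?thesis
      using A3_e[of ?S x, OF dd r] eps assms(2,3) 3 by (auto simp: eps_def lreps_def)
  qed
qed

lemma letter_layer:
  assumes "d \<in> {1,2,3}" "y \<in> layer d x \<union> deeper d x"
  shows "letter n y \<in> layer d x \<union> deeper d x"
  using assms(2)
proof
  assume "y \<in> deeper d x"
  then show ?thesis
    using letter_deeper by blast
next
  assume y: "y \<in> layer d x"
  show ?thesis
  proof (cases "n \<in> {1,2,3,4}")
    case False
    \<comment> \<open>\<open>letter\<close> reads every digit other than 1, ..., 5 as
      \<open>t\<close>, so such a digit can be replaced by 6.\<close>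
    define m :: nat where "m = (if n = 5 then 5 else 6)"
    have m: "m \<in> {5,6}" "letter n = letter m"
      using False by (auto simp: m_def letter_def fun_eq_iff)
    obtain b h where b: "b \<in> set (lreps d)" and h: "h \<in> set (stab d)"
      and "y \<sim> actn b (actn h (actn (eps d) x))"
      using y unfolding layer_def by blast
    then have eq: "letter n y \<sim> letter n (actn b (actn (eps d) (actn h x)))"
      using actn_eqd[of y _ "[n]"] stab_comm[OF assms(1) h] by simp
    have "letter n (actn b (actn (eps d) (actn h x))) \<in> layer d x \<union> deeper d x"
      unfolding m(2) using layer_e[OF assms(1) b m(1)] layer_shift[OF assms(1) h] deeper_shift by blast
    then show ?thesis
      using eq eqd_trans unfolding layer_def deeper_def by blast
  next
    case True
    then show ?thesis
      using layer_r[OF assms(1) y] by blast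
  qed
qed

lemma actn_layer:
  assumes "d \<in> {1,2,3}"
  shows "actn u (actn (eps d) x) \<in> layer d x \<union> deeper d x"
proof (induction u)
  case Nil
  then show ?case using eps_layer by simp
next
  case (Cons n u)
  then show ?case using letter_layer[OF assms(1)] by simp
qed

lemma actn_group:
  assumes "set u \<subseteq> {1,2,3,4}"
  shows "\<exists>b\<in>set W24. \<exists>h\<in>set C48. actn u x = actn b (actn h x)"
  using assms
proof (induction u)
  case Nil
  then show ?case
    by (simp add: W24_def C48_def)
next
  case (Cons n u)
  then obtain b h where b: "b \<in> set W24" and h: "h \<in> set C48" and u: "actn u x = actn b (actn h x)"
    by auto
  define S where "S = {z. \<exists>b\<in>set W24. \<exists>g\<in>{[],[1],[2],[3]}. z = actn b (actn g (actn h x))}"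
  have "\<forall>b\<in>set W24. \<forall>g\<in>{[],[1],[2],[3]}. actn b (actn g (actn h x)) \<in> S"
    unfolding S_def by blast
  from W24_closed[OF this] have "letter n (actn b (actn h x)) \<in> S"
    using Cons.prems b by auto
  then obtain b' g where "b' \<in> set W24" "g \<in> {[],[1],[2],[3]}"
    "letter n (actn b (actn h x)) = actn b' (actn g (actn h x))"
    unfolding S_def by blast
  moreover obtain h' where "h' \<in> set C48" "actn g (actn h x) = actn h' x"
    using stab_closed[of 1 g h x] calculation(2) h by (auto simp: stab_def)
  ultimately show ?case
    using u by auto
qed

lemma actn_digits: "actn (digits w) x = act f w x"
proof (induction w)
  case (Cons g w)
  have "actn (gen_digits g) y = f g y" for y
  proof (cases g)
    case (Fr i)
    then show ?thesis by (cases i) (simp_all add: gen_digits_def)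
  next
    case (Fe i)
    then show ?thesis
      by (cases i) (simp_all add: gen_digits_def e2_eq e3_eq e4_eq del: w432343 w4324)
  qed
  then show ?case
    using Cons by (simp add: digits_def)
qed (simp add: digits_def)

text \<open>The presentation is not visibly closed under reversal of words. This lemma and the next
  two derive the mirror images that are missing; right multiplication will require them.\<close>

lemma e_r_r: "(i, j) \<in> {(f1,f2),(f2,f1),(f3,f4),(f4,f3)} \<Longrightarrow> f (Fe j) (f (Fr i) (f (Fr j) x)) = f (Fe j) (f (Fe i) x)"
  by (elim insertE emptyE) (simp_all add: e2_eq e3_eq e4_eq)

lemma e3r2e3r2: "e3 (r2 (e3 (r2 x))) = e3 (e2 (e3 x))"
  by (simp add: e2_eq e3_eq e4_eq)

lemma r2e3e2: "r2 (e3 (e2 x)) = e3 (e2 x)"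
  by (simp add: e2_eq e3_eq e4_eq)

end

section \<open>Words and quotient algebras\<close>

lemma dpow_add: "dpow (k + l) = dpow k * dpow l"
  by (simp add: dpow_def mult_single)

lemma dpow_0 [simp]: "dpow 0 = 1"
  by (simp add: dpow_def)

lemma scal_add_left: "scal (a + b) p = scal a p + scal b p"
  by (simp add: scal_def single_add distrib_right)

lemma scal_diff: "scal c (p - q) = scal c p - scal c q"
  by (simp add: scal_def right_diff_distrib)

lemma scal_0 [simp]: "scal 0 p = 0" "scal c 0 = 0"
  by (simp_all add: scal_def)

lemma scal_scal [simp]: "scal a (scal b p) = scal (a * b) p"
  by (simp add: scal_def mult.assoc [symmetric] mult_single)

lemma scal_1 [simp]: "scal 1 p = p"
  by (simp add: scal_def)

lemma scal_single [simp]: "scal c (Poly_Mapping.single w a) = Poly_Mapping.single w (c * a)"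
  by (simp add: scal_def mult_single)

lemma scal_sum: "scal c (\<Sum>x\<in>A. p x) = (\<Sum>x\<in>A. scal c (p x))"
  by (simp add: scal_def sum_distrib_left)

lemma falg_expand: "p = (\<Sum>w\<in>Poly_Mapping.keys p. Poly_Mapping.single w (Poly_Mapping.lookup p w))"
  by (rule poly_mapping_eqI) (auto simp: lookup_sum lookup_single when_def in_keys_iff)

lemma single_0_comm: "Poly_Mapping.single 0 c * p = p * Poly_Mapping.single (0 :: 'g word) (c :: laurent)"
proof -
  have "Poly_Mapping.single 0 c * (\<Sum>w\<in>Poly_Mapping.keys p. Poly_Mapping.single w (Poly_Mapping.lookup p w))
    = (\<Sum>w\<in>Poly_Mapping.keys p. Poly_Mapping.single w (Poly_Mapping.lookup p w)) * Poly_Mapping.single 0 c"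
    by (simp add: sum_distrib_left sum_distrib_right mult_single mult.commute)
  then show ?thesis
    by (simp flip: falg_expand)
qed

lemma scal_mult_left: "scal c p * q = scal c (p * q)"
  by (simp add: scal_def mult.assoc)

lemma scal_mult_right: "p * scal c q = scal c (p * q)"
  by (metis mult.assoc scal_def single_0_comm)

section \<open>Monomials and linear extension\<close>

definition mon :: "'g list \<Rightarrow> int \<Rightarrow> 'g falg" where
  "mon w k = Poly_Mapping.single (Word w) (dpow k)"

lemma mon_mult: "mon u a * mon v b = mon (u @ v) (a + b)"
  by (simp add: mon_def mult_single plus_word_def dpow_add)

lemma scal_mon: "scal (dpow k) (mon w l) = mon w (k + l)"
  by (simp add: mon_def dpow_add)

lemma mon_Nil: "mon [] 0 = 1"
  by (simp add: mon_def flip: zero_word_def)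

lemma mon_Cons: "mon (x # w) k = gen x * mon w k"
  by (simp add: mon_def gen_def mult_single plus_word_def)

lemma gen_mon: "gen x = mon [x] 0"
  by (simp add: mon_def gen_def)

lemma dl_mult: "dl * p = scal (dpow 1) p" "p * dl = scal (dpow 1) p"
  by (simp_all add: dl_def scal_mult_left scal_mult_right)

lemma dl_mon: "dl * mon w k = mon w (k + 1)" "mon w k * dl = mon w (k + 1)"
  by (simp_all add: dl_mult scal_mon add.commute)

lemma falg_mon_expand:
  "p = (\<Sum>w\<in>Poly_Mapping.keys p. scal (Poly_Mapping.lookup p w) (mon (letters w) 0))"
  by (subst falg_expand) (simp add: mon_def)

text \<open>Linear extension of a map on words. Both \<open>hom\<close> and the functionals that
  read off coefficients are instances, so linearity is shown once.\<close>

definition lin :: "('g word \<Rightarrow> 'h falg) \<Rightarrow> 'g falg \<Rightarrow> 'h falg" where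
  "lin F p = (\<Sum>w\<in>Poly_Mapping.keys p. scal (Poly_Mapping.lookup p w) (F w))"

lemma lin_superset:
  assumes "finite A" "Poly_Mapping.keys p \<subseteq> A"
  shows "lin F p = (\<Sum>w\<in>A. scal (Poly_Mapping.lookup p w) (F w))"
  unfolding lin_def using assms by (intro sum.mono_neutral_left) (auto simp: in_keys_iff)

lemma lin_add: "lin F (p + q) = lin F p + lin F q"
proof -
  let ?A = "Poly_Mapping.keys p \<union> Poly_Mapping.keys q"
  have "lin F (p + q) = (\<Sum>w\<in>?A. scal (Poly_Mapping.lookup (p + q) w) (F w))"
    by (intro lin_superset) (auto simp: Poly_Mapping.keys_add)
  also have "\<dots> = lin F p + lin F q"
    by (simp add: lookup_add scal_add_left sum.distrib lin_superset[of ?A p] lin_superset[of ?A q])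
  finally show ?thesis .
qed

lemma lin_0 [simp]: "lin F 0 = 0"
  by (simp add: lin_def)

lemma lin_uminus: "lin F (- p) = - lin F p"
  using lin_add[of F p "- p"] by (simp add: eq_neg_iff_add_eq_0 add.commute)

lemma lin_diff: "lin F (p - q) = lin F p - lin F q"
  using lin_add[of F p "- q"] by (simp add: lin_uminus)

lemma lin_sum: "lin F (\<Sum>x\<in>A. p x) = (\<Sum>x\<in>A. lin F (p x))"
  by (induction A rule: infinite_finite_induct) (simp_all add: lin_add)

lemma lin_single: "lin F (Poly_Mapping.single w c) = scal c (F w)"
  by (cases "c = 0") (simp_all add: lin_def)

lemma lin_scal: "lin F (scal c p) = scal c (lin F p)"
proof -
  have "lin F (scal c (\<Sum>w\<in>Poly_Mapping.keys p. Poly_Mapping.single w (Poly_Mapping.lookup p w))) = scal c (lin F p)"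
    by (simp add: scal_sum lin_sum lin_single lin_def[of F p])
  then show ?thesis
    by (simp flip: falg_expand)
qed

lemma hom_lin: "hom img = lin (\<lambda>w. prod_list (map img (letters w)))"
  by (simp add: fun_eq_iff hom_def lin_def)

lemma hom_mult:
  fixes p q :: "'g falg"
  shows "hom img (p * q) = hom img p * hom img q"
proof -
  let ?s = "\<lambda>p::'g falg. \<lambda>w. Poly_Mapping.single w (Poly_Mapping.lookup p w)"
  have single: "hom img (Poly_Mapping.single u a * Poly_Mapping.single v b)
      = hom img (Poly_Mapping.single u a) * hom img (Poly_Mapping.single v b)" for u v a b
    by (simp add: hom_lin lin_single mult_single plus_word_def scal_mult_left scal_mult_right mult.commute)
  have "hom img (p * q) = hom img ((\<Sum>u\<in>Poly_Mapping.keys p. ?s p u) * (\<Sum>v\<in>Poly_Mapping.keys q. ?s q v))"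
    by (simp flip: falg_expand)
  also have "\<dots> = (\<Sum>u\<in>Poly_Mapping.keys p. \<Sum>v\<in>Poly_Mapping.keys q. hom img (?s p u) * hom img (?s q v))"
    by (simp only: sum_product hom_lin lin_sum single[unfolded hom_lin])
  also have "\<dots> = hom img (\<Sum>u\<in>Poly_Mapping.keys p. ?s p u) * hom img (\<Sum>v\<in>Poly_Mapping.keys q. ?s q v)"
    by (simp only: sum_product hom_lin lin_sum)
  finally show ?thesis
    by (simp flip: falg_expand)
qed

lemma hom_mon:
  assumes "\<And>x. img x = mon (W x) 0"
  shows "hom img (mon w k) = mon (concat (map W w)) k"
proof -
  have "prod_list (map img w) = mon (concat (map W w)) 0"
    by (induction w) (simp_all add: assms mon_Nil mon_mult)
  then show ?thesis
    by (simp add: hom_lin mon_def[of w] lin_single scal_mon)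
qed

section \<open>Ideals and proportional words\<close>

lemma ideal_gen_diff: "x \<in> ideal_gen S \<Longrightarrow> y \<in> ideal_gen S \<Longrightarrow> x - y \<in> ideal_gen S"
  using ideal_gen.add_in[of x S "- y"] ideal_gen.neg_in[of y S] by simp

lemma ideal_gen_mult:
  assumes "x \<in> ideal_gen S" shows "a * x \<in> ideal_gen S" "x * b \<in> ideal_gen S"
proof -
  have "a * x * b \<in> ideal_gen S" for a b
    using assms
  proof induction
    case (gen_in s c d)
    then show ?case
      using ideal_gen.gen_in[of s S "a * c" "d * b"] by (simp add: mult.assoc)
  next
    case (add_in x y)
    then show ?case by (simp add: distrib_left distrib_right ideal_gen.add_in)
  next
    case (neg_in x)
    then show ?case by (simp add: ideal_gen.neg_in)
  qed (simp add: ideal_gen.zero_in)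
  from this[of a 1] this[of 1 b] show "a * x \<in> ideal_gen S" "x * b \<in> ideal_gen S"
    by simp_all
qed

lemma ideal_gen_base: "s \<in> S \<Longrightarrow> s \<in> ideal_gen S"
  using ideal_gen.gen_in[of s S 1 1] by simp

lemma ideal_gen_scal: "x \<in> ideal_gen S \<Longrightarrow> scal c x \<in> ideal_gen S"
  unfolding scal_def by (rule ideal_gen_mult)

lemma hom_ideal_gen:
  assumes "\<And>s. s \<in> S \<Longrightarrow> hom img s \<in> ideal_gen S'" and "x \<in> ideal_gen S"
  shows "hom img x \<in> ideal_gen S'"
  using assms(2)
proof induction
  case (gen_in s a b)
  then show ?case
    using assms(1) by (simp add: hom_mult ideal_gen_mult)
next
  case (add_in x y)
  then show ?case
    by (simp add: hom_lin lin_add ideal_gen.add_in)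
next
  case (neg_in x)
  then show ?case
    by (simp add: hom_lin lin_uminus ideal_gen.neg_in)
qed (simp add: hom_lin ideal_gen.zero_in)

lemma ideal_equivp: "equivp (\<lambda>x y. x - y \<in> ideal_gen S)"
proof (rule equivpI)
  show "reflp (\<lambda>x y. x - y \<in> ideal_gen S)"
    by (simp add: reflp_def ideal_gen.zero_in)
  show "symp (\<lambda>x y. x - y \<in> ideal_gen S)"
    using ideal_gen.neg_in by (fastforce intro: sympI)
  show "transp (\<lambda>x y. x - y \<in> ideal_gen S)"
    using ideal_gen.add_in by (fastforce intro: transpI)
qed

text \<open>Proportionality by a power of \<delta>. The exponent is an integer, so placing it on one
  side still gives a symmetric relation.\<close>

definition wcong :: "'g falg set \<Rightarrow> 'g list \<Rightarrow> 'g list \<Rightarrow> bool" where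
  "wcong S u v \<longleftrightarrow> (\<exists>k. mon u 0 - mon v k \<in> ideal_gen S)"

lemma wcong_mon:
  assumes "wcong S u v"
  shows "\<exists>k. mon u a - mon v k \<in> ideal_gen S"
proof -
  obtain k where "mon u 0 - mon v k \<in> ideal_gen S"
    using assms unfolding wcong_def by blast
  from ideal_gen_scal[OF this, of "dpow a"] show ?thesis
    by (auto simp: scal_diff scal_mon)
qed

lemma wcong_refl [simp]: "wcong S u u"
  unfolding wcong_def by (rule exI[of _ 0]) (simp add: ideal_gen.zero_in)

lemma wcong_sym: "wcong S u v \<Longrightarrow> wcong S v u"
proof -
  assume "wcong S u v"
  then obtain k where "mon u 0 - mon v k \<in> ideal_gen S"
    unfolding wcong_def by blast
  from ideal_gen.neg_in[OF ideal_gen_scal[OF this, of "dpow (- k)"]] show ?thesis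
    unfolding wcong_def by (auto simp: scal_diff scal_mon)
qed

lemma wcong_trans [trans]:
  assumes "wcong S u v" "wcong S v w" shows "wcong S u w"
proof -
  obtain k where "mon u 0 - mon v k \<in> ideal_gen S"
    using assms unfolding wcong_def by blast
  moreover obtain l where "mon v k - mon w l \<in> ideal_gen S"
    using wcong_mon[OF assms(2)] by blast
  ultimately show ?thesis
    using ideal_gen.add_in unfolding wcong_def by fastforce
qed

lemma wcong_append:
  assumes "wcong S u v" shows "wcong S (p @ u @ q) (p @ v @ q)"
proof -
  obtain k where "mon u 0 - mon v k \<in> ideal_gen S"
    using assms unfolding wcong_def by blast
  then have "mon p 0 * (mon u 0 - mon v k) * mon q 0 \<in> ideal_gen S"
    by (intro ideal_gen_mult)
  then show ?thesis
    unfolding wcong_def by (auto simp: left_diff_distrib right_diff_distrib mon_mult)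
qed

\<comment> \<open>The quotients and their left and right actions\<close>
quotient_type brF4 = "F4gen falg" / "\<lambda>x y. x - y \<in> IF4"
  unfolding IF4_def by (rule ideal_equivp)

quotient_type brE6 = "E6gen falg" / "\<lambda>x y. x - y \<in> IE6"
  unfolding IE6_def by (rule ideal_equivp)

definition lmulF4 :: "F4gen falg \<Rightarrow> brF4 \<Rightarrow> brF4" where
  "lmulF4 a x = abs_brF4 (a * rep_brF4 x)"

definition rmulF4 :: "F4gen falg \<Rightarrow> brF4 \<Rightarrow> brF4" where
  "rmulF4 a x = abs_brF4 (rep_brF4 x * a)"

lemma mulF4_abs: "lmulF4 a (abs_brF4 x) = abs_brF4 (a * x)" "rmulF4 a (abs_brF4 x) = abs_brF4 (x * a)"
proof -
  have "rep_brF4 (abs_brF4 x) - x \<in> IF4"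
    by (rule Quotient3_rep_abs[OF Quotient3_brF4]) (simp add: IF4_def ideal_gen.zero_in)
  then have "a * (rep_brF4 (abs_brF4 x) - x) \<in> IF4" "(rep_brF4 (abs_brF4 x) - x) * a \<in> IF4"
    unfolding IF4_def by (rule ideal_gen_mult)+
  then show "lmulF4 a (abs_brF4 x) = abs_brF4 (a * x)" "rmulF4 a (abs_brF4 x) = abs_brF4 (x * a)"
    by (simp_all add: lmulF4_def rmulF4_def brF4.abs_eq_iff left_diff_distrib right_diff_distrib)
qed

lemma mulF4_relation:
  assumes "a - b \<in> relF4" shows "lmulF4 a x = lmulF4 b x" "rmulF4 a x = rmulF4 b x"
proof -
  obtain y where x: "x = abs_brF4 y"
    by (induction x rule: brF4.abs_induct) blast
  have "(a - b) * y \<in> IF4" "y * (a - b) \<in> IF4"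
    unfolding IF4_def using ideal_gen_base[OF assms] by (simp_all add: ideal_gen_mult)
  then show "lmulF4 a x = lmulF4 b x" "rmulF4 a x = rmulF4 b x"
    by (simp_all add: x mulF4_abs brF4.abs_eq_iff left_diff_distrib right_diff_distrib)
qed

lemma mulF4_mult: "lmulF4 (a * b) x = lmulF4 a (lmulF4 b x)" "rmulF4 (a * b) x = rmulF4 b (rmulF4 a x)"
  and mulF4_1 [simp]: "lmulF4 1 x = x" "rmulF4 1 x = x"
proof -
  obtain y where x: "x = abs_brF4 y"
    by (induction x rule: brF4.abs_induct) blast
  show "lmulF4 (a * b) x = lmulF4 a (lmulF4 b x)" "rmulF4 (a * b) x = rmulF4 b (rmulF4 a x)"
    "lmulF4 1 x = x" "rmulF4 1 x = x"
    by (simp_all add: x mulF4_abs mult.assoc)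
qed

definition lmulE6 :: "E6gen falg \<Rightarrow> brE6 \<Rightarrow> brE6" where
  "lmulE6 a x = abs_brE6 (a * rep_brE6 x)"

definition rmulE6 :: "E6gen falg \<Rightarrow> brE6 \<Rightarrow> brE6" where
  "rmulE6 a x = abs_brE6 (rep_brE6 x * a)"

lemma mulE6_abs: "lmulE6 a (abs_brE6 x) = abs_brE6 (a * x)" "rmulE6 a (abs_brE6 x) = abs_brE6 (x * a)"
proof -
  have "rep_brE6 (abs_brE6 x) - x \<in> IE6"
    by (rule Quotient3_rep_abs[OF Quotient3_brE6]) (simp add: IE6_def ideal_gen.zero_in)
  then have "a * (rep_brE6 (abs_brE6 x) - x) \<in> IE6" "(rep_brE6 (abs_brE6 x) - x) * a \<in> IE6"
    unfolding IE6_def by (rule ideal_gen_mult)+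
  then show "lmulE6 a (abs_brE6 x) = abs_brE6 (a * x)" "rmulE6 a (abs_brE6 x) = abs_brE6 (x * a)"
    by (simp_all add: lmulE6_def rmulE6_def brE6.abs_eq_iff left_diff_distrib right_diff_distrib)
qed

lemma mulE6_relation:
  assumes "a - b \<in> relE6" shows "lmulE6 a x = lmulE6 b x" "rmulE6 a x = rmulE6 b x"
proof -
  obtain y where x: "x = abs_brE6 y"
    by (induction x rule: brE6.abs_induct) blast
  have "(a - b) * y \<in> IE6" "y * (a - b) \<in> IE6"
    unfolding IE6_def using ideal_gen_base[OF assms] by (simp_all add: ideal_gen_mult)
  then show "lmulE6 a x = lmulE6 b x" "rmulE6 a x = rmulE6 b x"
    by (simp_all add: x mulE6_abs brE6.abs_eq_iff left_diff_distrib right_diff_distrib)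
qed

lemma mulE6_mult: "lmulE6 (a * b) x = lmulE6 a (lmulE6 b x)" "rmulE6 (a * b) x = rmulE6 b (rmulE6 a x)"
  and mulE6_1 [simp]: "lmulE6 1 x = x" "rmulE6 1 x = x"
proof -
  obtain y where x: "x = abs_brE6 y"
    by (induction x rule: brE6.abs_induct) blast
  show "lmulE6 (a * b) x = lmulE6 a (lmulE6 b x)" "rmulE6 (a * b) x = rmulE6 b (rmulE6 a x)"
    "lmulE6 1 x = x" "rmulE6 1 x = x"
    by (simp_all add: x mulE6_abs mult.assoc)
qed

lemma relF4I:
  "r i * r i - 1 \<in> relF4" "r i * e i - e i \<in> relF4" "e i * r i - e i \<in> relF4"
  "i \<in> {f3, f4} \<Longrightarrow> e i * e i - dl * e i \<in> relF4"
  "i \<in> {f1, f2} \<Longrightarrow> e i * e i - dl * dl * e i \<in> relF4"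
  unfolding relF4_def by blast+

lemma relF4_comm:
  assumes "(i, j) \<in> {(f1,f3),(f3,f1),(f1,f4),(f4,f1),(f2,f4),(f4,f2)}"
  shows "r i * r j - r j * r i \<in> relF4" "e i * r j - r j * e i \<in> relF4" "e i * e j - e j * e i \<in> relF4"
  using assms unfolding relF4_def by blast+

lemma relF4_braid:
  assumes "(i, j) \<in> {(f1,f2),(f2,f1),(f3,f4),(f4,f3)}"
  shows "r i * r j * r i - r j * r i * r j \<in> relF4" "r j * r i * e j - e i * e j \<in> relF4"
    "r i * e j * r i - r j * e i * r j \<in> relF4"
  using assms unfolding relF4_def by blast+

lemma relF4_23:
  "r f2 * r f3 * r f2 * r f3 - r f3 * r f2 * r f3 * r f2 \<in> relF4"
  "r f2 * r f3 * e f2 - r f3 * e f2 \<in> relF4"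
  "r f2 * e f3 * r f2 * e f3 - e f3 * e f2 * e f3 \<in> relF4"
  "(r f2 * r f3 * r f2) * e f3 - e f3 * (r f2 * r f3 * r f2) \<in> relF4"
  "e f2 * r f3 * e f2 - dl * e f2 \<in> relF4"
  "e f2 * e f3 * e f2 - dl * e f2 \<in> relF4"
  "e f2 * r f3 * r f2 - e f2 * r f3 \<in> relF4"
  "e f2 * e f3 * r f2 - e f2 * e f3 \<in> relF4"
  unfolding relF4_def by blast+

lemma mulF4_dl:
  "lmulF4 (gen g) (lmulF4 dl x) = lmulF4 dl (lmulF4 (gen g) x)"
  "rmulF4 (gen g) (rmulF4 dl x) = rmulF4 dl (rmulF4 (gen g) x)"
  "lmulF4 dl (lmulF4 (scal (dpow (-1)) 1) x) = x" "lmulF4 (scal (dpow (-1)) 1) (lmulF4 dl x) = x"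
  "rmulF4 dl (rmulF4 (scal (dpow (-1)) 1) x) = x" "rmulF4 (scal (dpow (-1)) 1) (rmulF4 dl x) = x"
  by (simp_all add: dl_mult dl_def scal_mult_left scal_mult_right flip: mulF4_mult dpow_add)

interpretation LF4: brauer_F4 "\<lambda>g. lmulF4 (gen g)" "lmulF4 dl" "lmulF4 (scal (dpow (-1)) 1)"
proof (unfold_locales, unfold r_def[symmetric] e_def[symmetric], goal_cases)
  case 1 show ?case by (rule mulF4_dl)
next
  case 2 show ?case by (rule mulF4_dl)
next
  case 3 show ?case by (rule mulF4_dl)
next
  case (4 i x)
  then show ?case
    using mulF4_relation(1)[OF relF4I(1)[of i]] by (simp add: mulF4_mult)
next
  case (5 i x)
  then show ?case
    using mulF4_relation(1)[OF relF4I(2)[of i]] by (simp add: mulF4_mult)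
next
  case (6 i x)
  then show ?case
    using mulF4_relation(1)[OF relF4I(3)[of i]] by (simp add: mulF4_mult)
next
  case (7 i x)
  then show ?case
    using mulF4_relation(1)[OF relF4I(4)[of i]] by (simp add: mulF4_mult)
next
  case (8 i x)
  then show ?case
    using mulF4_relation(1)[OF relF4I(5)[of i]] by (simp add: mulF4_mult)
next
  case (9 i j x)
  then show ?case
    using relF4_comm[THEN mulF4_relation(1), of i j x] by (simp add: mulF4_mult)
next
  case (10 i j x)
  then show ?case
    using relF4_braid[THEN mulF4_relation(1), of i j x] by (simp add: mulF4_mult)
qed (use relF4_23[THEN mulF4_relation(1)] in \<open>simp_all add: mulF4_mult\<close>)

text \<open>An identity for left multiplications holds for the products, hence for right multiplications.\<close>

lemma rmulF4_eq:
  assumes "\<And>x. lmulF4 a x = lmulF4 b x" shows "rmulF4 a x = rmulF4 b x"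
proof -
  obtain y where x: "x = abs_brF4 y"
    by (induction x rule: brF4.abs_induct) blast
  have "a - b \<in> IF4"
    using assms[of "abs_brF4 1"] by (simp add: mulF4_abs brF4.abs_eq_iff)
  then have "y * (a - b) \<in> IF4"
    unfolding IF4_def by (rule ideal_gen_mult)
  then show ?thesis
    by (simp add: x mulF4_abs brF4.abs_eq_iff right_diff_distrib)
qed

text \<open>Composites of right multiplications spell words backwards. The interpretation therefore
  says that reversal respects the relations, and every left reduction acquires a right one.\<close>

interpretation RF4: brauer_F4 "\<lambda>g. rmulF4 (gen g)" "rmulF4 dl" "rmulF4 (scal (dpow (-1)) 1)"
proof (unfold_locales, unfold r_def[symmetric] e_def[symmetric], goal_cases)
  case 1 show ?case by (rule mulF4_dl)
next
  case 2 show ?case by (rule mulF4_dl)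
next
  case 3 show ?case by (rule mulF4_dl)
next
  case (4 i x)
  then show ?case
    using mulF4_relation(2)[OF relF4I(1)[of i]] by (simp add: mulF4_mult)
next
  case (5 i x)
  then show ?case
    using mulF4_relation(2)[OF relF4I(3)[of i]] by (simp add: mulF4_mult)
next
  case (6 i x)
  then show ?case
    using mulF4_relation(2)[OF relF4I(2)[of i]] by (simp add: mulF4_mult)
next
  case (7 i x)
  have "rmulF4 (e i) (rmulF4 dl y) = rmulF4 dl (rmulF4 (e i) y)" for y
    unfolding e_def by (rule mulF4_dl)
  then show ?case
    using mulF4_relation(2)[OF relF4I(4)[OF 7]] by (simp add: mulF4_mult)
next
  case (8 i x)
  have "rmulF4 (e i) (rmulF4 dl y) = rmulF4 dl (rmulF4 (e i) y)" for y
    unfolding e_def by (rule mulF4_dl)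
  then show ?case
    using mulF4_relation(2)[OF relF4I(5)[OF 8]] by (simp add: mulF4_mult)
next
  case (9 i j x)
  then have "(j, i) \<in> {(f1,f3),(f3,f1),(f1,f4),(f4,f1),(f2,f4),(f4,f2)}"
    by auto
  from relF4_comm[THEN mulF4_relation(2), OF this, of x] relF4_comm[THEN mulF4_relation(2), OF 9, of x]
  show ?case by (simp add: mulF4_mult)
next
  case (10 i j x)
  \<comment> \<open>The reversed braid relation is a consequence found by rewriting with left
    multiplications, transferred to the right; cases 13 and 18 proceed alike.\<close>
  have "rmulF4 (e j * r i * r j) x = rmulF4 (e j * e i) x"
    using LF4.e_r_r[OF 10] by (intro rmulF4_eq) (simp add: mulF4_mult r_def e_def)
  then show ?case
    using relF4_braid[THEN mulF4_relation(2), OF 10, of x] by (simp add: mulF4_mult)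
next
  case (13 x)
  have "rmulF4 (e f3 * r f2 * e f3 * r f2) x = rmulF4 (e f3 * e f2 * e f3) x"
    using LF4.e3r2e3r2 by (intro rmulF4_eq) (simp add: mulF4_mult r_def e_def)
  then show ?case
    by (simp add: mulF4_mult)
next
  case (18 x)
  have "rmulF4 (r f2 * e f3 * e f2) x = rmulF4 (e f3 * e f2) x"
    using LF4.r2e3e2 by (intro rmulF4_eq) (simp add: mulF4_mult r_def e_def)
  then show ?case
    by (simp add: mulF4_mult)
next
  case (15 x)
  have "rmulF4 (e f2) (rmulF4 dl y) = rmulF4 dl (rmulF4 (e f2) y)" for y
    unfolding e_def by (rule mulF4_dl)
  then show ?case
    using relF4_23(5)[THEN mulF4_relation(2), of x] by (simp add: mulF4_mult)
next
  case (16 x)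
  have "rmulF4 (e f2) (rmulF4 dl y) = rmulF4 dl (rmulF4 (e f2) y)" for y
    unfolding e_def by (rule mulF4_dl)
  then show ?case
    using relF4_23(6)[THEN mulF4_relation(2), of x] by (simp add: mulF4_mult)
qed (use relF4_23[THEN mulF4_relation(2)] in \<open>simp_all add: mulF4_mult\<close>)

lemma act_lmulF4: "act (\<lambda>g. lmulF4 (gen g)) w (abs_brF4 (mon v k)) = abs_brF4 (mon (w @ v) k)"
  by (induction w) (simp_all add: mulF4_abs mon_Cons)

lemma act_rmulF4: "act (\<lambda>g. rmulF4 (gen g)) w (abs_brF4 (mon v k)) = abs_brF4 (mon (v @ rev w) k)"
  by (induction w) (simp_all add: mulF4_abs gen_mon mon_mult)

lemma funpow_dl_F4:
  "((lmulF4 dl) ^^ n) (abs_brF4 (mon w k)) = abs_brF4 (mon w (k + int n))"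
  "((rmulF4 dl) ^^ n) (abs_brF4 (mon w k)) = abs_brF4 (mon w (k + int n))"
  by (induction n) (simp_all add: mulF4_abs dl_mon add_ac)

lemma abs_brF4_wcong:
  assumes "abs_brF4 (mon u k) = abs_brF4 (mon v l)" shows "wcong relF4 u v"
proof -
  have "mon u k - mon v l \<in> ideal_gen relF4"
    using assms by (simp add: brF4.abs_eq_iff IF4_def)
  from ideal_gen_scal[OF this, of "dpow (- k)"] show ?thesis
    unfolding wcong_def by (auto simp: scal_diff scal_mon)
qed

lemma LF4_eqd: "LF4.eqd (abs_brF4 (mon u k)) (abs_brF4 (mon v l)) \<Longrightarrow> wcong relF4 u v"
  unfolding LF4.eqd_def by (auto simp: funpow_dl_F4 intro: abs_brF4_wcong)

lemma RF4_eqd: "RF4.eqd (abs_brF4 (mon u k)) (abs_brF4 (mon v l)) \<Longrightarrow> wcong relF4 u v"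
  unfolding RF4.eqd_def by (auto simp: funpow_dl_F4 intro: abs_brF4_wcong)

section \<open>Normal forms of words of type F4\<close>

lemma wd_append [simp]: "wd (u @ v) = wd u @ wd v"
  by (simp add: wd_def)

lemma wd_rev: "wd (rev u) = rev (wd u)"
  by (induction u) (simp_all add: wd_def letter_word_def tword_def)

definition ncong :: "nat list \<Rightarrow> nat list \<Rightarrow> bool" (infix "\<approx>" 50) where
  "u \<approx> v \<longleftrightarrow> wcong relF4 (wd u) (wd v)"

lemma ncong_refl [simp]: "u \<approx> u"
  by (simp add: ncong_def)

lemma ncong_sym: "u \<approx> v \<Longrightarrow> v \<approx> u"
  by (simp add: ncong_def wcong_sym)

lemma ncong_trans [trans]: "u \<approx> v \<Longrightarrow> v \<approx> w \<Longrightarrow> u \<approx> w"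
  unfolding ncong_def by (rule wcong_trans)

lemma ncong_append: "u \<approx> v \<Longrightarrow> p @ u @ q \<approx> p @ v @ q"
  unfolding ncong_def wd_append by (rule wcong_append)

lemma ncong_left:
  assumes "LF4.eqd (LF4.actn u (abs_brF4 1)) (LF4.actn v (abs_brF4 1))" shows "u \<approx> v"
  using assms unfolding LF4.act_wd[symmetric] ncong_def mon_Nil[symmetric] act_lmulF4
  by (intro LF4_eqd) simp

lemma ncong_right:
  assumes "RF4.eqd (RF4.actn u (abs_brF4 1)) (RF4.actn v (abs_brF4 1))" shows "rev u \<approx> rev v"
  using assms unfolding RF4.act_wd[symmetric] ncong_def mon_Nil[symmetric] act_rmulF4
  by (intro RF4_eqd) (simp add: wd_rev)

lemma rev_eps: "rev (eps d) \<approx> eps d"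
proof -
  have "[6,5] \<approx> [5,6]"
    by (rule ncong_left) (simp add: LF4.wte)
  then show ?thesis
    by (auto simp: eps_def)
qed

lemma reduce_left:
  assumes "d \<in> {1,2,3}"
  shows "(\<exists>b\<in>set (lreps d). \<exists>h\<in>set (stab d). u @ eps d \<approx> b @ h @ eps d)
    \<or> (\<exists>d'>d. d' \<le> 3 \<and> (\<exists>p q. u @ eps d \<approx> p @ eps d' @ q))"
proof -
  consider b h where "b \<in> set (lreps d)" "h \<in> set (stab d)"
      "LF4.eqd (LF4.actn (u @ eps d) (abs_brF4 1)) (LF4.actn (b @ h @ eps d) (abs_brF4 1))"
    | d' p q where "d' > d" "d' \<le> 3"
      "LF4.eqd (LF4.actn (u @ eps d) (abs_brF4 1)) (LF4.actn (p @ eps d' @ q) (abs_brF4 1))"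
    using LF4.actn_layer[OF assms, of u "abs_brF4 1"]
    unfolding LF4.layer_def LF4.deeper_def by auto
  then show ?thesis
  proof cases
    case 1
    then show ?thesis
      using ncong_left[OF 1(3)] by blast
  next
    case 2
    then show ?thesis
      using ncong_left[OF 2(3)] by blast
  qed
qed

text \<open>The left reduction, carried out for right multiplication and read backwards. Reversal
  preserves the idempotents because \<open>e1\<close> and \<open>t\<close> commute and
  \<open>t\<close> is a palindrome.\<close>

lemma reduce_right:
  assumes "d \<in> {1,2,3}"
  shows "(\<exists>b\<in>set (lreps d). \<exists>h\<in>set (stab d). eps d @ v \<approx> eps d @ rev h @ rev b)
    \<or> (\<exists>d'>d. d' \<le> 3 \<and> (\<exists>p q. eps d @ v \<approx> p @ eps d' @ q))"
proof -
  have eps: "p @ rev (eps d) @ q \<approx> p @ eps d @ q" for p q d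
    by (rule ncong_append[OF rev_eps])
  have start: "eps d @ v \<approx> rev (eps d) @ v"
    using ncong_sym[OF eps[of "[]" d v]] by simp
  consider b h where "b \<in> set (lreps d)" "h \<in> set (stab d)"
      "RF4.eqd (RF4.actn (rev v @ eps d) (abs_brF4 1)) (RF4.actn (b @ h @ eps d) (abs_brF4 1))"
    | d' p q where "d' > d" "d' \<le> 3"
      "RF4.eqd (RF4.actn (rev v @ eps d) (abs_brF4 1)) (RF4.actn (p @ eps d' @ q) (abs_brF4 1))"
    using RF4.actn_layer[OF assms, of "rev v" "abs_brF4 1"]
    unfolding RF4.layer_def RF4.deeper_def by auto
  then show ?thesis
  proof cases
    case 1
    have "eps d @ v \<approx> eps d @ rev h @ rev b"
      using ncong_trans[OF start ncong_trans[OF _ eps[of "[]" d "rev h @ rev b", simplified]]] ncong_right[OF 1(3)]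
      by simp
    then show ?thesis
      using 1 by blast
  next
    case 2
    have "eps d @ v \<approx> rev q @ eps d' @ rev p"
      using ncong_trans[OF start ncong_trans[OF _ eps[of "rev q" d' "rev p"]]] ncong_right[OF 2(3)]
      by simp
    then show ?thesis
      using 2 by blast
  qed
qed

definition nf0 :: "nat list set" where
  "nf0 = {b @ h | b h. b \<in> set W24 \<and> h \<in> set C48}"

definition nf :: "nat \<Rightarrow> nat list set" where
  "nf d = {b @ h @ eps d @ rev b' | b h b'. b \<in> set (lreps d) \<and> h \<in> set (stab d) \<and> b' \<in> set (lreps d)}"

text \<open>Each side is reduced separately. If neither falls into a deeper stratum, the two group
  elements meet next to the idempotent and multiply inside \<open>stab d\<close>; otherwise the
  depth grows, and it is bounded by 3.\<close>

lemma reduce_eps: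
  assumes "d \<in> {1,2,3}"
  shows "\<exists>d'\<in>{1,2,3}. \<exists>n\<in>nf d'. u @ eps d @ v \<approx> n"
  using assms
proof (induction "3 - d" arbitrary: d u v rule: less_induct)
  case less
  have deeper: ?case if "d' > d" "d' \<le> 3" "u @ eps d @ v \<approx> p @ eps d' @ q" for d' p q
  proof -
    have "\<exists>d''\<in>{1,2,3}. \<exists>n\<in>nf d''. p @ eps d' @ q \<approx> n"
      using that less.prems by (intro less.hyps) auto
    then show ?thesis
      using ncong_trans[OF that(3)] by blast
  qed
  show ?case
    using reduce_left[OF less.prems, of u]
  proof (elim disjE bexE exE conjE)
    fix d' p q assume d': "d' > d" "d' \<le> 3" and eq: "u @ eps d \<approx> p @ eps d' @ q"
    have "u @ eps d @ v \<approx> p @ eps d' @ (q @ v)"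
      using ncong_append[OF eq, of "[]" v] by simp
    then show ?case
      using deeper[OF d'] by blast
  next
    fix b h assume b: "b \<in> set (lreps d)" and h: "h \<in> set (stab d)" and eq: "u @ eps d \<approx> b @ h @ eps d"
    have uv: "u @ eps d @ v \<approx> b @ h @ eps d @ v"
      using ncong_append[OF eq, of "[]" v] by simp
    show ?case
      using reduce_right[OF less.prems, of v]
    proof (elim disjE bexE exE conjE)
      fix d' p q assume d': "d' > d" "d' \<le> 3" and eq': "eps d @ v \<approx> p @ eps d' @ q"
      have "u @ eps d @ v \<approx> (b @ h @ p) @ eps d' @ q"
        using ncong_trans[OF uv] ncong_append[OF eq', of "b @ h" "[]"] by simp
      then show ?case
        using deeper[OF d'] by blast
    next
      fix b' h' assume b': "b' \<in> set (lreps d)" and h': "h' \<in> set (stab d)"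
        and eq': "eps d @ v \<approx> eps d @ rev h' @ rev b'"
      have v: "u @ eps d @ v \<approx> b @ h @ eps d @ rev h' @ rev b'"
        using ncong_trans[OF uv] ncong_append[OF eq', of "b @ h" "[]"] by simp
      obtain h'' where h'': "h'' \<in> set (stab d)"
        "LF4.actn (h @ eps d @ rev h') (abs_brF4 1) = LF4.actn (h'' @ eps d) (abs_brF4 1)"
        using LF4.stab_mult_rev[OF less.prems h h'] by auto
      then have "h @ eps d @ rev h' \<approx> h'' @ eps d"
        by (intro ncong_left) simp
      from ncong_append[OF this, of b "rev b'"] have "u @ eps d @ v \<approx> b @ h'' @ eps d @ rev b'"
        using ncong_trans[OF v] by simp
      then show ?case
        using b b' h''(1) less.prems unfolding nf_def by blast
    qed
  qed
qed

lemma F4_word_normal_form: "\<exists>n. n \<in> nf0 \<union> nf 1 \<union> nf 2 \<union> nf 3 \<and> wcong relF4 w (wd n)"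
proof -
  have w: "wcong relF4 w (wd (digits w))"
  proof -
    have "act (\<lambda>g. lmulF4 (gen g)) w (abs_brF4 (mon [] 0)) = act (\<lambda>g. lmulF4 (gen g)) (wd (digits w)) (abs_brF4 (mon [] 0))"
      by (simp add: LF4.act_wd LF4.actn_digits)
    then show ?thesis
      unfolding act_lmulF4 by (simp add: abs_brF4_wcong)
  qed
  have "\<exists>n. n \<in> nf0 \<union> nf 1 \<union> nf 2 \<union> nf 3 \<and> digits w \<approx> n"
  proof (cases "set (digits w) \<subseteq> {1,2,3,4}")
    case True
    then obtain b h where "b \<in> set W24" "h \<in> set C48"
      "LF4.actn (digits w) (abs_brF4 1) = LF4.actn b (LF4.actn h (abs_brF4 1))"
      using LF4.actn_group by blast
    moreover from this have "digits w \<approx> b @ h"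
      by (intro ncong_left) simp
    ultimately show ?thesis
      unfolding nf0_def by blast
  next
    case False
    \<comment> \<open>A digit that is not a reflection denotes \<open>e1\<close> or
      \<open>t\<close>, that is \<open>eps 2\<close> or \<open>eps 1\<close>, and the reduction
      starts from this occurrence.\<close>
    then obtain m u v where "digits w = u @ [m] @ v" "m \<notin> {1,2,3,4}"
      by (metis append_Cons append_Nil split_list subsetI)
    moreover have "wd [m] = wd (eps (if m = 5 then 2 else 1))"
      using calculation(2) by (auto simp: wd_def letter_word_def eps_def)
    ultimately have "wd (digits w) = wd (u @ eps (if m = 5 then 2 else 1) @ v)"
      by (simp only: wd_append)
    then have "digits w \<approx> u @ eps (if m = 5 then 2 else 1) @ v"
      by (simp add: ncong_def)
    moreover have "(if m = 5 then 2 else 1 :: nat) \<in> {1,2,3}"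
      by simp
    from reduce_eps[OF this, of u v] obtain d' n where "d' \<in> {1,2,3}" "n \<in> nf d'"
      "u @ eps (if m = 5 then 2 else 1) @ v \<approx> n"
      by blast
    ultimately have "n \<in> nf0 \<union> nf 1 \<union> nf 2 \<union> nf 3" "digits w \<approx> n"
      using ncong_trans by (blast, blast)
    then show ?thesis
      by blast
  qed
  then show ?thesis
    using wcong_trans[OF w] unfolding ncong_def by blast
qed

section \<open>A model over the field with two elements\<close>

text \<open>The root lattice of type \<open>E\<^sub>6\<close> modulo 2 is a symplectic space over the field with two elements.
  A reflection acts on it as a transvection, and the generator \<open>E\<^sub>i\<close> as the correspondence that restricts to
  the orthogonal complement of the simple root \<open>\<alpha>\<^sub>i\<close> and passes to the quotient by \<open>\<alpha>\<^sub>i\<close>.  A power of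
  \<open>\<delta>\<close> is produced when \<open>\<alpha>\<^sub>i\<close> already lies in the subspace that is transported.\<close>

datatype vec = Vec bool bool bool bool bool bool

fun vadd :: "vec \<Rightarrow> vec \<Rightarrow> vec" where
  "vadd (Vec a b c d k l) (Vec a' b' c' d' k' l') = Vec (a \<noteq> a') (b \<noteq> b') (c \<noteq> c') (d \<noteq> d') (k \<noteq> k') (l \<noteq> l')"

definition vzero :: vec where "vzero = Vec False False False False False False"

fun root :: "E6node \<Rightarrow> vec" where
  "root n1 = Vec True False False False False False"
| "root n2 = Vec False True False False False False"
| "root n3 = Vec False False True False False False"
| "root n4 = Vec False False False True False False"
| "root n5 = Vec False False False False True False"
| "root n6 = Vec False False False False False True"

text \<open>Pairing with a simple root modulo 2: the coordinates at the neighbouring nodes are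
  added, while the diagonal entry 2 vanishes.\<close>

fun form :: "E6node \<Rightarrow> vec \<Rightarrow> bool" where
  "form n1 (Vec a b c d k l) = c"
| "form n2 (Vec a b c d k l) = d"
| "form n3 (Vec a b c d k l) = (a \<noteq> d)"
| "form n4 (Vec a b c d k l) = (b \<noteq> (c \<noteq> k))"
| "form n5 (Vec a b c d k l) = (d \<noteq> l)"
| "form n6 (Vec a b c d k l) = k"

lemma vadd_comm: "vadd x y = vadd y x"
  and vadd_assoc: "vadd (vadd x y) z = vadd x (vadd y z)"
  and vadd_self [simp]: "vadd x x = vzero" "vadd vzero x = x" "vadd x vzero = x"
  by (cases x; cases y; cases z; auto simp: vzero_def)+

lemma vadd_left_comm: "vadd x (vadd y z) = vadd y (vadd x z)"
  by (metis vadd_assoc vadd_comm)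

lemma vadd_cancel [simp]: "vadd x (vadd x y) = y"
  by (metis vadd_assoc vadd_self)

lemma form_vadd [simp]: "form i (vadd x y) \<longleftrightarrow> form i x \<noteq> form i y"
  by (cases i; cases x; cases y) auto

lemma form_zero [simp]: "\<not> form i vzero"
  by (cases i) (simp_all add: vzero_def)

lemma form_root [simp]: "form i (root j) \<longleftrightarrow> adjE6 i j"
  by (cases i; cases j) (simp_all add: adjE6_def doubleton_eq_iff)

lemma adjE6_sym: "adjE6 i j \<longleftrightarrow> adjE6 j i" and adjE6_irrefl [simp]: "\<not> adjE6 i i"
  by (cases i; cases j; simp add: adjE6_def doubleton_eq_iff)+

definition reflect :: "E6node \<Rightarrow> vec \<Rightarrow> vec" where
  "reflect i x = (if form i x then vadd (root i) x else x)"

fun grel :: "E6gen \<Rightarrow> (vec \<times> vec) set" where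
  "grel (ER i) = {(x, y). y = reflect i x}"
| "grel (EE i) = {(x, y). \<not> form i x \<and> (y = x \<or> y = vadd (root i) x)}"

primrec wrel :: "E6gen list \<Rightarrow> (vec \<times> vec) set" where
  "wrel [] = Id"
| "wrel (g # w) = wrel w O grel g"

text \<open>The exponent is relative to the subspace arriving from the right. This makes
  \<open>wexp\<close> a cocycle over the action of words on subspaces, and
  \<open>wexp_append\<close> is the cocycle identity.\<close>

fun gexp :: "E6gen \<Rightarrow> vec set \<Rightarrow> int" where
  "gexp (ER i) L = 0"
| "gexp (EE i) L = (if root i \<in> L then 1 else 0)"

primrec wexp :: "E6gen list \<Rightarrow> vec set \<Rightarrow> int" where
  "wexp [] L = 0"
| "wexp (g # w) L = gexp g (wrel w `` L) + wexp w L"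

lemma wrel_append: "wrel (u @ v) = wrel v O wrel u"
  by (induction u) (auto simp: O_assoc)

lemma wexp_append: "wexp (u @ v) L = wexp u (wrel v `` L) + wexp v L"
  by (induction u) (auto simp: wrel_append relcomp_Image)

definition vsubspace :: "vec set \<Rightarrow> bool" where
  "vsubspace L \<longleftrightarrow> vzero \<in> L \<and> (\<forall>x\<in>L. \<forall>y\<in>L. vadd x y \<in> L)"

lemma reflect_vadd: "reflect i (vadd x y) = vadd (reflect i x) (reflect i y)"
  by (auto simp: reflect_def vadd_comm vadd_assoc vadd_left_comm)

lemma reflect_zero [simp]: "reflect i vzero = vzero"
  by (simp add: reflect_def)

lemma vsubspace_grel:
  assumes "vsubspace L" shows "vsubspace (grel g `` L)"
proof (cases g)
  case (ER i)
  then have "grel g `` L = reflect i ` L"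
    by auto
  then show ?thesis
    using assms unfolding vsubspace_def by (auto simp flip: reflect_vadd) (metis image_eqI reflect_zero)
next
  case (EE i)
  have "vadd x y \<in> grel g `` L" if x: "x \<in> grel g `` L" and y: "y \<in> grel g `` L" for x y
  proof -
    obtain x' where "x' \<in> L" "\<not> form i x'" "x = x' \<or> x = vadd (root i) x'"
      using x EE by auto
    moreover obtain y' where "y' \<in> L" "\<not> form i y'" "y = y' \<or> y = vadd (root i) y'"
      using y EE by auto
    moreover from calculation have "vadd x' y' \<in> L" "\<not> form i (vadd x' y')"
      "vadd x y = vadd x' y' \<or> vadd x y = vadd (root i) (vadd x' y')"
      using assms by (auto simp: vsubspace_def vadd_assoc vadd_left_comm vadd_comm)
    ultimately show ?thesis
      unfolding EE grel.simps by blast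
  qed
  moreover have "vzero \<in> grel g `` L"
    using assms form_zero unfolding EE grel.simps vsubspace_def by blast
  ultimately show ?thesis
    unfolding vsubspace_def by blast
qed

lemma vsubspace_wrel: "vsubspace L \<Longrightarrow> vsubspace (wrel w `` L)"
  by (induction w) (simp_all add: relcomp_Image vsubspace_grel)

text \<open>Quantifying over all incoming subspaces makes the condition stable under multiplication
  on both sides: a right factor changes \<open>L\<close>, and a left factor sees only the common
  image.\<close>

definition sound :: "E6gen list \<Rightarrow> E6gen list \<Rightarrow> int \<Rightarrow> bool" where
  "sound u v j \<longleftrightarrow> wrel u = wrel v \<and> (\<forall>L. vsubspace L \<longrightarrow> wexp u L = wexp v L + j)"

lemma reflect_reflect [simp]: "reflect i (reflect i x) = x"
  by (simp add: reflect_def)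

lemma form_reflect [simp]: "form j (reflect i x) \<longleftrightarrow> form j x \<noteq> (form i x \<and> adjE6 j i)"
  by (auto simp: reflect_def)

lemma reflect_eq_iff: "reflect i x = y \<longleftrightarrow> x = reflect i y"
  by (metis reflect_reflect)

lemma reflect_root: "reflect i (root j) = (if adjE6 i j then vadd (root i) (root j) else root j)"
  by (simp add: reflect_def)

lemma image_reflect: "root j \<in> grel (ER i) `` L \<longleftrightarrow> reflect i (root j) \<in> L"
proof -
  have "grel (ER i) `` L = reflect i ` L"
    by auto
  then show ?thesis
    by (metis (no_types, lifting) image_iff reflect_reflect)
qed

lemma image_EE:
  assumes "\<not> adjE6 l k"
  shows "root k \<in> grel (EE l) `` L \<longleftrightarrow> root k \<in> L \<or> vadd (root l) (root k) \<in> L"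
proof -
  have "root k \<in> grel (EE l) `` L \<longleftrightarrow> (\<exists>x\<in>L. \<not> form l x \<and> (x = root k \<or> x = vadd (root l) (root k)))"
    by (auto simp: Image_iff)
  also have "\<dots> \<longleftrightarrow> root k \<in> L \<or> vadd (root l) (root k) \<in> L"
  proof -
    have "\<not> form l (root k)" "\<not> form l (vadd (root l) (root k))"
      using assms by simp_all
    then show ?thesis
      by blast
  qed
  finally show ?thesis .
qed

lemma rel_eqI: "(\<And>x z. (x, z) \<in> A \<longleftrightarrow> (x, z) \<in> B) \<Longrightarrow> A = B"
  by auto

lemma sound_RR: "sound [ER i, ER i] [] 0"
proof -
  have "(x, z) \<in> wrel [ER i, ER i] \<longleftrightarrow> (x, z) \<in> wrel []" for x z
    by (simp add: relcomp_unfold eq_commute)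
  then have "wrel [ER i, ER i] = wrel []"
    by (rule rel_eqI)
  then show ?thesis
    by (simp add: sound_def del: grel.simps(1))
qed

lemma sound_RE: "sound [ER i, EE i] [EE i] 0"
proof -
  have "(x, z) \<in> wrel [ER i, EE i] \<longleftrightarrow> (x, z) \<in> wrel [EE i]" for x z
    by (cases "form i x")
      (simp_all add: relcomp_unfold conj_disj_distribL conj_disj_distribR ex_disj_distrib reflect_def disj_ac)
  then have "wrel [ER i, EE i] = wrel [EE i]"
    by (rule rel_eqI)
  then show ?thesis
    by (simp add: sound_def del: grel.simps)
qed

lemma sound_ER: "sound [EE i, ER i] [EE i] 0"
proof -
  have "(x, z) \<in> wrel [EE i, ER i] \<longleftrightarrow> (x, z) \<in> wrel [EE i]" for x z
    by (cases "form i x") (simp_all add: relcomp_unfold reflect_def)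
  then have "wrel [EE i, ER i] = wrel [EE i]"
    by (rule rel_eqI)
  then show ?thesis
    by (simp add: sound_def image_reflect reflect_root del: grel.simps)
qed

lemma sound_EE: "sound [EE i, EE i] [EE i] 1"
proof -
  have "(x, z) \<in> wrel [EE i, EE i] \<longleftrightarrow> (x, z) \<in> wrel [EE i]" for x z
    by (cases "form i x")
      (simp_all add: relcomp_unfold conj_disj_distribL conj_disj_distribR ex_disj_distrib disj_ac)
  then have "wrel [EE i, EE i] = wrel [EE i]"
    by (rule rel_eqI)
  then show ?thesis
    by (simp add: sound_def image_EE vsubspace_def del: grel.simps)
qed

lemma sound_comm:
  assumes "\<not> adjE6 i j"
  shows "sound [ER i, ER j] [ER j, ER i] 0" "sound [EE i, ER j] [ER j, EE i] 0" "sound [EE i, EE j] [EE j, EE i] 0"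
proof -
  have ji: "\<not> adjE6 j i"
    using assms adjE6_sym by blast
  show "sound [ER i, ER j] [ER j, ER i] 0"
    using assms ji by (auto simp: sound_def relcomp_unfold reflect_def vadd_left_comm)
  have "wrel [EE i, ER j] = wrel [ER j, EE i]"
    using assms ji by (auto simp: relcomp_unfold reflect_vadd reflect_root)
  then show "sound [EE i, ER j] [ER j, EE i] 0"
    using ji by (auto simp: sound_def image_reflect reflect_root simp del: grel.simps)
  \<comment> \<open>For distinct nodes both exponents are the dimension of the intersection of
    \<open>L\<close> with the span of the two roots, which does not depend on the order.\<close>
  have "wexp [EE i, EE j] L = wexp [EE j, EE i] L" if "vsubspace L" for L
  proof -
    have sub: "root k \<in> L" if "root l \<in> L" "vadd (root l) (root k) \<in> L" for k l
      using \<open>vsubspace L\<close> that unfolding vsubspace_def by (metis vadd_cancel)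
    show ?thesis
      using sub[of i j] sub[of j i] by (auto simp: image_EE[OF assms] image_EE[OF ji] vadd_comm simp del: grel.simps)
  qed
  moreover have "(x, z) \<in> wrel [EE i, EE j] \<longleftrightarrow> (x, z) \<in> wrel [EE j, EE i]" for x z
    using assms ji by (cases "form i x"; cases "form j x")
      (simp_all add: relcomp_unfold conj_disj_distribL conj_disj_distribR ex_disj_distrib vadd_left_comm disj_ac)
  then have "wrel [EE i, EE j] = wrel [EE j, EE i]"
    by (rule rel_eqI)
  ultimately show "sound [EE i, EE j] [EE j, EE i] 0"
    by (simp add: sound_def)
qed

lemma sound_braid:
  assumes "adjE6 i j"
  shows "sound [ER i, ER j, ER i] [ER j, ER i, ER j] 0" "sound [ER j, ER i, EE j] [EE i, EE j] 0"
    "sound [ER i, EE j, ER i] [ER j, EE i, ER j] 0"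
proof -
  have ji: "adjE6 j i"
    using assms adjE6_sym by blast
  show "sound [ER i, ER j, ER i] [ER j, ER i, ER j] 0"
    using assms ji by (auto simp: sound_def relcomp_unfold reflect_def vadd_left_comm vadd_comm vadd_assoc)
  have "(x, z) \<in> wrel [ER j, ER i, EE j] \<longleftrightarrow> (x, z) \<in> wrel [EE i, EE j]" for x z
    using assms ji by (cases "form i x"; cases "form j x")
      (simp_all add: relcomp_unfold conj_disj_distribL conj_disj_distribR ex_disj_distrib reflect_def
        vadd_left_comm vadd_comm vadd_assoc disj_commute)
  then have "wrel [ER j, ER i, EE j] = wrel [EE i, EE j]"
    by (rule rel_eqI)
  \<comment> \<open>The image under \<open>EE j\<close> is orthogonal to \<open>root j\<close>, and
    \<open>root i\<close> is not; so no \<delta> arises from the second idempotent.\<close>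
  moreover have "root i \<notin> grel (EE j) `` L" for L
  proof
    assume "root i \<in> grel (EE j) `` L"
    then obtain x where "\<not> form j x" "root i = x \<or> root i = vadd (root j) x"
      by auto
    then have "\<not> form j (root i)"
      by (metis adjE6_irrefl form_root form_vadd)
    then show False
      using ji by simp
  qed
  ultimately show "sound [ER j, ER i, EE j] [EE i, EE j] 0"
    by (simp add: sound_def del: grel.simps(2))
  \<comment> \<open>The conjugate is the correspondence of the root \<open>root i + root j\<close>,
    a description symmetric in the two nodes.\<close>
  have conj: "(x, z) \<in> wrel [ER i, EE j, ER i] \<longleftrightarrow> form i x = form j x \<and> (z = x \<or> z = vadd (vadd (root i) (root j)) x)"
    if "adjE6 i j" "adjE6 j i" for i j x z
  proof -
    have "(x, z) \<in> wrel [ER i, EE j, ER i] \<longleftrightarrow> (\<exists>y. (reflect i x, y) \<in> grel (EE j) \<and> z = reflect i y)"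
      by (auto simp: relcomp_unfold simp del: grel.simps(2))
    also have "\<dots> \<longleftrightarrow> (reflect i x, reflect i z) \<in> grel (EE j)"
      by (metis reflect_reflect)
    also have "\<dots> \<longleftrightarrow> \<not> form j (reflect i x) \<and> (reflect i z = reflect i x \<or> reflect i z = vadd (root j) (reflect i x))"
      by simp
    also have "\<dots> \<longleftrightarrow> form i x = form j x \<and> (z = x \<or> z = reflect i (vadd (root j) (reflect i x)))"
      using that by (auto simp: reflect_eq_iff)
    also have "reflect i (vadd (root j) (reflect i x)) = vadd (vadd (root i) (root j)) x"
      using that by (simp add: reflect_vadd reflect_root)
    finally show ?thesis .
  qed
  have "wrel [ER i, EE j, ER i] = wrel [ER j, EE i, ER j]"
    by (rule rel_eqI, unfold conj[OF assms ji] conj[OF ji assms]) (auto simp: vadd_comm[of "root i"])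
  moreover have "root j \<in> grel (ER i) `` L \<longleftrightarrow> root i \<in> grel (ER j) `` L" for L
    using assms ji by (simp add: image_reflect reflect_root vadd_comm del: grel.simps)
  ultimately show "sound [ER i, EE j, ER i] [ER j, EE i, ER j] 0"
    by (simp add: sound_def del: grel.simps)
qed

section \<open>Functionals that vanish on the ideal\<close>

lemma relE6_sound:
  assumes "s \<in> relE6" shows "\<exists>u v j. s = mon u 0 - mon v j \<and> sound u v j"
proof -
  have dl: "dl * E i = mon [EE i] 1" for i
    by (simp add: E_def gen_mon dl_mon)
  note [simp] = dl R_def E_def gen_mon mon_mult
  consider i where "s = mon [ER i, ER i] 0 - mon [] 0"
    | i where "s = mon [ER i, EE i] 0 - mon [EE i] 0"
    | i where "s = mon [EE i, ER i] 0 - mon [EE i] 0"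
    | i where "s = mon [EE i, EE i] 0 - mon [EE i] 1"
    | i j where "\<not> adjE6 i j" "s \<in> {mon [ER i, ER j] 0 - mon [ER j, ER i] 0,
        mon [EE i, ER j] 0 - mon [ER j, EE i] 0, mon [EE i, EE j] 0 - mon [EE j, EE i] 0}"
    | i j where "adjE6 i j" "s \<in> {mon [ER i, ER j, ER i] 0 - mon [ER j, ER i, ER j] 0,
        mon [ER j, ER i, EE j] 0 - mon [EE i, EE j] 0, mon [ER i, EE j, ER i] 0 - mon [ER j, EE i, ER j] 0}"
    using assms unfolding relE6_def mon_Nil by (auto simp: dl_mon)
  then show ?thesis
    by cases (use sound_RR sound_RE sound_ER sound_EE sound_comm sound_braid in blast)+
qed

text \<open>Words with correspondence \<open>F\<close> are weighted by the power of \<delta> that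
  they produce from the zero subspace. The scalar is placed in the free algebra as a multiple of 1,
  so that \<open>lin\<close> applies.\<close>

definition coef :: "(vec \<times> vec) set \<Rightarrow> E6gen falg \<Rightarrow> E6gen falg" where
  "coef F = lin (\<lambda>w. if wrel (letters w) = F then scal (dpow (wexp (letters w) {vzero})) 1 else 0)"

lemma coef_single:
  "coef F (Poly_Mapping.single w c) = (if wrel (letters w) = F then scal (c * dpow (wexp (letters w) {vzero})) 1 else 0)"
  by (simp add: coef_def lin_single)

lemma coef_mon: "coef F (mon w k) = (if wrel w = F then scal (dpow (k + wexp w {vzero})) 1 else 0)"
  by (simp add: mon_def coef_single dpow_add)

text \<open>The right factor \<open>b\<close> produces a subspace on which the exponents of
  \<open>u\<close> and \<open>v\<close> differ by exactly \<open>j\<close>. Since \<open>u\<close>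
  and \<open>v\<close> have the same image, the left factor \<open>a\<close> contributes equally to
  both terms.\<close>

lemma sound_coef:
  assumes "sound u v j"
  shows "coef F (Poly_Mapping.single a c * (mon u 0 - mon v j) * Poly_Mapping.single b c') = 0"
proof -
  have L: "vsubspace (wrel (letters b) `` {vzero})"
    by (intro vsubspace_wrel) (simp add: vsubspace_def)
  have "wexp u (wrel (letters b) `` {vzero}) = wexp v (wrel (letters b) `` {vzero}) + j"
    using assms L unfolding sound_def by blast
  moreover have "wrel u = wrel v"
    using assms by (simp add: sound_def)
  ultimately show ?thesis
    by (simp add: right_diff_distrib left_diff_distrib mon_def mult_single coef_def lin_diff lin_single
        plus_word_def wrel_append wexp_append dpow_add relcomp_Image mult_ac)
qed

lemma coef_IE6:
  assumes "x \<in> IE6" shows "coef F x = 0"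
  using assms unfolding IE6_def
proof induction
  case (gen_in s a b)
  obtain u v j where s: "s = mon u 0 - mon v j" "sound u v j"
    using relE6_sound[OF gen_in] by blast
  let ?s = "\<lambda>p::E6gen falg. \<lambda>w. Poly_Mapping.single w (Poly_Mapping.lookup p w)"
  have "coef F (a * s * b) = coef F ((\<Sum>w\<in>Poly_Mapping.keys a. ?s a w) * s * (\<Sum>w\<in>Poly_Mapping.keys b. ?s b w))"
    by (simp flip: falg_expand)
  also have "\<dots> = (\<Sum>w'\<in>Poly_Mapping.keys b. \<Sum>w\<in>Poly_Mapping.keys a. coef F (?s a w * s * ?s b w'))"
    unfolding coef_def by (simp only: sum_distrib_left sum_distrib_right lin_sum)
  also have "\<dots> = 0"
    by (simp add: s(1) sound_coef[OF s(2)])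
  finally show ?case .
qed (simp_all add: coef_def lin_add lin_uminus)

section \<open>Rewriting in the algebra of type E6\<close>

fun phi_word :: "F4gen \<Rightarrow> E6gen list" where
  "phi_word (Fr f1) = [ER n1, ER n6]"
| "phi_word (Fr f2) = [ER n3, ER n5]"
| "phi_word (Fr f3) = [ER n4]"
| "phi_word (Fr f4) = [ER n2]"
| "phi_word (Fe f1) = [EE n1, EE n6]"
| "phi_word (Fe f2) = [EE n3, EE n5]"
| "phi_word (Fe f3) = [EE n4]"
| "phi_word (Fe f4) = [EE n2]"

declare phi_word.simps [simp del]

locale brauer_E6 =
  fixes f :: "E6gen \<Rightarrow> 'b \<Rightarrow> 'b" and dd di :: "'b \<Rightarrow> 'b"
  assumes dd_di [simp]: "dd (di x) = x" and di_dd [simp]: "di (dd x) = x"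
    and f_dd [simp]: "f g (dd x) = dd (f g x)"
    and RR: "f (ER i) (f (ER i) x) = x"
    and RE: "f (ER i) (f (EE i) x) = f (EE i) x"
    and ER: "f (EE i) (f (ER i) x) = f (EE i) x"
    and EE: "f (EE i) (f (EE i) x) = dd (f (EE i) x)"
    and comm: "i \<noteq> j \<Longrightarrow> \<not> adjE6 i j \<Longrightarrow>
        f (ER i) (f (ER j) x) = f (ER j) (f (ER i) x)
      \<and> f (EE i) (f (ER j) x) = f (ER j) (f (EE i) x)
      \<and> f (EE i) (f (EE j) x) = f (EE j) (f (EE i) x)"
    and braid: "adjE6 i j \<Longrightarrow>
        f (ER i) (f (ER j) (f (ER i) x)) = f (ER j) (f (ER i) (f (ER j) x))
      \<and> f (ER j) (f (ER i) (f (EE j) x)) = f (EE i) (f (EE j) x)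
      \<and> f (ER i) (f (EE j) (f (ER i) x)) = f (ER j) (f (EE i) (f (ER j) x))"
begin

abbreviation "R1 \<equiv> f (ER n1)"
abbreviation "E1 \<equiv> f (EE n1)"
abbreviation "R2 \<equiv> f (ER n2)"
abbreviation "E2 \<equiv> f (EE n2)"
abbreviation "R3 \<equiv> f (ER n3)"
abbreviation "E3 \<equiv> f (EE n3)"
abbreviation "R4 \<equiv> f (ER n4)"
abbreviation "E4 \<equiv> f (EE n4)"
abbreviation "R5 \<equiv> f (ER n5)"
abbreviation "E5 \<equiv> f (EE n5)"
abbreviation "R6 \<equiv> f (ER n6)"
abbreviation "E6 \<equiv> f (EE n6)"

lemma dd_inject [simp]: "dd x = dd y \<longleftrightarrow> x = y"
  by (metis di_dd)

lemmas [simp] = RR RE ER EE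

text \<open>The letters \<open>A, \<dots>, F\<close> in the names of the rules stand for \<open>E\<^sub>1, \<dots>, E\<^sub>6\<close>.\<close>

lemma q21 [simp]: "R2 (R1 x) = R1 (R2 x)"
  using comm[of n1 n2 x] by (simp add: adjE6_def doubleton_eq_iff)

lemma q313 [simp]: "R3 (R1 (R3 x)) = R1 (R3 (R1 x))"
  using braid[of n1 n3 x] by (simp add: adjE6_def doubleton_eq_iff)

lemma q41 [simp]: "R4 (R1 x) = R1 (R4 x)"
  using comm[of n1 n4 x] by (simp add: adjE6_def doubleton_eq_iff)

lemma q51 [simp]: "R5 (R1 x) = R1 (R5 x)"
  using comm[of n1 n5 x] by (simp add: adjE6_def doubleton_eq_iff)

lemma q61 [simp]: "R6 (R1 x) = R1 (R6 x)"
  using comm[of n1 n6 x] by (simp add: adjE6_def doubleton_eq_iff)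

lemma q32 [simp]: "R3 (R2 x) = R2 (R3 x)"
  using comm[of n2 n3 x] by (simp add: adjE6_def doubleton_eq_iff)

lemma q424 [simp]: "R4 (R2 (R4 x)) = R2 (R4 (R2 x))"
  using braid[of n2 n4 x] by (simp add: adjE6_def doubleton_eq_iff)

lemma q52 [simp]: "R5 (R2 x) = R2 (R5 x)"
  using comm[of n2 n5 x] by (simp add: adjE6_def doubleton_eq_iff)

lemma q62 [simp]: "R6 (R2 x) = R2 (R6 x)"
  using comm[of n2 n6 x] by (simp add: adjE6_def doubleton_eq_iff)

lemma q434 [simp]: "R4 (R3 (R4 x)) = R3 (R4 (R3 x))"
  using braid[of n3 n4 x] by (simp add: adjE6_def doubleton_eq_iff)

lemma q53 [simp]: "R5 (R3 x) = R3 (R5 x)"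
  using comm[of n3 n5 x] by (simp add: adjE6_def doubleton_eq_iff)

lemma q63 [simp]: "R6 (R3 x) = R3 (R6 x)"
  using comm[of n3 n6 x] by (simp add: adjE6_def doubleton_eq_iff)

lemma q545 [simp]: "R5 (R4 (R5 x)) = R4 (R5 (R4 x))"
  using braid[of n4 n5 x] by (simp add: adjE6_def doubleton_eq_iff)

lemma q64 [simp]: "R6 (R4 x) = R4 (R6 x)"
  using comm[of n4 n6 x] by (simp add: adjE6_def doubleton_eq_iff)

lemma q656 [simp]: "R6 (R5 (R6 x)) = R5 (R6 (R5 x))"
  using braid[of n5 n6 x] by (simp add: adjE6_def doubleton_eq_iff)

lemma q312 [simp]: "R3 (R1 (R2 x)) = R2 (R3 (R1 x))"
  using q32[of "R1 x"] by simp

lemma q4314 [simp]: "R4 (R3 (R1 (R4 x))) = R3 (R4 (R3 (R1 x)))"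
  using q434[of "R1 x"] by simp

lemma q5425 [simp]: "R5 (R4 (R2 (R5 x))) = R4 (R5 (R4 (R2 x)))"
  using q545[of "R2 x"] by simp

lemma q5435 [simp]: "R5 (R4 (R3 (R5 x))) = R4 (R5 (R4 (R3 x)))"
  using q545[of "R3 x"] by simp

lemma q6546 [simp]: "R6 (R5 (R4 (R6 x))) = R5 (R6 (R5 (R4 x)))"
  using q656[of "R4 x"] by simp

lemma q42343 [simp]: "R4 (R2 (R3 (R4 (R3 x)))) = R2 (R4 (R2 (R3 (R4 x))))"
  using q424[of "R3 (R4 x)"] by simp

lemma q42342 [simp]: "R4 (R2 (R3 (R4 (R2 x)))) = R3 (R4 (R2 (R3 (R4 x))))"
  using q434[of "R2 (R4 x)"] by simp

lemma q54235 [simp]: "R5 (R4 (R2 (R3 (R5 x)))) = R4 (R5 (R4 (R2 (R3 x))))"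
  using q5425[of "R3 x"] by simp

lemma q54315 [simp]: "R5 (R4 (R3 (R1 (R5 x)))) = R4 (R5 (R4 (R3 (R1 x))))"
  using q5435[of "R1 x"] by simp

lemma q65426 [simp]: "R6 (R5 (R4 (R2 (R6 x)))) = R5 (R6 (R5 (R4 (R2 x))))"
  using q6546[of "R2 x"] by simp

lemma q65436 [simp]: "R6 (R5 (R4 (R3 (R6 x)))) = R5 (R6 (R5 (R4 (R3 x))))"
  using q6546[of "R3 x"] by simp

lemma q423142 [simp]: "R4 (R2 (R3 (R1 (R4 (R2 x))))) = R3 (R4 (R2 (R3 (R1 (R4 x)))))"
  using q4314[of "R2 (R4 x)"] by simp

lemma q542315 [simp]: "R5 (R4 (R2 (R3 (R1 (R5 x))))) = R4 (R5 (R4 (R2 (R3 (R1 x)))))"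
  using q54235[of "R1 x"] by simp

lemma q654236 [simp]: "R6 (R5 (R4 (R2 (R3 (R6 x))))) = R5 (R6 (R5 (R4 (R2 (R3 x)))))"
  using q65426[of "R3 x"] by simp

lemma q654316 [simp]: "R6 (R5 (R4 (R3 (R1 (R6 x))))) = R5 (R6 (R5 (R4 (R3 (R1 x)))))"
  using q65436[of "R1 x"] by simp

lemma q4231431 [simp]: "R4 (R2 (R3 (R1 (R4 (R3 (R1 x)))))) = R2 (R4 (R2 (R3 (R1 (R4 (R3 x))))))"
  using q42343[of "R1 (R3 x)"] by simp

lemma q5423454 [simp]: "R5 (R4 (R2 (R3 (R4 (R5 (R4 x)))))) = R4 (R5 (R4 (R2 (R3 (R4 (R5 x))))))"
  using q54235[of "R4 (R5 x)"] by simp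

lemma q6542316 [simp]: "R6 (R5 (R4 (R2 (R3 (R1 (R6 x)))))) = R5 (R6 (R5 (R4 (R2 (R3 (R1 x))))))"
  using q654236[of "R1 x"] by simp

lemma q6542346 [simp]: "R6 (R5 (R4 (R2 (R3 (R4 (R6 x)))))) = R5 (R6 (R5 (R4 (R2 (R3 (R4 x))))))"
  using q654236[of "R4 x"] by simp

lemma q54231454 [simp]: "R5 (R4 (R2 (R3 (R1 (R4 (R5 (R4 x))))))) = R4 (R5 (R4 (R2 (R3 (R1 (R4 (R5 x)))))))"
  using q542315[of "R4 (R5 x)"] by simp

lemma q65423146 [simp]: "R6 (R5 (R4 (R2 (R3 (R1 (R4 (R6 x))))))) = R5 (R6 (R5 (R4 (R2 (R3 (R1 (R4 x)))))))"
  using q6542316[of "R4 x"] by simp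

lemma q654234565 [simp]: "R6 (R5 (R4 (R2 (R3 (R4 (R5 (R6 (R5 x)))))))) = R5 (R6 (R5 (R4 (R2 (R3 (R4 (R5 (R6 x))))))))"
  using q6542346[of "R5 (R6 x)"] by simp

lemma q654231436 [simp]: "R6 (R5 (R4 (R2 (R3 (R1 (R4 (R3 (R6 x)))))))) = R5 (R6 (R5 (R4 (R2 (R3 (R1 (R4 (R3 x))))))))"
  using q65423146[of "R3 x"] by simp

lemma q5423143543 [simp]: "R5 (R4 (R2 (R3 (R1 (R4 (R3 (R5 (R4 (R3 x))))))))) = R4 (R5 (R4 (R2 (R3 (R1 (R4 (R3 (R5 (R4 x)))))))))"
  using q54231454[of "R3 (R4 x)"] by simp

lemma q54231435423 [simp]: "R5 (R4 (R2 (R3 (R1 (R4 (R3 (R5 (R4 (R2 (R3 x)))))))))) = R4 (R5 (R4 (R2 (R3 (R1 (R4 (R3 (R5 (R4 (R2 x))))))))))"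
  using q5423143543[of "R2 x"] by simp

lemma qBA [simp]: "E2 (E1 x) = E1 (E2 x)"
  using comm[of n1 n2 x] by (simp add: adjE6_def doubleton_eq_iff)

lemma qA2 [simp]: "E1 (R2 x) = R2 (E1 x)"
  using comm[of n1 n2 x] by (simp add: adjE6_def doubleton_eq_iff)

lemma q31C [simp]: "R3 (R1 (E3 x)) = E1 (E3 x)"
  using braid[of n1 n3 x] by (simp add: adjE6_def doubleton_eq_iff)

lemma q3A3 [simp]: "R3 (E1 (R3 x)) = R1 (E3 (R1 x))"
  using braid[of n1 n3 x] by (simp add: adjE6_def doubleton_eq_iff)

lemma qDA [simp]: "E4 (E1 x) = E1 (E4 x)"
  using comm[of n1 n4 x] by (simp add: adjE6_def doubleton_eq_iff)

lemma qA4 [simp]: "E1 (R4 x) = R4 (E1 x)"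
  using comm[of n1 n4 x] by (simp add: adjE6_def doubleton_eq_iff)

lemma qEA [simp]: "E5 (E1 x) = E1 (E5 x)"
  using comm[of n1 n5 x] by (simp add: adjE6_def doubleton_eq_iff)

lemma qFA [simp]: "E6 (E1 x) = E1 (E6 x)"
  using comm[of n1 n6 x] by (simp add: adjE6_def doubleton_eq_iff)

lemma qB1 [simp]: "E2 (R1 x) = R1 (E2 x)"
  using comm[of n2 n1 x] by (simp add: adjE6_def doubleton_eq_iff)

lemma qCB [simp]: "E3 (E2 x) = E2 (E3 x)"
  using comm[of n2 n3 x] by (simp add: adjE6_def doubleton_eq_iff)

lemma qB3 [simp]: "E2 (R3 x) = R3 (E2 x)"
  using comm[of n2 n3 x] by (simp add: adjE6_def doubleton_eq_iff)

lemma q42D [simp]: "R4 (R2 (E4 x)) = E2 (E4 x)"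
  using braid[of n2 n4 x] by (simp add: adjE6_def doubleton_eq_iff)

lemma q4B4 [simp]: "R4 (E2 (R4 x)) = R2 (E4 (R2 x))"
  using braid[of n2 n4 x] by (simp add: adjE6_def doubleton_eq_iff)

lemma qEB [simp]: "E5 (E2 x) = E2 (E5 x)"
  using comm[of n2 n5 x] by (simp add: adjE6_def doubleton_eq_iff)

lemma qB5 [simp]: "E2 (R5 x) = R5 (E2 x)"
  using comm[of n2 n5 x] by (simp add: adjE6_def doubleton_eq_iff)

lemma qFB [simp]: "E6 (E2 x) = E2 (E6 x)"
  using comm[of n2 n6 x] by (simp add: adjE6_def doubleton_eq_iff)

lemma qB6 [simp]: "E2 (R6 x) = R6 (E2 x)"
  using comm[of n2 n6 x] by (simp add: adjE6_def doubleton_eq_iff)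

lemma q13A [simp]: "R1 (R3 (E1 x)) = E3 (E1 x)"
  using braid[of n3 n1 x] by (simp add: adjE6_def doubleton_eq_iff)

lemma qC2 [simp]: "E3 (R2 x) = R2 (E3 x)"
  using comm[of n3 n2 x] by (simp add: adjE6_def doubleton_eq_iff)

lemma q43D [simp]: "R4 (R3 (E4 x)) = E3 (E4 x)"
  using braid[of n3 n4 x] by (simp add: adjE6_def doubleton_eq_iff)

lemma q4C4 [simp]: "R4 (E3 (R4 x)) = R3 (E4 (R3 x))"
  using braid[of n3 n4 x] by (simp add: adjE6_def doubleton_eq_iff)

lemma qEC [simp]: "E5 (E3 x) = E3 (E5 x)"
  using comm[of n3 n5 x] by (simp add: adjE6_def doubleton_eq_iff)

lemma qC5 [simp]: "E3 (R5 x) = R5 (E3 x)"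
  using comm[of n3 n5 x] by (simp add: adjE6_def doubleton_eq_iff)

lemma qFC [simp]: "E6 (E3 x) = E3 (E6 x)"
  using comm[of n3 n6 x] by (simp add: adjE6_def doubleton_eq_iff)

lemma qC6 [simp]: "E3 (R6 x) = R6 (E3 x)"
  using comm[of n3 n6 x] by (simp add: adjE6_def doubleton_eq_iff)

lemma qD1 [simp]: "E4 (R1 x) = R1 (E4 x)"
  using comm[of n4 n1 x] by (simp add: adjE6_def doubleton_eq_iff)

lemma q24B [simp]: "R2 (R4 (E2 x)) = E4 (E2 x)"
  using braid[of n4 n2 x] by (simp add: adjE6_def doubleton_eq_iff)

lemma q34C [simp]: "R3 (R4 (E3 x)) = E4 (E3 x)"
  using braid[of n4 n3 x] by (simp add: adjE6_def doubleton_eq_iff)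

lemma q54E [simp]: "R5 (R4 (E5 x)) = E4 (E5 x)"
  using braid[of n4 n5 x] by (simp add: adjE6_def doubleton_eq_iff)

lemma q5D5 [simp]: "R5 (E4 (R5 x)) = R4 (E5 (R4 x))"
  using braid[of n4 n5 x] by (simp add: adjE6_def doubleton_eq_iff)

lemma qFD [simp]: "E6 (E4 x) = E4 (E6 x)"
  using comm[of n4 n6 x] by (simp add: adjE6_def doubleton_eq_iff)

lemma qD6 [simp]: "E4 (R6 x) = R6 (E4 x)"
  using comm[of n4 n6 x] by (simp add: adjE6_def doubleton_eq_iff)

lemma qE1 [simp]: "E5 (R1 x) = R1 (E5 x)"
  using comm[of n5 n1 x] by (simp add: adjE6_def doubleton_eq_iff)

lemma qE2 [simp]: "E5 (R2 x) = R2 (E5 x)"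
  using comm[of n5 n2 x] by (simp add: adjE6_def doubleton_eq_iff)

lemma qE3 [simp]: "E5 (R3 x) = R3 (E5 x)"
  using comm[of n5 n3 x] by (simp add: adjE6_def doubleton_eq_iff)

lemma q45D [simp]: "R4 (R5 (E4 x)) = E5 (E4 x)"
  using braid[of n5 n4 x] by (simp add: adjE6_def doubleton_eq_iff)

lemma q65F [simp]: "R6 (R5 (E6 x)) = E5 (E6 x)"
  using braid[of n5 n6 x] by (simp add: adjE6_def doubleton_eq_iff)

lemma q6E6 [simp]: "R6 (E5 (R6 x)) = R5 (E6 (R5 x))"
  using braid[of n5 n6 x] by (simp add: adjE6_def doubleton_eq_iff)

lemma qF1 [simp]: "E6 (R1 x) = R1 (E6 x)"
  using comm[of n6 n1 x] by (simp add: adjE6_def doubleton_eq_iff)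

lemma qF2 [simp]: "E6 (R2 x) = R2 (E6 x)"
  using comm[of n6 n2 x] by (simp add: adjE6_def doubleton_eq_iff)

lemma qF3 [simp]: "E6 (R3 x) = R3 (E6 x)"
  using comm[of n6 n3 x] by (simp add: adjE6_def doubleton_eq_iff)

lemma qF4 [simp]: "E6 (R4 x) = R4 (E6 x)"
  using comm[of n6 n4 x] by (simp add: adjE6_def doubleton_eq_iff)

lemma q56E [simp]: "R5 (R6 (E5 x)) = E6 (E5 x)"
  using braid[of n6 n5 x] by (simp add: adjE6_def doubleton_eq_iff)

lemma q6AF [simp]: "R6 (E1 (E6 x)) = E1 (E6 x)"
  using RE[of n6 "E1 x"] by simp

lemma q5CE [simp]: "R5 (E3 (E5 x)) = E3 (E5 x)"
  using RE[of n5 "E3 x"] by simp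

lemma qC15 [simp]: "E3 (R1 (R5 x)) = R5 (E3 (R1 x))"
  using qC5[of "R1 x"] by simp

lemma qC16 [simp]: "E3 (R1 (R6 x)) = R6 (E3 (R1 x))"
  using qC6[of "R1 x"] by simp

lemma qAC1 [simp]: "E1 (E3 (R1 x)) = E1 (R3 x)"
  using RR[of n3 "E1 (R3 x)"] by simp

lemma q35A3 [simp]: "R3 (R5 (E1 (R3 x))) = R1 (R5 (E3 (R1 x)))"
  using q53[of "E1 (R3 x)", symmetric] by simp

lemma qBD2 [simp]: "E2 (E4 (R2 x)) = E2 (R4 x)"
  using RR[of n4 "E2 (R4 x)"] by simp

lemma qCA3 [simp]: "E3 (E1 (R3 x)) = E3 (R1 x)"
  using q13A[of "R3 x", symmetric] by simp

lemma qCD3 [simp]: "E3 (E4 (R3 x)) = E3 (R4 x)"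
  using RR[of n4 "E3 (R4 x)"] by simp

lemma qDB4 [simp]: "E4 (E2 (R4 x)) = E4 (R2 x)"
  using q24B[of "R4 x", symmetric] by simp

lemma q3DC [simp]: "R3 (E4 (E3 x)) = R4 (E3 x)"
  using RR[of n3 "R4 (E3 x)"] by simp

lemma qDC4 [simp]: "E4 (E3 (R4 x)) = E4 (R3 x)"
  using q34C[of "R4 x", symmetric] by simp

lemma q345C [simp]: "R3 (R4 (R5 (E3 x))) = E4 (R5 (E3 x))"
  using q34C[of "R5 x"] by simp

lemma q5DE [simp]: "R5 (E4 (E5 x)) = R4 (E5 x)"
  using RR[of n5 "R4 (E5 x)"] by simp

lemma qEDE [simp]: "E5 (E4 (E5 x)) = E5 (R4 (E5 x))"
  using ER[of n5 "R4 (E5 x)"] by simp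

lemma q54CE [simp]: "R5 (R4 (E3 (E5 x))) = E4 (E3 (E5 x))"
  using q54E[of "E3 x"] by simp

lemma qDE4 [simp]: "E4 (E5 (R4 x)) = E4 (R5 x)"
  using RR[of n5 "E4 (R5 x)"] by simp

lemma q5D35 [simp]: "R5 (E4 (R3 (R5 x))) = R4 (E5 (R4 (R3 x)))"
  using q5D5[of "R3 x"] by simp

lemma qED5 [simp]: "E5 (E4 (R5 x)) = E5 (R4 x)"
  using q45D[of "R5 x", symmetric] by simp

lemma q65AF [simp]: "R6 (R5 (E1 (E6 x))) = E1 (E5 (E6 x))"
  using q65F[of "E1 x"] by simp

lemma qEF5 [simp]: "E5 (E6 (R5 x)) = E5 (R6 x)"
  using RR[of n6 "E5 (R6 x)"] by simp

lemma q56CE [simp]: "R5 (R6 (E3 (E5 x))) = E3 (E6 (E5 x))"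
  using q56E[of "E3 x"] by simp

lemma qFE6 [simp]: "E6 (E5 (R6 x)) = E6 (R5 x)"
  using q56E[of "R6 x", symmetric] by simp

lemma qA31 [simp]: "E1 (R3 (R1 x)) = E1 (E3 x)"
  using qAC1[of "R1 x", symmetric] by simp

lemma qB42 [simp]: "E2 (R4 (R2 x)) = E2 (E4 x)"
  using qBD2[of "R2 x", symmetric] by simp

lemma qC13 [simp]: "E3 (R1 (R3 x)) = E3 (E1 x)"
  using qCA3[of "R3 x", symmetric] by simp

lemma qC43 [simp]: "E3 (R4 (R3 x)) = E3 (E4 x)"
  using qCD3[of "R3 x", symmetric] by simp

lemma qCED3 [simp]: "E3 (E5 (E4 (R3 x))) = E3 (E5 (R4 x))"
  using qEC[of "E4 (R3 x)", symmetric] by simp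

lemma qD24 [simp]: "E4 (R2 (R4 x)) = E4 (E2 x)"
  using qDB4[of "R4 x", symmetric] by simp

lemma qD34 [simp]: "E4 (R3 (R4 x)) = E4 (E3 x)"
  using qDC4[of "R4 x", symmetric] by simp

lemma qE4E [simp]: "E5 (R4 (E5 x)) = E5 x"
  using q45D[of "E5 x", symmetric] by simp

lemma qEDCE [simp]: "E5 (E4 (E3 (E5 x))) = E5 (R4 (E3 (E5 x)))"
  using qEDE[of "E3 x"] by simp

lemma qD54 [simp]: "E4 (R5 (R4 x)) = E4 (E5 x)"
  using qDE4[of "R4 x", symmetric] by simp

lemma qE45 [simp]: "E5 (R4 (R5 x)) = E5 (E4 x)"
  using qED5[of "R5 x", symmetric] by simp

lemma qED35 [simp]: "E5 (E4 (R3 (R5 x))) = E5 (R4 (R3 x))"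
  using qED5[of "R3 x"] by simp

lemma qE65 [simp]: "E5 (R6 (R5 x)) = E5 (E6 x)"
  using qEF5[of "R5 x", symmetric] by simp

lemma qF56 [simp]: "E6 (R5 (R6 x)) = E6 (E5 x)"
  using qFE6[of "R6 x", symmetric] by simp

lemma qCE43 [simp]: "E3 (E5 (R4 (R3 x))) = E3 (E5 (E4 x))"
  using qEC[of "R4 (R3 x)", symmetric] by simp

lemma qE4CE [simp]: "E5 (R4 (E3 (E5 x))) = E3 (E5 x)"
  using qE4E[of "E3 x"] by simp

lemma qE435 [simp]: "E5 (R4 (R3 (R5 x))) = E5 (E4 (R3 x))"
  using qE45[of "R3 x"] by simp

lemma q6C1E6 [simp]: "R6 (E3 (R1 (E5 (R6 x)))) = R5 (E3 (R1 (E6 (R5 x))))"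
  using qC16[of "E5 (R6 x)", symmetric] by simp

text \<open>The equations of \<open>phi_word\<close> are kept out of the simpset, so that
  \<open>act f (phi_word g)\<close> stays recognisable to the rules of type F4; these eight
  equations unfold it on demand.\<close>

lemma F_gens:
  "act f (phi_word (Fr f1)) x = R1 (R6 x)" "act f (phi_word (Fr f2)) x = R3 (R5 x)"
  "act f (phi_word (Fr f3)) x = R4 x" "act f (phi_word (Fr f4)) x = R2 x"
  "act f (phi_word (Fe f1)) x = E1 (E6 x)" "act f (phi_word (Fe f2)) x = E3 (E5 x)"
  "act f (phi_word (Fe f3)) x = E4 x" "act f (phi_word (Fe f4)) x = E2 x"
  by (simp_all add: phi_word.simps)

lemma act_dd [simp]: "act f w (dd x) = dd (act f w x)"
  by (induction w) simp_all

lemma E_R_R: "adjE6 i j \<Longrightarrow> f (EE j) (f (ER i) (f (ER j) x)) = f (EE j) (f (EE i) x)"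
  by (cases i; cases j) (simp_all add: adjE6_def doubleton_eq_iff)

text \<open>The images of the generators satisfy the relations of type F4 by rewriting in type E6.
  Besides the well-definedness of \<phi> this makes all rules for \<open>t\<close> available
  here.\<close>

sublocale F: brauer_F4 "\<lambda>g. act f (phi_word g)" dd di
proof (unfold_locales, goal_cases)
  case (4 i x) show ?case by (cases i) (simp_all add: F_gens)
next
  case (5 i x) show ?case by (cases i) (simp_all add: F_gens)
next
  case (6 i x) show ?case by (cases i) (simp_all add: F_gens)
next
  case (7 i x) then show ?case by (auto simp: F_gens)
next
  case (8 i x) then show ?case by (auto simp: F_gens)
next
  case (9 i j x) then show ?case by (auto simp: F_gens)
next
  case (10 i j x) then show ?case by (auto simp: F_gens)
qed (simp_all add: F_gens)

section \<open>The idempotent of the highest root of E6\<close>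

abbreviation "T \<equiv> F.t"

lemma T_eq: "T x = R2 (R4 (R3 (R5 (R1 (R6 (R4 (R3 (R5 (R4 (E2 (R4 (R5 (R3 (R4 (R6 (R1 (R5 (R3 (R4 (R2 x))))))))))))))))))))"
  unfolding F.t_def F_gens by simp

text \<open>The 21 letters spell the reflection in the highest root, obtained by replacing
  \<open>E2\<close> by \<open>R2\<close> in \<open>T_eq\<close>; it is absorbed because
  \<open>R2 E2 = E2\<close>.\<close>

lemma T_absorb: "R2 (R4 (R3 (R5 (R1 (R6 (R4 (R3 (R5 (R4 (R2 (R4 (R5 (R3 (R4 (R6 (R1 (R5 (R3 (R4 (R2 (T x))))))))))))))))))))) = T x"
  unfolding T_eq by simp

text \<open>The conjugator exchanges \<open>R1\<close> with \<open>R5\<close>, which commutes with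
  \<open>E2\<close>. For \<open>R3\<close>, \<open>R5\<close> and \<open>R6\<close> the
  corresponding letters are \<open>R6\<close>, \<open>R1\<close> and \<open>R3\<close>.\<close>

lemma qT1 [simp]: "T (R1 x) = R1 (T x)"
proof -
  have "R4 (R5 (R3 (R4 (R6 (R1 (R5 (R3 (R4 (R2 (R1 y)))))))))) = R5 (R4 (R5 (R3 (R4 (R6 (R1 (R5 (R3 (R4 (R2 y))))))))))" "R2 (R4 (R3 (R5 (R1 (R6 (R4 (R3 (R5 (R4 (R5 y)))))))))) = R1 (R2 (R4 (R3 (R5 (R1 (R6 (R4 (R3 (R5 (R4 y))))))))))" for y
    by simp_all
  then show ?thesis
    by (simp only: T_eq qB5)
qed

lemma qT3 [simp]: "T (R3 x) = R3 (T x)"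
proof -
  have "R4 (R5 (R3 (R4 (R6 (R1 (R5 (R3 (R4 (R2 (R3 y)))))))))) = R6 (R4 (R5 (R3 (R4 (R6 (R1 (R5 (R3 (R4 (R2 y))))))))))" "R2 (R4 (R3 (R5 (R1 (R6 (R4 (R3 (R5 (R4 (R6 y)))))))))) = R3 (R2 (R4 (R3 (R5 (R1 (R6 (R4 (R3 (R5 (R4 y))))))))))" for y
    by simp_all
  then show ?thesis
    by (simp only: T_eq qB6)
qed

lemma qT4 [simp]: "T (R4 x) = R4 (T x)"
  using F.wt3[of x] by (simp only: F_gens)

lemma qT5 [simp]: "T (R5 x) = R5 (T x)"
proof -
  have "R4 (R5 (R3 (R4 (R6 (R1 (R5 (R3 (R4 (R2 (R5 y)))))))))) = R1 (R4 (R5 (R3 (R4 (R6 (R1 (R5 (R3 (R4 (R2 y))))))))))" "R2 (R4 (R3 (R5 (R1 (R6 (R4 (R3 (R5 (R4 (R1 y)))))))))) = R5 (R2 (R4 (R3 (R5 (R1 (R6 (R4 (R3 (R5 (R4 y))))))))))" for y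
    by simp_all
  then show ?thesis
    by (simp only: T_eq qB1)
qed

lemma qT6 [simp]: "T (R6 x) = R6 (T x)"
proof -
  have "R4 (R5 (R3 (R4 (R6 (R1 (R5 (R3 (R4 (R2 (R6 y)))))))))) = R3 (R4 (R5 (R3 (R4 (R6 (R1 (R5 (R3 (R4 (R2 y))))))))))" "R2 (R4 (R3 (R5 (R1 (R6 (R4 (R3 (R5 (R4 (R3 y)))))))))) = R6 (R2 (R4 (R3 (R5 (R1 (R6 (R4 (R3 (R5 (R4 y))))))))))" for y
    by simp_all
  then show ?thesis
    by (simp only: T_eq qB3)
qed

lemma qT2T [simp]: "T (R2 (T x)) = T x"
  using F.wt4t[of x] by (simp only: F_gens)

text \<open>In the Weyl group the two reflection words differ by the reflection in the highest root
  on the right, which \<open>T\<close> absorbs. The five rules that follow have the same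
  origin.\<close>

lemma q65423143542T [simp]: "R6 (R5 (R4 (R2 (R3 (R1 (R4 (R3 (R5 (R4 (R2 (T x))))))))))) = R5 (R4 (R2 (R3 (R1 (R4 (R3 (R5 (R4 (R2 (T x))))))))))"
proof -
  have "R6 (R5 (R4 (R2 (R3 (R1 (R4 (R3 (R5 (R4 (R2 y)))))))))) = R5 (R4 (R2 (R3 (R1 (R4 (R3 (R5 (R4 (R2 (R2 (R4 (R3 (R5 (R1 (R6 (R4 (R3 (R5 (R4 (R2 (R4 (R5 (R3 (R4 (R6 (R1 (R5 (R3 (R4 (R2 y))))))))))))))))))))))))))))))" for y
    by simp
  then show ?thesis
    by (simp only: T_absorb)
qed

lemma q54231436542T [simp]: "R5 (R4 (R2 (R3 (R1 (R4 (R3 (R6 (R5 (R4 (R2 (T x))))))))))) = R4 (R2 (R3 (R1 (R4 (R3 (R6 (R5 (R4 (R2 (T x))))))))))"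
proof -
  have "R5 (R4 (R2 (R3 (R1 (R4 (R3 (R6 (R5 (R4 (R2 y)))))))))) = R4 (R2 (R3 (R1 (R4 (R3 (R6 (R5 (R4 (R2 (R2 (R4 (R3 (R5 (R1 (R6 (R4 (R3 (R5 (R4 (R2 (R4 (R5 (R3 (R4 (R6 (R1 (R5 (R3 (R4 (R2 y))))))))))))))))))))))))))))))" for y
    by simp
  then show ?thesis
    by (simp only: T_absorb)
qed

lemma q42315436542T [simp]: "R4 (R2 (R3 (R1 (R5 (R4 (R3 (R6 (R5 (R4 (R2 (T x))))))))))) = R2 (R3 (R1 (R5 (R4 (R3 (R6 (R5 (R4 (R2 (T x))))))))))"
proof -
  have "R4 (R2 (R3 (R1 (R5 (R4 (R3 (R6 (R5 (R4 (R2 y)))))))))) = R2 (R3 (R1 (R5 (R4 (R3 (R6 (R5 (R4 (R2 (R2 (R4 (R3 (R5 (R1 (R6 (R4 (R3 (R5 (R4 (R2 (R4 (R5 (R3 (R4 (R6 (R1 (R5 (R3 (R4 (R2 y))))))))))))))))))))))))))))))" for y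
    by simp
  then show ?thesis
    by (simp only: T_absorb)
qed

lemma q31425436542T [simp]: "R3 (R1 (R4 (R2 (R5 (R4 (R3 (R6 (R5 (R4 (R2 (T x))))))))))) = R1 (R4 (R2 (R5 (R4 (R3 (R6 (R5 (R4 (R2 (T x))))))))))"
proof -
  have "R3 (R1 (R4 (R2 (R5 (R4 (R3 (R6 (R5 (R4 (R2 y)))))))))) = R1 (R4 (R2 (R5 (R4 (R3 (R6 (R5 (R4 (R2 (R2 (R4 (R3 (R5 (R1 (R6 (R4 (R3 (R5 (R4 (R2 (R4 (R5 (R3 (R4 (R6 (R1 (R5 (R3 (R4 (R2 y))))))))))))))))))))))))))))))" for y
    by simp
  then show ?thesis
    by (simp only: T_absorb)
qed

lemma q24315436542T [simp]: "R2 (R4 (R3 (R1 (R5 (R4 (R3 (R6 (R5 (R4 (R2 (T x))))))))))) = R4 (R3 (R1 (R5 (R4 (R3 (R6 (R5 (R4 (R2 (T x))))))))))"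
proof -
  have "R2 (R4 (R3 (R1 (R5 (R4 (R3 (R6 (R5 (R4 (R2 y)))))))))) = R4 (R3 (R1 (R5 (R4 (R3 (R6 (R5 (R4 (R2 (R2 (R4 (R3 (R5 (R1 (R6 (R4 (R3 (R5 (R4 (R2 (R4 (R5 (R3 (R4 (R6 (R1 (R5 (R3 (R4 (R2 y))))))))))))))))))))))))))))))" for y
    by simp
  then show ?thesis
    by (simp only: T_absorb)
qed

lemma q13425436542T [simp]: "R1 (R3 (R4 (R2 (R5 (R4 (R3 (R6 (R5 (R4 (R2 (T x))))))))))) = R3 (R4 (R2 (R5 (R4 (R3 (R6 (R5 (R4 (R2 (T x))))))))))"
proof -
  have "R1 (R3 (R4 (R2 (R5 (R4 (R3 (R6 (R5 (R4 (R2 y)))))))))) = R3 (R4 (R2 (R5 (R4 (R3 (R6 (R5 (R4 (R2 (R2 (R4 (R3 (R5 (R1 (R6 (R4 (R3 (R5 (R4 (R2 (R4 (R5 (R3 (R4 (R6 (R1 (R5 (R3 (R4 (R2 y))))))))))))))))))))))))))))))" for y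
    by simp
  then show ?thesis
    by (simp only: T_absorb)
qed

lemma q35T243542T243542 [simp]: "R3 (R5 (T (R2 (R4 (R3 (R5 (R4 (R2 (T (R2 (R4 (R3 (R5 (R4 (R2 x))))))))))))))) = T (R2 (R4 (R3 (R5 (R4 (R2 (T (R2 (R4 (R3 (R5 (R4 (R2 x)))))))))))))"
proof -
  have "F.r2 (F.t (F.r4 (F.r3 (F.r2 (F.r3 (F.r4 (F.t (F.r4 (F.r3 (F.r2 (F.r3 (F.r4 x)))))))))))) = F.t (F.r4 (F.r3 (F.r2 (F.r3 (F.r4 (F.t (F.r4 (F.r3 (F.r2 (F.r3 (F.r4 x)))))))))))"
    by (metis F.rr F.w2t432134t F.w31 F.w41 F.wt1)
  then show ?thesis
    by (simp only: F_gens)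
qed

lemma qT243542T243542 [simp]: "T (R2 (R4 (R3 (R5 (R4 (R2 (T (R2 (R4 (R3 (R5 (R4 (R2 x))))))))))))) = T (R2 (R4 (R3 (R5 (R4 (R2 (T x)))))))"
proof -
  have "F.t (F.r4 (F.r3 (F.r2 (F.r3 (F.r4 (F.t (F.r4 (F.r3 (F.r2 (F.r3 (F.r4 x))))))))))) = F.t (F.r4 (F.r3 (F.r2 (F.r3 (F.r4 (F.t x))))))"
    by simp
  then show ?thesis
    by (simp only: F_gens)
qed

lemma q243542T243542T [simp]: "R2 (R4 (R3 (R5 (R4 (R2 (T (R2 (R4 (R3 (R5 (R4 (R2 (T x))))))))))))) = T (R2 (R4 (R3 (R5 (R4 (R2 (T x)))))))"
proof -
  have "F.r4 (F.r3 (F.r2 (F.r3 (F.r4 (F.t (F.r4 (F.r3 (F.r2 (F.r3 (F.r4 (F.t x))))))))))) = F.t (F.r4 (F.r3 (F.r2 (F.r3 (F.r4 (F.t x))))))"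
    by simp
  then show ?thesis
    by (simp only: F_gens)
qed

lemma q35T243542T [simp]: "R3 (R5 (T (R2 (R4 (R3 (R5 (R4 (R2 (T x))))))))) = T (R2 (R4 (R3 (R5 (R4 (R2 (T x)))))))"
  using q35T243542T243542 by (simp del: q35T243542T243542)

lemma qT23 [simp]: "T (R2 (R3 x)) = R3 (T (R2 x))"
  using qT3[of "R2 x"] by simp

lemma qT25 [simp]: "T (R2 (R5 x)) = R5 (T (R2 x))"
  using qT5[of "R2 x"] by simp

section \<open>Critical pairs involving \<open>T\<close>\<close>

lemma qT26 [simp]: "T (R2 (R6 x)) = R6 (T (R2 x))"
  using qT6[of "R2 x"] by simp

lemma qT242 [simp]: "T (R2 (R4 (R2 x))) = R4 (T (R2 (R4 x)))"
  using qT4[of "R2 (R4 x)"] by simp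

lemma qT24T [simp]: "T (R2 (R4 (T x))) = R4 (T x)"
  using qT2T[of "R4 x"] by simp

lemma qT246 [simp]: "T (R2 (R4 (R6 x))) = R6 (T (R2 (R4 x)))"
  using qT26[of "R4 x"] by simp

lemma qT2454 [simp]: "T (R2 (R4 (R5 (R4 x)))) = R5 (T (R2 (R4 (R5 x))))"
  using qT25[of "R4 (R5 x)"] by simp

lemma qT243T [simp]: "T (R2 (R4 (R3 (T x)))) = R4 (R3 (T x))"
  using qT24T[of "R3 x"] by simp

lemma qT245T [simp]: "T (R2 (R4 (R5 (T x)))) = R4 (R5 (T x))"
  using qT24T[of "R5 x"] by simp

lemma qT2436 [simp]: "T (R2 (R4 (R3 (R6 x)))) = R6 (T (R2 (R4 (R3 x))))"
  using qT246[of "R3 x"] by simp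

lemma qT24565 [simp]: "T (R2 (R4 (R5 (R6 (R5 x))))) = R6 (T (R2 (R4 (R5 (R6 x)))))"
  using qT246[of "R5 (R6 x)"] by simp

lemma qT2431T [simp]: "T (R2 (R4 (R3 (R1 (T x))))) = R4 (R3 (R1 (T x)))"
  using qT243T[of "R1 x"] by simp

lemma qT2456T [simp]: "T (R2 (R4 (R5 (R6 (T x))))) = R4 (R5 (R6 (T x)))"
  using qT245T[of "R6 x"] by simp

lemma qT24316 [simp]: "T (R2 (R4 (R3 (R1 (R6 x))))) = R6 (T (R2 (R4 (R3 (R1 x)))))"
  using qT2436[of "R1 x"] by simp

lemma qT243543 [simp]: "T (R2 (R4 (R3 (R5 (R4 (R3 x)))))) = R5 (T (R2 (R4 (R3 (R5 (R4 x))))))"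
  using qT2454[of "R3 (R4 x)"] by simp

lemma qT24315T [simp]: "T (R2 (R4 (R3 (R1 (R5 (T x)))))) = R4 (R3 (R1 (R5 (T x))))"
  using qT2431T[of "R5 x"] by simp

lemma qT2431565 [simp]: "T (R2 (R4 (R3 (R1 (R5 (R6 (R5 x))))))) = R6 (T (R2 (R4 (R3 (R1 (R5 (R6 x)))))))"
  using qT24316[of "R5 (R6 x)"] by simp

lemma qT2435423 [simp]: "T (R2 (R4 (R3 (R5 (R4 (R2 (R3 x))))))) = R5 (T (R2 (R4 (R3 (R5 (R4 (R2 x)))))))"
  using qT243543[of "R2 x"] by simp

lemma qT243154T [simp]: "T (R2 (R4 (R3 (R1 (R5 (R4 (T x))))))) = R4 (R3 (R1 (R5 (R4 (T x)))))"
  using qT24315T[of "R4 x"] by simp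

lemma qT24315431 [simp]: "T (R2 (R4 (R3 (R1 (R5 (R4 (R3 (R1 x)))))))) = R5 (T (R2 (R4 (R3 (R1 (R5 (R4 (R3 x))))))))"
  using qT243543[of "R1 (R3 x)"] by simp

lemma qT2431543T [simp]: "T (R2 (R4 (R3 (R1 (R5 (R4 (R3 (T x)))))))) = R4 (R3 (R1 (R5 (R4 (R3 (T x))))))"
  using qT243154T[of "R3 x"] by simp

lemma qT243154231 [simp]: "T (R2 (R4 (R3 (R1 (R5 (R4 (R2 (R3 (R1 x))))))))) = R5 (T (R2 (R4 (R3 (R1 (R5 (R4 (R2 (R3 x)))))))))"
  using qT2435423[of "R1 (R3 x)"] by simp

lemma qT24315436T [simp]: "T (R2 (R4 (R3 (R1 (R5 (R4 (R3 (R6 (T x))))))))) = R4 (R3 (R1 (R5 (R4 (R3 (R6 (T x)))))))"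
  using qT2431543T[of "R6 x"] by simp

lemma q5T243542T [simp]: "R5 (T (R2 (R4 (R3 (R5 (R4 (R2 (T x)))))))) = R3 (T (R2 (R4 (R3 (R5 (R4 (R2 (T x))))))))"
  using RR[of n3 "R5 (T (R2 (R4 (R3 (R5 (R4 (R2 (T x))))))))", symmetric] by simp

lemma q5T2431542T [simp]: "R5 (T (R2 (R4 (R3 (R1 (R5 (R4 (R2 (T x))))))))) = R3 (T (R2 (R4 (R3 (R1 (R5 (R4 (R2 (T x)))))))))"
  using q5T243542T[of "R1 x"] by simp

lemma q54T243542T [simp]: "R5 (R4 (T (R2 (R4 (R3 (R5 (R4 (R2 (T x))))))))) = R3 (R4 (T (R2 (R4 (R3 (R5 (R4 (R2 (T x)))))))))"
  using q5T243542T[of "R4 x"] by simp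

lemma q54T2431542T [simp]: "R5 (R4 (T (R2 (R4 (R3 (R1 (R5 (R4 (R2 (T x)))))))))) = R3 (R4 (T (R2 (R4 (R3 (R1 (R5 (R4 (R2 (T x))))))))))"
  using q5T2431542T[of "R4 x"] by simp

lemma q5T24315426T [simp]: "R5 (T (R2 (R4 (R3 (R1 (R5 (R4 (R2 (R6 (T x)))))))))) = R3 (T (R2 (R4 (R3 (R1 (R5 (R4 (R2 (R6 (T x))))))))))"
  using q5T2431542T[of "R6 x"] by simp

lemma q5423T243542T [simp]: "R5 (R4 (R2 (R3 (T (R2 (R4 (R3 (R5 (R4 (R2 (T x))))))))))) = R4 (R5 (R4 (R2 (T (R2 (R4 (R3 (R5 (R4 (R2 (T x)))))))))))"
  using q5425[of "T (R2 (R4 (R3 (R5 (R4 (R2 (T x)))))))"] by simp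

lemma q54T24315423T [simp]: "R5 (R4 (T (R2 (R4 (R3 (R1 (R5 (R4 (R2 (R3 (T x))))))))))) = R3 (R4 (T (R2 (R4 (R3 (R1 (R5 (R4 (R2 (R3 (T x)))))))))))"
  using q54T2431542T[of "R3 x"] by simp

lemma q54T24315426T [simp]: "R5 (R4 (T (R2 (R4 (R3 (R1 (R5 (R4 (R2 (R6 (T x))))))))))) = R3 (R4 (T (R2 (R4 (R3 (R1 (R5 (R4 (R2 (R6 (T x)))))))))))"
  using q54T2431542T[of "R6 x"] by simp

lemma q54316T243542T [simp]: "R5 (R4 (R3 (R1 (R6 (T (R2 (R4 (R3 (R5 (R4 (R2 (T x)))))))))))) = R4 (R3 (R1 (R6 (T (R2 (R4 (R3 (R5 (R4 (R2 (T x)))))))))))"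
  using qT5[of "R4 (R2 (R3 (R1 (R4 (R3 (R6 (R5 (R4 (R2 (T x))))))))))", symmetric] by simp

lemma q43156T243542T [simp]: "R4 (R3 (R1 (R5 (R6 (T (R2 (R4 (R3 (R5 (R4 (R2 (T x)))))))))))) = R3 (R1 (R5 (R6 (T (R2 (R4 (R3 (R5 (R4 (R2 (T x)))))))))))"
  using qT4[of "R2 (R3 (R1 (R5 (R4 (R3 (R6 (R5 (R4 (R2 (T x))))))))))", symmetric] by simp

lemma q31456T243542T [simp]: "R3 (R1 (R4 (R5 (R6 (T (R2 (R4 (R3 (R5 (R4 (R2 (T x)))))))))))) = R1 (R4 (R5 (R6 (T (R2 (R4 (R3 (R5 (R4 (R2 (T x)))))))))))"
  using qT3[of "R1 (R4 (R2 (R5 (R4 (R3 (R6 (R5 (R4 (R2 (T x))))))))))", symmetric] by simp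

lemma q54234T243542T [simp]: "R5 (R4 (R2 (R3 (R4 (T (R2 (R4 (R3 (R5 (R4 (R2 (T x)))))))))))) = R4 (R2 (R5 (R4 (R2 (T (R2 (R4 (R3 (R5 (R4 (R2 (T x))))))))))))"
  using q5425[of "R4 (T (R2 (R4 (R3 (R5 (R4 (R2 (T x))))))))"] by simp

lemma q543T24315426T [simp]: "R5 (R4 (R3 (T (R2 (R4 (R3 (R1 (R5 (R4 (R2 (R6 (T x)))))))))))) = R3 (R4 (R3 (T (R2 (R4 (R3 (R1 (R5 (R4 (R2 (R6 (T x))))))))))))"
  using q545[of "T (R2 (R4 (R3 (R1 (R5 (R4 (R2 (R6 (T x)))))))))"] by simp

lemma q54T243154236T [simp]: "R5 (R4 (T (R2 (R4 (R3 (R1 (R5 (R4 (R2 (R3 (R6 (T x)))))))))))) = R3 (R4 (T (R2 (R4 (R3 (R1 (R5 (R4 (R2 (R3 (R6 (T x))))))))))))"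
  using q54T24315423T[of "R6 x"] by simp

lemma q5423T24315426T [simp]: "R5 (R4 (R2 (R3 (T (R2 (R4 (R3 (R1 (R5 (R4 (R2 (R6 (T x))))))))))))) = R4 (R5 (R4 (R2 (T (R2 (R4 (R3 (R1 (R5 (R4 (R2 (R6 (T x)))))))))))))"
  using q5425[of "T (R2 (R4 (R3 (R1 (R5 (R4 (R2 (R6 (T x)))))))))"] by simp

lemma q54T2431542365T [simp]: "R5 (R4 (T (R2 (R4 (R3 (R1 (R5 (R4 (R2 (R3 (R6 (R5 (T x))))))))))))) = R3 (R4 (T (R2 (R4 (R3 (R1 (R5 (R4 (R2 (R3 (R6 (R5 (T x)))))))))))))"
  using q54T243154236T[of "R5 x"] by simp

lemma qT243542T24354 [simp]: "T (R2 (R4 (R3 (R5 (R4 (R2 (T (R2 (R4 (R3 (R5 (R4 x)))))))))))) = T (R2 (R4 (R3 (R5 (R4 (R2 (T (R2 x))))))))"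
  using qT243542T243542[of "R2 x"] by simp

lemma qT243542T2435 [simp]: "T (R2 (R4 (R3 (R5 (R4 (R2 (T (R2 (R4 (R3 (R5 x))))))))))) = T (R2 (R4 (R3 (R5 (R4 (R2 (T (R2 (R4 x)))))))))"
  using qT243542T24354[of "R4 x"] by simp

lemma qT243542T245 [simp]: "T (R2 (R4 (R3 (R5 (R4 (R2 (T (R2 (R4 (R5 x)))))))))) = T (R2 (R4 (R3 (R5 (R4 (R2 (T (R2 (R4 (R3 x))))))))))"
  using qT243542T2435[of "R5 x", symmetric] by simp

lemma qT243542T2431 [simp]: "T (R2 (R4 (R3 (R5 (R4 (R2 (T (R2 (R4 (R3 (R1 x))))))))))) = T (R2 (R4 (R3 (R1 (R5 (R4 (R2 (T (R2 (R4 (R5 x)))))))))))"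
  using qT243542T245[of "R1 x", symmetric] by simp

lemma qT2431542T2435 [simp]: "T (R2 (R4 (R3 (R1 (R5 (R4 (R2 (T (R2 (R4 (R3 (R5 x)))))))))))) = T (R2 (R4 (R3 (R1 (R5 (R4 (R2 (T (R2 (R4 (R3 (R1 x))))))))))))"
  using qT243542T2431[of "R3 x", symmetric] by simp

lemma qT2431542T24315 [simp]: "T (R2 (R4 (R3 (R1 (R5 (R4 (R2 (T (R2 (R4 (R3 (R1 (R5 x))))))))))))) = T (R2 (R4 (R3 (R1 (R5 (R4 (R2 (T (R2 (R4 (R3 x)))))))))))"
  using qT2431542T2435[of "R5 x", symmetric] by simp

lemma q43542T243542T [simp]: "R4 (R3 (R5 (R4 (R2 (T (R2 (R4 (R3 (R5 (R4 (R2 (T x)))))))))))) = R2 (T (R2 (R4 (R3 (R5 (R4 (R2 (T x))))))))"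
  using RR[of n2 "R4 (R3 (R5 (R4 (R2 (T (R2 (R4 (R3 (R5 (R4 (R2 (T x))))))))))))", symmetric] by simp

lemma q3542T243542T [simp]: "R3 (R5 (R4 (R2 (T (R2 (R4 (R3 (R5 (R4 (R2 (T x))))))))))) = R4 (R2 (T (R2 (R4 (R3 (R5 (R4 (R2 (T x)))))))))"
  using RR[of n4 "R3 (R5 (R4 (R2 (T (R2 (R4 (R3 (R5 (R4 (R2 (T x)))))))))))", symmetric] by simp

lemma q542T243542T [simp]: "R5 (R4 (R2 (T (R2 (R4 (R3 (R5 (R4 (R2 (T x)))))))))) = R3 (R4 (R2 (T (R2 (R4 (R3 (R5 (R4 (R2 (T x))))))))))"
  using RR[of n3 "R5 (R4 (R2 (T (R2 (R4 (R3 (R5 (R4 (R2 (T x))))))))))", symmetric] by simp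

lemma q542T2431542T [simp]: "R5 (R4 (R2 (T (R2 (R4 (R3 (R1 (R5 (R4 (R2 (T x))))))))))) = R3 (R4 (R2 (T (R2 (R4 (R3 (R1 (R5 (R4 (R2 (T x)))))))))))"
  using q542T243542T[of "R1 x"] by simp

lemma q542T24315426T [simp]: "R5 (R4 (R2 (T (R2 (R4 (R3 (R1 (R5 (R4 (R2 (R6 (T x)))))))))))) = R3 (R4 (R2 (T (R2 (R4 (R3 (R1 (R5 (R4 (R2 (R6 (T x))))))))))))"
  using q542T2431542T[of "R6 x"] by simp

lemma q2423156T243542T [simp]: "R2 (R4 (R2 (R3 (R1 (R5 (R6 (T (R2 (R4 (R3 (R5 (R4 (R2 (T x)))))))))))))) = R4 (R2 (R3 (R1 (R5 (R6 (T (R2 (R4 (R3 (R5 (R4 (R2 (T x)))))))))))))"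
  using q424[of "R3 (R1 (R5 (R6 (T (R2 (R4 (R3 (R5 (R4 (R2 (T x)))))))))))", symmetric] by simp

lemma q54T24315423654T [simp]: "R5 (R4 (T (R2 (R4 (R3 (R1 (R5 (R4 (R2 (R3 (R6 (R5 (R4 (T x)))))))))))))) = R3 (R4 (T (R2 (R4 (R3 (R1 (R5 (R4 (R2 (R3 (R6 (R5 (R4 (T x))))))))))))))"
  using q54T2431542365T[of "R4 x"] by simp

lemma q454231T24315426T [simp]: "R4 (R5 (R4 (R2 (R3 (R1 (T (R2 (R4 (R3 (R1 (R5 (R4 (R2 (R6 (T x))))))))))))))) = R1 (R5 (R4 (R2 (R3 (R1 (T (R2 (R4 (R3 (R1 (R5 (R4 (R2 (R6 (T x)))))))))))))))"
  using q542315[of "T (R2 (R4 (R3 (R1 (R5 (R4 (R2 (R6 (T x)))))))))", symmetric] by simp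

lemma qT24315426T243156 [simp]: "T (R2 (R4 (R3 (R1 (R5 (R4 (R2 (R6 (T (R2 (R4 (R3 (R1 (R5 (R6 x))))))))))))))) = T (R2 (R4 (R3 (R1 (R5 (R4 (R2 (R6 (T (R2 (R4 (R3 (R5 x)))))))))))))"
  using qT2431542T24315[of "R6 (R5 x)"] by simp

lemma q23423156T243542T [simp]: "R2 (R3 (R4 (R2 (R3 (R1 (R5 (R6 (T (R2 (R4 (R3 (R5 (R4 (R2 (T x))))))))))))))) = R3 (R4 (R2 (R3 (R1 (R5 (R6 (T (R2 (R4 (R3 (R5 (R4 (R2 (T x))))))))))))))"
  using q32[of "R4 (R2 (R3 (R1 (R5 (R6 (T (R2 (R4 (R3 (R5 (R4 (R2 (T x)))))))))))))", symmetric] by simp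

lemma q4354231T24315426T [simp]: "R4 (R3 (R5 (R4 (R2 (R3 (R1 (T (R2 (R4 (R3 (R1 (R5 (R4 (R2 (R6 (T x)))))))))))))))) = R1 (R3 (R5 (R4 (R2 (R3 (R1 (T (R2 (R4 (R3 (R1 (R5 (R4 (R2 (R6 (T x))))))))))))))))"
  using q54315[of "R4 (R2 (T (R2 (R4 (R3 (R1 (R5 (R4 (R2 (R6 (T x)))))))))))", symmetric] by simp

lemma qT24315426T2431546 [simp]: "T (R2 (R4 (R3 (R1 (R5 (R4 (R2 (R6 (T (R2 (R4 (R3 (R1 (R5 (R4 (R6 x)))))))))))))))) = T (R2 (R4 (R3 (R1 (R5 (R4 (R2 (R6 (T (R2 (R4 (R3 (R5 (R4 x))))))))))))))"
  using qT24315426T243156[of "R4 x"] by simp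

lemma q234542316T243542T [simp]: "R2 (R3 (R4 (R5 (R4 (R2 (R3 (R1 (R6 (T (R2 (R4 (R3 (R5 (R4 (R2 (T x)))))))))))))))) = R3 (R4 (R5 (R4 (R2 (R3 (R1 (R6 (T (R2 (R4 (R3 (R5 (R4 (R2 (T x)))))))))))))))"
  using q52[of "R3 (R4 (R2 (R3 (R1 (R5 (R6 (T (R2 (R4 (R3 (R5 (R4 (R2 (T x))))))))))))))", symmetric] by simp

lemma q43154231T24315426T [simp]: "R4 (R3 (R1 (R5 (R4 (R2 (R3 (R1 (T (R2 (R4 (R3 (R1 (R5 (R4 (R2 (R6 (T x))))))))))))))))) = R1 (R3 (R1 (R5 (R4 (R2 (R3 (R1 (T (R2 (R4 (R3 (R1 (R5 (R4 (R2 (R6 (T x)))))))))))))))))"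
  using q54315[of "R4 (R2 (R3 (T (R2 (R4 (R3 (R1 (R5 (R4 (R2 (R6 (T x))))))))))))", symmetric] by simp

lemma q6T24315426T243542T [simp]: "R6 (T (R2 (R4 (R3 (R1 (R5 (R4 (R2 (R6 (T (R2 (R4 (R3 (R5 (R4 (R2 (T x))))))))))))))))) = R1 (T (R2 (R4 (R3 (R1 (R5 (R4 (R2 (R6 (T (R2 (R4 (R3 (R5 (R4 (R2 (T x)))))))))))))))))"
  using qT2431565[of "R4 (R2 (T (R2 (R4 (R3 (R5 (R4 (R2 (T x)))))))))", symmetric] by simp

lemma qT24315426T24315426 [simp]: "T (R2 (R4 (R3 (R1 (R5 (R4 (R2 (R6 (T (R2 (R4 (R3 (R1 (R5 (R4 (R2 (R6 x))))))))))))))))) = T (R2 (R4 (R3 (R1 (R5 (R4 (R2 (R6 (T (R2 (R4 (R3 (R5 (R4 (R2 x)))))))))))))))"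
  using qT24315426T2431546[of "R2 x"] by simp

lemma q343T24315426T243542T [simp]: "R3 (R4 (R3 (T (R2 (R4 (R3 (R1 (R5 (R4 (R2 (R6 (T (R2 (R4 (R3 (R5 (R4 (R2 (T x))))))))))))))))))) = R4 (R3 (T (R2 (R4 (R3 (R1 (R5 (R4 (R2 (R6 (T (R2 (R4 (R3 (R5 (R4 (R2 (T x))))))))))))))))))"
  using qT2435423[of "R1 (R4 (R5 (R6 (T (R2 (R4 (R3 (R5 (R4 (R2 (T x)))))))))))", symmetric] by simp

lemma qT24315423654T [simp]: "T (R2 (R4 (R3 (R1 (R5 (R4 (R2 (R3 (R6 (R5 (R4 (T x)))))))))))) = T (R2 (R4 (R3 (R1 (R5 (R4 (R2 (R3 (R6 (R5 (T x)))))))))))"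
  using qT243542T2431[of "R5 (R4 (R3 (R6 (R5 (R4 (R2 (T x)))))))"] by simp

lemma qT243154236543T [simp]: "T (R2 (R4 (R3 (R1 (R5 (R4 (R2 (R3 (R6 (R5 (R4 (R3 (T x))))))))))))) = T (R2 (R4 (R3 (R1 (R5 (R4 (R2 (R6 (R5 (T x))))))))))"
  using qT24315423654T[of "R3 x"] by simp

lemma qT2431542365431T [simp]: "T (R2 (R4 (R3 (R1 (R5 (R4 (R2 (R3 (R6 (R5 (R4 (R3 (R1 (T x)))))))))))))) = T (R2 (R4 (R3 (R5 (R4 (R2 (R6 (R5 (T x)))))))))"
  using qT243154236543T[of "R1 x"] by simp

lemma qT24315423465431T [simp]: "T (R2 (R4 (R3 (R1 (R5 (R4 (R2 (R3 (R4 (R6 (R5 (R4 (R3 (R1 (T x))))))))))))))) = T (R2 (R4 (R3 (R5 (R4 (R2 (R6 (T x))))))))"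
  using qT2431542365431T[of "R5 x"] by simp

lemma qT243154234565431T [simp]: "T (R2 (R4 (R3 (R1 (R5 (R4 (R2 (R3 (R4 (R5 (R6 (R5 (R4 (R3 (R1 (T x)))))))))))))))) = T (R2 (R4 (R3 (R5 (R4 (R2 (T x)))))))"
  using qT24315423465431T[of "R6 x"] by simp

lemma q2423154231T24315426T [simp]: "R2 (R4 (R2 (R3 (R1 (R5 (R4 (R2 (R3 (R1 (T (R2 (R4 (R3 (R1 (R5 (R4 (R2 (R6 (T x))))))))))))))))))) = R1 (R4 (R2 (R3 (R1 (R5 (R4 (R2 (R3 (R1 (T (R2 (R4 (R3 (R1 (R5 (R4 (R2 (R6 (T x)))))))))))))))))))"
  using q42343[of "R5 (R4 (R2 (R3 (R1 (T (R2 (R4 (R3 (R1 (R5 (R4 (R2 (R6 (T x))))))))))))))", symmetric] by simp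

lemma q4T24315426T243542T [simp]: "R4 (T (R2 (R4 (R3 (R1 (R5 (R4 (R2 (R6 (T (R2 (R4 (R3 (R5 (R4 (R2 (T x))))))))))))))))) = T (R2 (R4 (R3 (R1 (R5 (R4 (R2 (R6 (T (R2 (R4 (R3 (R5 (R4 (R2 (T x))))))))))))))))"
  using qT242[of "R3 (R4 (R5 (R4 (R2 (R3 (R1 (R6 (T (R2 (R4 (R3 (R5 (R4 (R2 (T x)))))))))))))))", symmetric] by simp

end

text \<open>Words in \<open>Br(E\<^sub>6)\<close> are written with the digits \<open>1, \<dots>, 6\<close> for the \<open>R\<^sub>i\<close> and \<open>7\<close> for the image of \<open>t\<close>,
  which belongs to the highest root.  The words \<open>uword\<close> and \<open>vword\<close> give its conjugates belonging to two
  further roots orthogonal to it and to each other.\<close>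

definition node :: "nat \<Rightarrow> E6node" where
  "node n = (if n = 1 then n1 else if n = 2 then n2 else if n = 3 then n3
     else if n = 4 then n4 else if n = 5 then n5 else n6)"

definition phiw :: "F4gen list \<Rightarrow> E6gen list" where
  "phiw w = concat (map phi_word w)"

definition eletter_word :: "nat \<Rightarrow> E6gen list" where
  "eletter_word n = (if n = 7 then phiw tword else [ER (node n)])"

definition ewd :: "nat list \<Rightarrow> E6gen list" where
  "ewd ns = concat (map eletter_word ns)"

definition uword :: "nat list" where "uword = [2,4,5,3,4,2,7,2,4,5,3,4,2]"

definition vword :: "nat list" where "vword = [1,6] @ uword @ [1,6]"

text \<open>Three orthogonal roots are enough: a fourth root orthogonal to them is, modulo 2, the
  sum of the other three and contributes only a factor.\<close>

definition eeps :: "nat \<Rightarrow> nat list" where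
  "eeps d = (if d = 0 then [] else if d = 1 then [7] else if d = 2 then 7 # uword else 7 # uword @ vword)"

text \<open>Representatives of the cosets of the centralizers of the three roots: \<open>B1\<close> in the Weyl group, \<open>B2\<close> and \<open>B3\<close>
  in the centralizers of the first and of the first two roots.\<close>

definition B1 :: "nat list list" where
  "B1 = [[], [2], [4,2], [3,4,2], [5,4,2], [1,3,4,2], [5,3,4,2], [6,5,4,2], [5,1,3,4,2], [4,5,3,4,2],
    [6,5,3,4,2], [4,5,1,3,4,2], [6,5,1,3,4,2], [2,4,5,3,4,2], [6,4,5,3,4,2], [2,4,5,1,3,4,2],
    [3,4,5,1,3,4,2], [6,4,5,1,3,4,2], [6,2,4,5,3,4,2], [5,6,4,5,3,4,2], [3,2,4,5,1,3,4,2],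
    [6,2,4,5,1,3,4,2], [6,3,4,5,1,3,4,2], [5,6,4,5,1,3,4,2], [5,6,2,4,5,3,4,2], [4,3,2,4,5,1,3,4,2],
    [6,3,2,4,5,1,3,4,2], [5,6,2,4,5,1,3,4,2], [5,6,3,4,5,1,3,4,2], [4,5,6,2,4,5,3,4,2],
    [5,4,3,2,4,5,1,3,4,2], [6,4,3,2,4,5,1,3,4,2], [5,6,3,2,4,5,1,3,4,2], [4,5,6,2,4,5,1,3,4,2],
    [4,5,6,3,4,5,1,3,4,2], [3,4,5,6,2,4,5,3,4,2]]"

definition B2 :: "nat list list" where
  "B2 = [[], [1], [6], [3,1], [6,1], [5,6], [4,3,1], [6,3,1], [5,6,1], [4,5,6], [5,4,3,1], [6,4,3,1],
    [5,6,3,1], [4,5,6,1], [3,4,5,6]]"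

definition B3 :: "nat list list" where
  "B3 = [[], [3], [5], [4,3], [5,3], [4,5]]"

text \<open>Left coset representatives of the Weyl group of type \<open>F\<^sub>4\<close>.\<close>

definition C45 :: "nat list list" where
  "C45 = [[], [1], [3], [3,1], [5,1], [4,3], [1,3,1], [4,3,1], [4,5,1], [2,4,3], [4,1,3,1], [2,4,3,1],
    [5,4,3,1], [2,4,5,1], [3,4,5,1], [2,4,1,3,1], [3,4,1,3,1], [5,4,1,3,1], [5,2,4,3,1], [3,2,4,5,1],
    [3,2,4,1,3,1], [5,2,4,1,3,1], [5,3,4,1,3,1], [4,5,2,4,3,1], [4,3,2,4,5,1], [4,3,2,4,1,3,1],
    [5,3,2,4,1,3,1], [4,5,2,4,1,3,1], [3,4,5,2,4,3,1], [5,4,3,2,4,5,1], [5,4,3,2,4,1,3,1],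
    [4,5,3,2,4,1,3,1], [3,4,5,2,4,1,3,1], [1,3,4,5,2,4,3,1], [6,5,4,3,2,4,5,1], [4,5,4,3,2,4,1,3,1],
    [6,5,4,3,2,4,1,3,1], [3,4,5,3,2,4,1,3,1], [1,3,4,5,2,4,1,3,1], [3,4,5,4,3,2,4,1,3,1],
    [6,4,5,4,3,2,4,1,3,1], [1,3,4,5,3,2,4,1,3,1], [1,3,4,5,4,3,2,4,1,3,1], [6,3,4,5,4,3,2,4,1,3,1],
    [6,1,3,4,5,4,3,2,4,1,3,1]]"

definition rdigits :: "nat list \<Rightarrow> nat list" where
  "rdigits t = concat (map (\<lambda>n. if n = 1 then [1,6] else if n = 2 then [3,5] else if n = 3 then [4] else [2]) t)"

text \<open>The conjugation in \<open>T_eq\<close> undone.\<close>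

definition e2digits :: "nat list" where "e2digits = [4,5,3,4,6,1,5,3,4,2,7,2,4,3,5,1,6,4,3,5,4]"

text \<open>The other idempotents are reached from \<open>E2\<close> along the edges of the diagram:
  node 4 first, then 3 and 5, then 1 and 6.\<close>

definition edigits :: "E6gen \<Rightarrow> nat list" where
  "edigits g = (case g of ER n1 \<Rightarrow> [1] | ER n2 \<Rightarrow> [2] | ER n3 \<Rightarrow> [3] | ER n4 \<Rightarrow> [4] | ER n5 \<Rightarrow> [5] | ER n6 \<Rightarrow> [6]
    | EE i \<Rightarrow> (let e4 = [2,4] @ e2digits @ [4,2];
        e3 = [4,3] @ e4 @ [3,4]; e5 = [4,5] @ e4 @ [5,4] in
      case i of n1 \<Rightarrow> [3,1] @ e3 @ [1,3] | n2 \<Rightarrow> e2digits | n3 \<Rightarrow> e3 | n4 \<Rightarrow> e4 | n5 \<Rightarrow> e5 | n6 \<Rightarrow> [5,6] @ e5 @ [6,5]))"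

lemma phiw_append [simp]: "phiw (u @ v) = phiw u @ phiw v"
  by (simp add: phiw_def)

lemma ewd_append [simp]: "ewd (u @ v) = ewd u @ ewd v"
  by (simp add: ewd_def)

section \<open>Factorization of words of type E6\<close>

context brauer_E6 begin

definition eletter :: "nat \<Rightarrow> 'b \<Rightarrow> 'b" where
  "eletter n = (if n = 7 then T else f (ER (node n)))"

lemma eletter_simps [simp]:
  "eletter (Suc 0) = R1" "eletter 1 = R1" "eletter 2 = R2" "eletter 3 = R3" "eletter 4 = R4" "eletter 5 = R5"
  "eletter 6 = R6" "eletter 7 = T"
  by (simp_all add: eletter_def node_def)

primrec eactn :: "nat list \<Rightarrow> 'b \<Rightarrow> 'b" where
  "eactn [] x = x"
| "eactn (n # ns) x = eletter n (eactn ns x)"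

lemma eactn_append [simp]: "eactn (u @ v) x = eactn u (eactn v x)"
  by (induction u) simp_all

lemma act_phiw: "act f (phiw w) x = act (\<lambda>g. act f (phi_word g)) w x"
  by (induction w) (simp_all add: phiw_def)

lemma act_ewd: "act f (ewd ns) x = eactn ns x"
proof -
  have "act f (phiw tword) x = T x" for x
    using F.act_wd[of "[6]" x] by (simp add: act_phiw wd_def letter_word_def)
  then show ?thesis
    by (induction ns) (simp_all add: ewd_def eletter_word_def eletter_def)
qed

lemma E_E_E: assumes "adjE6 i j" shows "f (EE j) (f (EE i) (f (EE j) x)) = f (EE j) x"
proof -
  have "f (EE j) (f (EE i) (f (EE j) x)) = f (EE j) (f (ER i) (f (EE j) (f (ER i) (f (ER i) x))))"
    using braid[OF assms, of x] by (metis ER RR)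
  also have "\<dots> = f (EE j) (f (EE i) (f (ER j) (f (ER i) x)))"
    using braid[OF assms, of "f (ER i) x"] by (metis ER)
  also have "\<dots> = f (EE j) x"
    using E_R_R[OF assms] by (metis RR)
  finally show ?thesis .
qed

lemma eactn_edigits: "eactn (edigits g) x = f g x"
proof (cases g)
  case (ER i)
  then show ?thesis
    by (cases i) (simp_all add: edigits_def)
next
  case (EE i)
  have "eactn e2digits x = E2 x" for x
    unfolding e2digits_def by (simp add: T_eq)
  then show ?thesis
    unfolding EE by (cases i) (simp_all add: edigits_def Let_def E_E_E adjE6_def doubleton_eq_iff)
qed

lemma T_U: "T (eactn uword x) = eactn uword (T x)"
  and T_V: "T (eactn vword x) = eactn vword (T x)"
  and U_V: "eactn vword (eactn uword x) = eactn uword (eactn vword x)"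
  by (simp_all add: uword_def vword_def)

text \<open>The lists \<open>B1\<close>, \<open>B2\<close>, \<open>B3\<close> have 36, 15 and 6
  members, one for each positive root of E6, of the A5 orthogonal to the highest root, and of the A3
  orthogonal to two of the three roots. The letters \<open>g\<close> generate the respective
  stabilizers.\<close>

lemma B1_closed:
  assumes "\<forall>b\<in>set B1. \<forall>g\<in>{[], [1], [3], [4], [5], [6]}. eactn b (eactn g (T x)) \<in> S"
  shows "\<forall>b\<in>set B1. R1 (eactn b (T x)) \<in> S \<and> R2 (eactn b (T x)) \<in> S \<and> R3 (eactn b (T x)) \<in> S \<and> R4 (eactn b (T x)) \<in> S \<and> R5 (eactn b (T x)) \<in> S \<and> R6 (eactn b (T x)) \<in> S"
  using assms by (simp add: B1_def)

lemma B2_closed: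
  assumes "\<forall>b\<in>set B2. \<forall>g\<in>{[], [3], [4], [5]}. eactn b (eactn g (eactn uword x)) \<in> S"
  shows "\<forall>b\<in>set B2. R1 (eactn b (eactn uword x)) \<in> S \<and> R3 (eactn b (eactn uword x)) \<in> S \<and> R4 (eactn b (eactn uword x)) \<in> S \<and> R5 (eactn b (eactn uword x)) \<in> S \<and> R6 (eactn b (eactn uword x)) \<in> S"
  using assms by (simp add: B2_def uword_def)

lemma B3_closed:
  assumes "\<forall>b\<in>set B3. \<forall>g\<in>{[], [4]}. eactn b (eactn g (eactn vword x)) \<in> S"
  shows "\<forall>b\<in>set B3. R3 (eactn b (eactn vword x)) \<in> S \<and> R4 (eactn b (eactn vword x)) \<in> S \<and> R5 (eactn b (eactn vword x)) \<in> S"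
  using assms by (simp add: B3_def vword_def uword_def)

text \<open>The Weyl group of type F4 is not a parabolic subgroup here, so Deodhar's lemma does not
  bound the correction: besides single generators, longer elements of the subgroup occur on the
  right.\<close>

lemma C45_closed:
  assumes "\<forall>b\<in>set C45. \<forall>g\<in>rdigits ` {[], [1], [2], [3], [4], [1,2], [2,1], [2,3,2], [1,2,3,2,1]}. eactn b (eactn g (x)) \<in> S"
  shows "\<forall>b\<in>set C45. R1 (eactn b (x)) \<in> S \<and> R2 (eactn b (x)) \<in> S \<and> R3 (eactn b (x)) \<in> S \<and> R4 (eactn b (x)) \<in> S \<and> R5 (eactn b (x)) \<in> S \<and> R6 (eactn b (x)) \<in> S"
  using assms by (simp add: C45_def rdigits_def)

text \<open>The product of \<open>T\<close> with a conjugate reduces to Weyl words times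
  \<open>T\<close>, or, for orthogonal roots, times \<open>T\<close> and \<open>uword\<close>. The
  equivalences for \<open>S\<close> allow those Weyl words to be stripped.\<close>

lemma B1_leaf:
  assumes "\<And>y. dd y \<in> S \<longleftrightarrow> y \<in> S"
    and "\<And>y. R1 y \<in> S \<longleftrightarrow> y \<in> S" "\<And>y. R2 y \<in> S \<longleftrightarrow> y \<in> S" "\<And>y. R3 y \<in> S \<longleftrightarrow> y \<in> S"
      "\<And>y. R4 y \<in> S \<longleftrightarrow> y \<in> S" "\<And>y. R5 y \<in> S \<longleftrightarrow> y \<in> S" "\<And>y. R6 y \<in> S \<longleftrightarrow> y \<in> S"
    and "T x \<in> S" "eactn uword (T x) \<in> S"
  shows "\<forall>b\<in>set B1. T (eactn b (T x)) \<in> S"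
  using assms by (simp add: B1_def uword_def)

lemma B2_leaf:
  assumes "\<And>y. dd y \<in> S \<longleftrightarrow> y \<in> S"
    and "\<And>y. R1 y \<in> S \<longleftrightarrow> y \<in> S" "\<And>y. R2 y \<in> S \<longleftrightarrow> y \<in> S" "\<And>y. R3 y \<in> S \<longleftrightarrow> y \<in> S"
      "\<And>y. R4 y \<in> S \<longleftrightarrow> y \<in> S" "\<And>y. R5 y \<in> S \<longleftrightarrow> y \<in> S" "\<And>y. R6 y \<in> S \<longleftrightarrow> y \<in> S"
    and "eactn uword x \<in> S" "eactn vword (eactn uword x) \<in> S"
  shows "\<forall>b\<in>set B2. eactn uword (eactn b (eactn uword x)) \<in> S"
  using assms by (simp add: B2_def uword_def vword_def)

text \<open>Only the word with three idempotents is assumed to lie in \<open>S\<close>: a root of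
  the A3 orthogonal to that of \<open>vword\<close> is the dependent fourth root, so the depth does
  not grow.\<close>

lemma B3_leaf:
  assumes "\<And>y. dd y \<in> S \<longleftrightarrow> y \<in> S"
    and "\<And>y. R1 y \<in> S \<longleftrightarrow> y \<in> S" "\<And>y. R2 y \<in> S \<longleftrightarrow> y \<in> S" "\<And>y. R3 y \<in> S \<longleftrightarrow> y \<in> S"
      "\<And>y. R4 y \<in> S \<longleftrightarrow> y \<in> S" "\<And>y. R5 y \<in> S \<longleftrightarrow> y \<in> S" "\<And>y. R6 y \<in> S \<longleftrightarrow> y \<in> S"
    and "T (eactn uword (eactn vword x)) \<in> S"
  shows "\<forall>b\<in>set B3. eactn vword (eactn b (eactn vword (eactn uword (T x)))) \<in> S"
  using assms by (simp add: B3_def uword_def vword_def)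

lemma eletter_dd [simp]: "eletter n (dd x) = dd (eletter n x)"
  by (simp add: eletter_def)

lemma eactn_dd [simp]: "eactn ns (dd x) = dd (eactn ns x)"
  by (induction ns) simp_all

lemma eactn_ddn: "eactn ns ((dd ^^ k) x) = (dd ^^ k) (eactn ns x)"
  by (induction k) simp_all

lemma eactn_eqd: "F.eqd y z \<Longrightarrow> F.eqd (eactn ns y) (eactn ns z)"
  unfolding F.eqd_def by (metis eactn_ddn)

lemma T_comm: "set h \<subseteq> {1,3,4,5,6} \<Longrightarrow> T (eactn h x) = eactn h (T x)"
  by (induction h) auto

lemma U_comm: "set h \<subseteq> {3,4,5} \<Longrightarrow> eactn uword (eactn h x) = eactn h (eactn uword x)"
proof (induction h)
  case (Cons n h)
  then have "n \<in> {3,4,5}" by simp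
  then have "eactn uword (eletter n y) = eletter n (eactn uword y)" for y
    by (auto simp: uword_def)
  with Cons show ?case by simp
qed simp

lemma V_comm: "set h \<subseteq> {4} \<Longrightarrow> eactn vword (eactn h x) = eactn h (eactn vword x)"
proof (induction h)
  case (Cons n h)
  have "eactn vword (eletter 4 y) = eletter 4 (eactn vword y)" for y
    by (simp add: vword_def uword_def)
  with Cons show ?case by simp
qed simp

lemma B1_layer:
  assumes "set u \<subseteq> {1,2,3,4,5,6}"
  shows "\<exists>b\<in>set B1. \<exists>h. set h \<subseteq> {1,3,4,5,6} \<and> eactn u (T x) = eactn b (eactn h (T x))"
  using assms
proof (induction u)
  case Nil
  show ?case
    by (rule bexI[of _ "[]"], rule exI[of _ "[]"]) (simp_all add: B1_def)
next
  case (Cons n u)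
  then obtain b h where b: "b \<in> set B1" and h: "set h \<subseteq> {1,3,4,5,6}" and eq: "eactn u (T x) = eactn b (eactn h (T x))"
    by auto
  define S where "S = {z. \<exists>b\<in>set B1. \<exists>g\<in>{[],[1],[3],[4],[5],[6]}. z = eactn b (eactn g (T (eactn h x)))}"
  have "\<forall>b\<in>set B1. \<forall>g\<in>{[],[1],[3],[4],[5],[6]}. eactn b (eactn g (T (eactn h x))) \<in> S"
    unfolding S_def by blast
  from B1_closed[OF this]
  have "eletter n (eactn b (T (eactn h x))) \<in> S"
    using b Cons.prems by auto
  then obtain b' g where "b' \<in> set B1" "g \<in> {[],[1],[3],[4],[5],[6]}"
    "eletter n (eactn b (T (eactn h x))) = eactn b' (eactn g (T (eactn h x)))"
    unfolding S_def by blast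
  then have "b' \<in> set B1" "set (g @ h) \<subseteq> {1,3,4,5,6}" "eactn (n # u) (T x) = eactn b' (eactn (g @ h) (T x))"
    using h eq by (auto simp: T_comm)
  then show ?case
    by blast
qed

lemma B2_layer:
  assumes "set u \<subseteq> {1,3,4,5,6}"
  shows "\<exists>b\<in>set B2. \<exists>h. set h \<subseteq> {3,4,5} \<and> eactn u (eactn uword x) = eactn b (eactn h (eactn uword x))"
  using assms
proof (induction u)
  case Nil
  show ?case
    by (rule bexI[of _ "[]"], rule exI[of _ "[]"]) (simp_all add: B2_def)
next
  case (Cons n u)
  then obtain b h where b: "b \<in> set B2" and h: "set h \<subseteq> {3,4,5}"
    and eq: "eactn u (eactn uword x) = eactn b (eactn h (eactn uword x))"
    by auto
  define S where "S = {z. \<exists>b\<in>set B2. \<exists>g\<in>{[],[3],[4],[5]}. z = eactn b (eactn g (eactn uword (eactn h x)))}"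
  have "\<forall>b\<in>set B2. \<forall>g\<in>{[],[3],[4],[5]}. eactn b (eactn g (eactn uword (eactn h x))) \<in> S"
    unfolding S_def by blast
  from B2_closed[OF this]
  have "eletter n (eactn b (eactn uword (eactn h x))) \<in> S"
    using b Cons.prems by auto
  then obtain b' g where "b' \<in> set B2" "g \<in> {[],[3],[4],[5]}"
    "eletter n (eactn b (eactn uword (eactn h x))) = eactn b' (eactn g (eactn uword (eactn h x)))"
    unfolding S_def by blast
  then have "b' \<in> set B2" "set (g @ h) \<subseteq> {3,4,5}"
    "eactn (n # u) (eactn uword x) = eactn b' (eactn (g @ h) (eactn uword x))"
    using h eq by (auto simp: U_comm)
  then show ?case
    by blast
qed

lemma B3_layer:
  assumes "set u \<subseteq> {3,4,5}"
  shows "\<exists>b\<in>set B3. \<exists>h. set h \<subseteq> {4} \<and> eactn u (eactn vword x) = eactn b (eactn h (eactn vword x))"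
  using assms
proof (induction u)
  case Nil
  show ?case
    by (rule bexI[of _ "[]"], rule exI[of _ "[]"]) (simp_all add: B3_def)
next
  case (Cons n u)
  then obtain b h where b: "b \<in> set B3" and h: "set h \<subseteq> {4}"
    and eq: "eactn u (eactn vword x) = eactn b (eactn h (eactn vword x))"
    by auto
  define S where "S = {z. \<exists>b\<in>set B3. \<exists>g\<in>{[],[4]}. z = eactn b (eactn g (eactn vword (eactn h x)))}"
  have "\<forall>b\<in>set B3. \<forall>g\<in>{[],[4]}. eactn b (eactn g (eactn vword (eactn h x))) \<in> S"
    unfolding S_def by blast
  from B3_closed[OF this]
  have "eletter n (eactn b (eactn vword (eactn h x))) \<in> S"
    using b Cons.prems by auto
  then obtain b' g where "b' \<in> set B3" "g \<in> {[],[4]}"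
    "eletter n (eactn b (eactn vword (eactn h x))) = eactn b' (eactn g (eactn vword (eactn h x)))"
    unfolding S_def by blast
  then have "b' \<in> set B3" "set (g @ h) \<subseteq> {4}"
    "eactn (n # u) (eactn vword x) = eactn b' (eactn (g @ h) (eactn vword x))"
    using h eq by (auto simp: V_comm)
  then show ?case
    by blast
qed

definition factored :: "'b \<Rightarrow> 'b set" where
  "factored x = {z. \<exists>d\<le>3. \<exists>u v. set u \<subseteq> {1,2,3,4,5,6} \<and> set v \<subseteq> {1,2,3,4,5,6}
     \<and> F.eqd z (eactn u (eactn (eeps d) (eactn v x)))}"

lemma factoredI:
  assumes "set u \<subseteq> {1,2,3,4,5,6}" "set v \<subseteq> {1,2,3,4,5,6}" "d \<le> 3"
  shows "eactn u (eactn (eeps d) (eactn v x)) \<in> factored x"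
  unfolding factored_def using assms F.eqd_refl by blast

lemma factored_dd: "dd z \<in> factored x \<longleftrightarrow> z \<in> factored x"
  by (simp add: factored_def)

lemma factored_step:
  assumes "z \<in> factored x" "n \<in> {1,2,3,4,5,6}" shows "eletter n z \<in> factored x"
proof -
  obtain d u v where d: "d \<le> 3" and uv: "set u \<subseteq> {1,2,3,4,5,6}" "set v \<subseteq> {1,2,3,4,5,6}"
    and eq: "F.eqd z (eactn u (eactn (eeps d) (eactn v x)))"
    using assms(1) unfolding factored_def by blast
  have "F.eqd (eletter n z) (eactn (n # u) (eactn (eeps d) (eactn v x)))"
    using eactn_eqd[OF eq, of "[n]"] by simp
  moreover have "set (n # u) \<subseteq> {1,2,3,4,5,6}"
    using assms(2) uv(1) by simp
  ultimately show ?thesis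
    using d uv(2) unfolding factored_def by blast
qed

lemma factored_R:
  assumes "n \<in> {1,2,3,4,5,6}" shows "eletter n z \<in> factored x \<longleftrightarrow> z \<in> factored x"
proof -
  have "eletter n (eletter n z) = z"
    using assms by auto
  then show ?thesis
    using factored_step[OF _ assms, of z x] factored_step[OF _ assms, of "eletter n z" x] by auto
qed

lemmas factored_R_simps = factored_R[of 1, simplified] factored_R[of 2, simplified] factored_R[of 3, simplified]
  factored_R[of 4, simplified] factored_R[of 5, simplified] factored_R[of 6, simplified]

lemma eeps_simps: "eactn (eeps 0) x = x" "eactn (eeps 1) x = T x" "eactn (eeps (Suc 0)) x = T x" "eactn (eeps 2) x = T (eactn uword x)"
    "eactn (eeps 3) x = T (eactn uword (eactn vword x))"
  by (simp_all add: eeps_def)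

text \<open>The Weyl word before the idempotents is split along the chain of stabilizers:
  \<open>B1\<close> for the first root, the remainder by \<open>B2\<close> for the second and by
  \<open>B3\<close> for the third. What is left commutes with all idempotents already treated and
  moves to the right.\<close>

lemma factored_T:
  assumes z: "z \<in> factored x" shows "T z \<in> factored x"
proof -
  obtain d u v where d: "d \<le> 3" and uv: "set u \<subseteq> {1,2,3,4,5,6}" "set v \<subseteq> {1,2,3,4,5,6}"
    and eq: "F.eqd z (eactn u (eactn (eeps d) (eactn v x)))"
    using z unfolding factored_def by blast
  note B1 = B1_leaf[of "factored x", OF factored_dd factored_R_simps]
    and B2 = B2_leaf[of "factored x", OF factored_dd factored_R_simps]
    and B3 = B3_leaf[of "factored x", OF factored_dd factored_R_simps]
  define y where "y = eactn v x"
  have I: "eactn h (eactn (eeps d) (eactn h' y)) \<in> factored x"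
    if "set h \<subseteq> {1,2,3,4,5,6}" "set h' \<subseteq> {1,2,3,4,5,6}" "d \<le> 3" for h h' d
    using factoredI[of h "h' @ v" d x] that uv(2) by (simp add: y_def)
  have "T (eactn u (eactn (eeps d) y)) \<in> factored x"
  proof -
    consider "d = 0" | "d = 1" | "d = 2" | "d = 3"
      using d by linarith
    then show ?thesis
    proof cases
      case 1
      then show ?thesis
        using I[of "[]" u 1] uv(1) by (simp add: eeps_simps)
    next
      case 2
      obtain b h where b: "b \<in> set B1" and h: "set h \<subseteq> {1,3,4,5,6}" and eq: "eactn u (T y) = eactn b (eactn h (T y))"
        using B1_layer[OF uv(1)] by blast
      have "T (eactn h y) \<in> factored x" "eactn uword (T (eactn h y)) \<in> factored x"
        using I[of "[]" h 1] I[of "[]" h 2] h by (auto simp: eeps_simps T_U)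
      from B1[OF this] b show ?thesis
        using h eq by (simp add: 2 eeps_simps T_comm)
    next
      case 3
      define w where "w = eactn uword y"
      obtain b h where b: "b \<in> set B1" and h: "set h \<subseteq> {1,3,4,5,6}" and eq: "eactn u (T w) = eactn b (eactn h (T w))"
        using B1_layer[OF uv(1)] by blast
      obtain c g where c: "c \<in> set B2" and g: "set g \<subseteq> {3,4,5}"
        and eq': "eactn h (eactn uword (T y)) = eactn c (eactn g (eactn uword (T y)))"
        using B2_layer[OF h] by blast
      have gh: "set g \<subseteq> {1,3,4,5,6}" "set g \<subseteq> {1,2,3,4,5,6}" "set h \<subseteq> {1,2,3,4,5,6}"
        using g h by auto
      have "T (eactn h w) \<in> factored x"
        using I[of h "[]" 2] gh(3) by (simp add: eeps_simps w_def T_comm[OF h])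
      moreover have "eactn uword (eactn c (eactn uword (eactn g (T y)))) \<in> factored x"
      proof (rule bspec[OF B2 c])
        show "eactn uword (eactn g (T y)) \<in> factored x"
          using I[of g "[]" 2] gh by (simp add: eeps_simps U_comm[OF g] T_U)
        show "eactn vword (eactn uword (eactn g (T y))) \<in> factored x"
          using I[of "[]" g 3] gh by (simp add: eeps_simps T_U T_V U_V flip: T_comm[OF gh(1)])
      qed
      then have "eactn uword (T (eactn h w)) \<in> factored x"
        by (simp add: T_comm[OF h] w_def T_U eq' U_comm[OF g])
      ultimately have "T (eactn b (T (eactn h w))) \<in> factored x"
        using B1 b by blast
      then show ?thesis
        using eq by (simp add: 3 eeps_simps T_comm[OF h] w_def)
    next
      case 4
      define w where "w = eactn uword (eactn vword y)"
      obtain b h where b: "b \<in> set B1" and h: "set h \<subseteq> {1,3,4,5,6}" and eq: "eactn u (T w) = eactn b (eactn h (T w))"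
        using B1_layer[OF uv(1)] by blast
      obtain c g where c: "c \<in> set B2" and g: "set g \<subseteq> {3,4,5}"
        and eq': "eactn h (eactn uword (T (eactn vword y))) = eactn c (eactn g (eactn uword (T (eactn vword y))))"
        using B2_layer[OF h] by blast
      obtain a k where a: "a \<in> set B3" and k: "set k \<subseteq> {4}"
        and eq'': "eactn g (eactn vword (eactn uword (T y))) = eactn a (eactn k (eactn vword (eactn uword (T y))))"
        using B3_layer[OF g] by blast
      have gh: "set g \<subseteq> {1,3,4,5,6}" "set g \<subseteq> {1,2,3,4,5,6}" "set h \<subseteq> {1,2,3,4,5,6}" "set k \<subseteq> {1,2,3,4,5,6}"
        "set k \<subseteq> {1,3,4,5,6}" "set k \<subseteq> {3,4,5}"
        using g h k by auto
      have "T (eactn h w) \<in> factored x"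
        using I[of h "[]" 3] gh(3) by (simp add: eeps_simps w_def T_comm[OF h])
      moreover have "eactn uword (eactn c (eactn uword (eactn g (T (eactn vword y))))) \<in> factored x"
      proof (rule bspec[OF B2 c])
        show "eactn uword (eactn g (T (eactn vword y))) \<in> factored x"
          using I[of g "[]" 3] gh by (simp add: eeps_simps U_comm[OF g] T_U)
        have "eactn vword (eactn a (eactn vword (eactn uword (T (eactn k y))))) \<in> factored x"
        proof (rule bspec[OF B3 a])
          show "T (eactn uword (eactn vword (eactn k y))) \<in> factored x"
            using I[of "[]" k 3] gh by (simp add: eeps_simps)
        qed
        also have "eactn vword (eactn a (eactn vword (eactn uword (T (eactn k y)))))
            = eactn vword (eactn g (eactn vword (eactn uword (T y))))"
          by (simp add: eq'' T_comm[OF gh(5)] U_comm[OF gh(6)] V_comm[OF k])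
        also have "\<dots> = eactn vword (eactn uword (eactn g (T (eactn vword y))))"
          by (simp add: U_comm[OF g] T_V U_V)
        finally show "eactn vword (eactn uword (eactn g (T (eactn vword y)))) \<in> factored x" .
      qed
      then have "eactn uword (T (eactn h w)) \<in> factored x"
        by (simp add: T_comm[OF h] w_def T_U eq' U_comm[OF g])
      ultimately have "T (eactn b (T (eactn h w))) \<in> factored x"
        using B1 b by blast
      then show ?thesis
        using eq by (simp add: 4 eeps_simps T_comm[OF h] w_def)
    qed
  qed
  then obtain d' u' v' where *: "d' \<le> 3" "set u' \<subseteq> {1,2,3,4,5,6}" "set v' \<subseteq> {1,2,3,4,5,6}"
    "F.eqd (T (eactn u (eactn (eeps d) y))) (eactn u' (eactn (eeps d') (eactn v' x)))"
    unfolding factored_def by blast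
  have "F.eqd (T z) (T (eactn u (eactn (eeps d) y)))"
    using eactn_eqd[OF eq, of "[7]"] by (simp add: y_def)
  from F.eqd_trans[OF this *(4)] show ?thesis
    using *(1-3) unfolding factored_def by blast
qed

lemma eactn_factored: "set w \<subseteq> {1,2,3,4,5,6,7} \<Longrightarrow> eactn w x \<in> factored x"
proof (induction w)
  case Nil
  show ?case
    using factoredI[of "[]" "[]" 0 x] by (simp add: eeps_simps)
next
  case (Cons n w)
  then have "eactn w x \<in> factored x" "n = 7 \<or> n \<in> {1,2,3,4,5,6}"
    by auto
  then show ?case
    using factored_T[of "eactn w x" x] factored_step[of "eactn w x" x n] by (elim disjE) simp_all
qed

lemma act_factored: "act f w x \<in> factored x"
proof -
  have "act f w x = eactn (concat (map edigits w)) x"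
    by (induction w) (simp_all add: eactn_edigits)
  moreover have "set (edigits g) \<subseteq> {1,2,3,4,5,6,7}" for g
    by (cases g; cases "case g of ER i \<Rightarrow> i | EE i \<Rightarrow> i") (auto simp: edigits_def Let_def e2digits_def)
  then have "set (concat (map edigits w)) \<subseteq> {1,2,3,4,5,6,7}"
    by (induction w) auto
  ultimately show ?thesis
    using eactn_factored by simp
qed

lemma rdigits_append [simp]: "rdigits (u @ v) = rdigits u @ rdigits v"
  by (simp add: rdigits_def)

lemma C45_coset:
  assumes "set u \<subseteq> {1,2,3,4,5,6}"
  shows "\<exists>c\<in>set C45. \<exists>t. eactn u x = eactn c (eactn (rdigits t) x)"
  using assms
proof (induction u)
  case Nil
  show ?case
    by (rule bexI[of _ "[]"], rule exI[of _ "[]"]) (simp_all add: C45_def rdigits_def)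
next
  case (Cons n u)
  then obtain c t where c: "c \<in> set C45" and eq: "eactn u x = eactn c (eactn (rdigits t) x)"
    by auto
  define S where "S = {z. \<exists>c\<in>set C45. \<exists>t'. z = eactn c (eactn (rdigits t') (eactn (rdigits t) x))}"
  have "\<forall>b\<in>set C45. \<forall>g\<in>rdigits ` {[], [1], [2], [3], [4], [1,2], [2,1], [2,3,2], [1,2,3,2,1]}. eactn b (eactn g (eactn (rdigits t) x)) \<in> S"
    unfolding S_def by blast
  from C45_closed[OF this]
  have "eletter n (eactn c (eactn (rdigits t) x)) \<in> S"
    using c Cons.prems by auto
  then obtain c' t' where "c' \<in> set C45" "eactn (n # u) x = eactn c' (eactn (rdigits (t' @ t)) x)"
    using eq unfolding S_def by auto
  then show ?case
    by blast
qed

end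

text \<open>For the listed cosets the product of the inverse representative with the word of the stratum lies in the
  image of \<open>Br(F\<^sub>4)\<close>.\<close>

definition G2 :: "(nat list \<times> nat list) list" where
  "G2 = [([],[6,4,3,2,3,4,6,4,3,2,3,4]), ([3],[1,3,6,4,3,2,3,4,5,2,1,3,4,6]),
    ([4,3],[1,3,6,4,3,2,3,5,2,1,3,4,6]), ([2,4,3],[1,2,3,2,3,4,3,2,3,5,2,1,3,4,6]),
    ([6,1,3,4,5,4,3,2,4,1,3,1],[2,3,2,3,4,3,2,3,5,2,1,3,4,6])]"

definition G3 :: "(nat list \<times> nat list) list" where
  "G3 = [([],[6,4,3,2,3,4,6,4,3,2,3,4,1,4,3,2,3,4,6,4,3,2,3,4,1]), ([1],[2,3,2,5,6,4,3,2,3,4,6]),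
    ([3],[1,3,2,5,6,4,3,2,3,4,6]), ([4,3],[1,3,2,5,6,4,3,2,3,4,6]), ([1,3,1],[3,2,5,6,4,3,2,3,4,6]),
    ([2,4,3],[1,2,3,2,4,3,2,5,6,4,3,2,3,4,6]), ([4,1,3,1],[3,2,5,6,4,3,2,3,4,6]),
    ([2,4,1,3,1],[2,3,2,4,3,2,5,6,4,3,2,3,4,6]), ([5,3,4,1,3,1],[3,2,5,6,4,3,2,3,4,6]),
    ([5,3,2,4,1,3,1],[2,3,2,4,3,2,5,6,4,3,2,3,4,6]), ([4,5,3,2,4,1,3,1],[2,3,2,4,3,2,5,6,4,3,2,3,4,6]),
    ([3,4,5,4,3,2,4,1,3,1],[2,3,2,4,3,2,5,6,4,3,2,3,4,6]),
    ([6,1,3,4,5,4,3,2,4,1,3,1],[2,3,2,4,3,2,5,6,4,3,2,3,4,6])]"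

context brauer_E6 begin

text \<open>All orthogonal pairs of roots are conjugate under the Weyl group of type E6, so the
  exchanged pair becomes \<open>T\<close> and \<open>uword\<close> between two Weyl words. This
  makes the short idempotent accessible to the rules for \<open>T\<close>.\<close>

lemma E1_E6: "E1 (E6 x) = R5 (R4 (R3 (R2 (R4 (R5 (R6 (R2 (R4 (R5 (R3 (R4 (R2 (R1 (T (eactn uword (R1 (R2 (R4 (R3 (R5 (R4 (R2 (R6 (R5 (R4 (R2 (R3 (R4 (R5 x)))))))))))))))))))))))))))))"
  unfolding eactn_edigits[of "EE n1", symmetric] eactn_edigits[of "EE n6", symmetric]
  by (simp add: edigits_def Let_def e2digits_def uword_def)

lemma good2: "\<forall>(c, s)\<in>set G2. eactn (rev c) (eactn (eeps 2) x) = F.actn s x"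
  unfolding G2_def
  by (simp only: list.set ball_simps split F.actn.simps F.letter_simps F_gens E1_E6) (simp add: eeps_def uword_def)

lemma good3: "\<forall>(c, s)\<in>set G3. eactn (rev c) (eactn (eeps 3) x) = F.actn s x"
  unfolding G3_def
  by (simp only: list.set ball_simps split F.actn.simps F.letter_simps F_gens E1_E6) (simp add: eeps_def uword_def vword_def)

lemma eactn_rev_eeps: "d \<le> 3 \<Longrightarrow> eactn (rev (eeps d)) x = eactn (eeps d) x"
  by (cases "d = 0"; cases "d = 1"; cases "d = 2") (simp_all add: eeps_def uword_def vword_def)

lemma act_rev_phi_word: "act f (rev (phi_word g)) x = act f (phi_word g) x"
proof (cases g)
  case (Fr i)
  then show ?thesis
    by (cases i) (simp_all add: phi_word.simps)
next
  case (Fe i)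
  then show ?thesis
    by (cases i) (simp_all add: phi_word.simps)
qed

end

section \<open>Invariant words\<close>

lemma relE6I:
  "R i * R i - 1 \<in> relE6" "R i * E i - E i \<in> relE6" "E i * R i - E i \<in> relE6" "E i * E i - dl * E i \<in> relE6"
  unfolding relE6_def by blast+

lemma relE6_comm:
  assumes "i \<noteq> j" "\<not> adjE6 i j"
  shows "R i * R j - R j * R i \<in> relE6" "E i * R j - R j * E i \<in> relE6" "E i * E j - E j * E i \<in> relE6"
  using assms unfolding relE6_def by blast+

lemma relE6_braid:
  assumes "adjE6 i j"
  shows "R i * R j * R i - R j * R i * R j \<in> relE6" "R j * R i * E j - E i * E j \<in> relE6"
    "R i * E j * R i - R j * E i * R j \<in> relE6"
  using assms unfolding relE6_def by blast+

lemma mulE6_dl: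
  "lmulE6 (gen g) (lmulE6 dl x) = lmulE6 dl (lmulE6 (gen g) x)"
  "rmulE6 (gen g) (rmulE6 dl x) = rmulE6 dl (rmulE6 (gen g) x)"
  "lmulE6 dl (lmulE6 (scal (dpow (-1)) 1) x) = x" "lmulE6 (scal (dpow (-1)) 1) (lmulE6 dl x) = x"
  "rmulE6 dl (rmulE6 (scal (dpow (-1)) 1) x) = x" "rmulE6 (scal (dpow (-1)) 1) (rmulE6 dl x) = x"
  by (simp_all add: dl_mult dl_def scal_mult_left scal_mult_right flip: mulE6_mult dpow_add)

interpretation LE6: brauer_E6 "\<lambda>g. lmulE6 (gen g)" "lmulE6 dl" "lmulE6 (scal (dpow (-1)) 1)"
proof (unfold_locales, unfold R_def[symmetric] E_def[symmetric], goal_cases)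
  case (4 i x)
  then show ?case
    using mulE6_relation(1)[OF relE6I(1)[of i]] by (simp add: mulE6_mult)
next
  case (5 i x)
  then show ?case
    using mulE6_relation(1)[OF relE6I(2)[of i]] by (simp add: mulE6_mult)
next
  case (6 i x)
  then show ?case
    using mulE6_relation(1)[OF relE6I(3)[of i]] by (simp add: mulE6_mult)
next
  case (7 i x)
  then show ?case
    using mulE6_relation(1)[OF relE6I(4)[of i]] by (simp add: mulE6_mult)
next
  case (8 i j x)
  then show ?case
    using relE6_comm[THEN mulE6_relation(1), of i j x] by (simp add: mulE6_mult)
next
  case (9 i j x)
  then show ?case
    using relE6_braid[THEN mulE6_relation(1), of i j x] by (simp add: mulE6_mult)
qed (rule mulE6_dl)+

lemma rmulE6_eq:
  assumes "\<And>x. lmulE6 a x = lmulE6 b x" shows "rmulE6 a x = rmulE6 b x"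
proof -
  obtain y where x: "x = abs_brE6 y"
    by (induction x rule: brE6.abs_induct) blast
  have "a - b \<in> IE6"
    using assms[of "abs_brE6 1"] by (simp add: mulE6_abs brE6.abs_eq_iff)
  then have "y * (a - b) \<in> IE6"
    unfolding IE6_def by (rule ideal_gen_mult)
  then show ?thesis
    by (simp add: x mulE6_abs brE6.abs_eq_iff right_diff_distrib)
qed

interpretation RE6: brauer_E6 "\<lambda>g. rmulE6 (gen g)" "rmulE6 dl" "rmulE6 (scal (dpow (-1)) 1)"
proof (unfold_locales, unfold R_def[symmetric] E_def[symmetric], goal_cases)
  case (4 i x)
  then show ?case
    using mulE6_relation(2)[OF relE6I(1)[of i]] by (simp add: mulE6_mult)
next
  case (5 i x)
  then show ?case
    using mulE6_relation(2)[OF relE6I(3)[of i]] by (simp add: mulE6_mult)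
next
  case (6 i x)
  then show ?case
    using mulE6_relation(2)[OF relE6I(2)[of i]] by (simp add: mulE6_mult)
next
  case (7 i x)
  have "rmulE6 (E i) (rmulE6 dl y) = rmulE6 dl (rmulE6 (E i) y)" for y
    unfolding E_def by (rule mulE6_dl)
  then show ?case
    using mulE6_relation(2)[OF relE6I(4)[of i]] by (simp add: mulE6_mult)
next
  case (8 i j x)
  then have "j \<noteq> i" "\<not> adjE6 j i"
    using adjE6_sym by auto
  from relE6_comm[THEN mulE6_relation(2), OF this, of x] relE6_comm[THEN mulE6_relation(2), OF 8, of x]
  show ?case by (simp add: mulE6_mult)
next
  case (9 i j x)
  have "rmulE6 (E j * R i * R j) x = rmulE6 (E j * E i) x"
    using LE6.E_R_R[OF 9] by (intro rmulE6_eq) (simp add: mulE6_mult R_def E_def)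
  then show ?case
    using relE6_braid[THEN mulE6_relation(2), OF 9, of x] by (simp add: mulE6_mult)
qed (rule mulE6_dl)+

lemma act_lmulE6: "act (\<lambda>g. lmulE6 (gen g)) w (abs_brE6 (mon v k)) = abs_brE6 (mon (w @ v) k)"
  by (induction w) (simp_all add: mulE6_abs mon_Cons)

lemma act_rmulE6: "act (\<lambda>g. rmulE6 (gen g)) w (abs_brE6 (mon v k)) = abs_brE6 (mon (v @ rev w) k)"
  by (induction w) (simp_all add: mulE6_abs gen_mon mon_mult)

lemma funpow_dl_E6: "((lmulE6 dl) ^^ n) (abs_brE6 (mon w k)) = abs_brE6 (mon w (k + int n))"
  by (induction n) (simp_all add: mulE6_abs dl_mon add_ac)

lemma abs_brE6_wcong:
  assumes "abs_brE6 (mon u k) = abs_brE6 (mon v l)" shows "wcong relE6 u v"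
proof -
  have "mon u k - mon v l \<in> ideal_gen relE6"
    using assms by (simp add: brE6.abs_eq_iff IE6_def)
  from ideal_gen_scal[OF this, of "dpow (- k)"] show ?thesis
    unfolding wcong_def by (auto simp: scal_diff scal_mon)
qed

lemma LE6_act: "LE6.eactn n (abs_brE6 1) = abs_brE6 (mon (ewd n) 0)"
  using act_lmulE6[of "ewd n" "[]" 0] by (simp add: LE6.act_ewd mon_Nil)

lemma wcong_rev_phi_word: "wcong relE6 (rev (phi_word g)) (phi_word g)"
proof -
  have "act (\<lambda>g. lmulE6 (gen g)) (rev (phi_word g)) (abs_brE6 (mon [] 0))
      = act (\<lambda>g. lmulE6 (gen g)) (phi_word g) (abs_brE6 (mon [] 0))"
    by (rule LE6.act_rev_phi_word)
  then show ?thesis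
    unfolding act_lmulE6 by (intro abs_brE6_wcong) simp
qed

lemma wcong_rev_phiw: "wcong relE6 (rev (phiw w)) (phiw (rev w))"
proof (induction w)
  case Nil
  show ?case by (simp add: phiw_def)
next
  case (Cons g w)
  have "wcong relE6 (rev (phiw w) @ rev (phi_word g)) (rev (phiw w) @ phi_word g)"
    using wcong_append[OF wcong_rev_phi_word, of "rev (phiw w)" _ "[]"] by simp
  also have "wcong relE6 (rev (phiw w) @ phi_word g) (phiw (rev w) @ phi_word g)"
    using wcong_append[OF Cons.IH, of "[]"] by simp
  finally show ?case
    by (simp add: phiw_def)
qed

lemma RE6_act: "RE6.eactn n (abs_brE6 1) = abs_brE6 (mon (rev (ewd n)) 0)"
  using act_rmulE6[of "ewd n" "[]" 0] by (simp add: RE6.act_ewd mon_Nil)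

definition econg :: "nat list \<Rightarrow> nat list \<Rightarrow> bool" (infix "\<simeq>" 50) where
  "u \<simeq> v \<longleftrightarrow> wcong relE6 (ewd u) (ewd v)"

lemma econg_sym: "u \<simeq> v \<Longrightarrow> v \<simeq> u"
  by (simp add: econg_def wcong_sym)

lemma econg_trans [trans]: "u \<simeq> v \<Longrightarrow> v \<simeq> w \<Longrightarrow> u \<simeq> w"
  unfolding econg_def by (rule wcong_trans)

lemma econg_append: "u \<simeq> v \<Longrightarrow> p @ u @ q \<simeq> p @ v @ q"
  unfolding econg_def ewd_append by (rule wcong_append)

lemma econg_left: "LE6.eactn u (abs_brE6 1) = LE6.eactn v (abs_brE6 1) \<Longrightarrow> u \<simeq> v"
  unfolding econg_def LE6_act by (rule abs_brE6_wcong)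

lemma wcong_rev_ewd: "wcong relE6 (rev (ewd n)) (ewd (rev n))"
proof (induction n)
  case Nil
  show ?case by (simp add: ewd_def)
next
  case (Cons m n)
  have "wcong relE6 (rev (eletter_word m)) (eletter_word m)"
  proof (cases "m = 7")
    case True
    have "rev tword = tword"
      by (simp add: tword_def)
    then show ?thesis
      using True wcong_rev_phiw[of tword] by (simp add: eletter_word_def)
  qed (simp add: eletter_word_def)
  then have "wcong relE6 (rev (ewd n) @ rev (eletter_word m)) (rev (ewd n) @ eletter_word m)"
    using wcong_append[of relE6 _ _ "rev (ewd n)" "[]"] by simp
  also have "wcong relE6 (rev (ewd n) @ eletter_word m) (ewd (rev n) @ eletter_word m)"
    using wcong_append[OF Cons.IH, of "[]"] by simp
  finally show ?case
    by (simp add: ewd_def)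
qed

lemma econg_right:
  assumes "RE6.eactn u (abs_brE6 1) = RE6.eactn v (abs_brE6 1)" shows "rev u \<simeq> rev v"
proof -
  have "wcong relE6 (rev (ewd u)) (rev (ewd v))"
    using assms unfolding RE6_act by (rule abs_brE6_wcong)
  then show ?thesis
    using wcong_rev_ewd wcong_sym wcong_trans unfolding econg_def by metis
qed

lemma E6_word_factored:
  "\<exists>d\<le>3. \<exists>u v. set u \<subseteq> {1,2,3,4,5,6} \<and> set v \<subseteq> {1,2,3,4,5,6} \<and> wcong relE6 w (ewd (u @ eeps d @ v))"
proof -
  obtain d u v where d: "d \<le> 3" "set u \<subseteq> {1,2,3,4,5,6}" "set v \<subseteq> {1,2,3,4,5,6}"
    and eq: "LE6.F.eqd (act (\<lambda>g. lmulE6 (gen g)) w (abs_brE6 1)) (LE6.eactn (u @ eeps d @ v) (abs_brE6 1))"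
    using LE6.act_factored[of w "abs_brE6 1"] unfolding LE6.factored_def by auto
  have "act (\<lambda>g. lmulE6 (gen g)) w (abs_brE6 1) = abs_brE6 (mon w 0)"
    using act_lmulE6[of w "[]" 0] by (simp add: mon_Nil)
  with eq obtain k l where "abs_brE6 (mon w (0 + int k)) = abs_brE6 (mon (ewd (u @ eeps d @ v)) (0 + int l))"
    unfolding LE6.F.eqd_def LE6_act by (metis funpow_dl_E6)
  then show ?thesis
    using d abs_brE6_wcong by blast
qed

section \<open>Words proportional to images under \<phi>\<close>

definition inF4 :: "nat list \<Rightarrow> bool" where
  "inF4 n \<longleftrightarrow> (\<exists>w. wcong relE6 (ewd n) (phiw w))"

lemma inF4_append: assumes "inF4 u" "inF4 v" shows "inF4 (u @ v)"
proof -
  obtain a b where ab: "wcong relE6 (ewd u) (phiw a)" "wcong relE6 (ewd v) (phiw b)"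
    using assms unfolding inF4_def by blast
  have "wcong relE6 (ewd u @ ewd v) (phiw a @ ewd v)"
    using wcong_append[OF ab(1), of "[]"] by simp
  also have "wcong relE6 (phiw a @ ewd v) (phiw a @ phiw b)"
    using wcong_append[OF ab(2), of _ "[]"] by simp
  finally show ?thesis
    unfolding inF4_def by (metis ewd_append phiw_append)
qed

lemma inF4_cong: "u \<simeq> v \<Longrightarrow> inF4 v \<Longrightarrow> inF4 u"
  unfolding inF4_def econg_def by (blast intro: wcong_trans)

lemma ewd_rdigits: "\<exists>w. ewd (rdigits t) = phiw w"
proof -
  have "ewd (rdigits t) = phiw (wd (map (\<lambda>n. if n \<in> {1,2,3} then n else 4) t))"
    by (induction t)
      (auto simp: rdigits_def ewd_def phiw_def wd_def letter_word_def eletter_word_def node_def phi_word.simps)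
  then show ?thesis
    by blast
qed

lemma inF4_rdigits: "inF4 (rdigits t)"
  unfolding inF4_def using ewd_rdigits wcong_refl by metis

text \<open>The lists treat only idempotents with the representative on the left. The same identity,
  read with right multiplications and then reversed, gives the other side.\<close>

lemma good_inF4:
  assumes "d \<in> {2, 3}" "c \<in> fst ` set (if d = 2 then G2 else G3)"
  shows "inF4 (rev c @ eeps d)" "inF4 (eeps d @ c)"
proof -
  obtain s where s: "(c, s) \<in> set (if d = 2 then G2 else G3)"
    using assms(2) by auto
  have L: "LE6.eactn (rev c @ eeps d) (abs_brE6 1) = LE6.F.actn s (abs_brE6 1)"
    using s assms(1) LE6.good2[of "abs_brE6 1"] LE6.good3[of "abs_brE6 1"] by (auto split: if_splits)
  have "LE6.F.actn s (abs_brE6 1) = act (\<lambda>g. lmulE6 (gen g)) (phiw (wd s)) (abs_brE6 1)"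
    unfolding LE6.act_phiw LE6.F.act_wd ..
  also have "\<dots> = abs_brE6 (mon (phiw (wd s)) 0)"
    using act_lmulE6[of "phiw (wd s)" "[]" 0] by (simp add: mon_Nil)
  finally show "inF4 (rev c @ eeps d)"
    using abs_brE6_wcong[of "ewd (rev c @ eeps d)" 0] L unfolding inF4_def LE6_act by metis
  have R: "RE6.eactn (rev c @ eeps d) (abs_brE6 1) = RE6.F.actn s (abs_brE6 1)"
    using s assms(1) RE6.good2[of "abs_brE6 1"] RE6.good3[of "abs_brE6 1"] by (auto split: if_splits)
  have "RE6.F.actn s (abs_brE6 1) = act (\<lambda>g. rmulE6 (gen g)) (phiw (wd s)) (abs_brE6 1)"
    unfolding RE6.act_phiw RE6.F.act_wd ..
  also have "\<dots> = abs_brE6 (mon (rev (phiw (wd s))) 0)"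
    using act_rmulE6[of "phiw (wd s)" "[]" 0] by (simp add: mon_Nil)
  finally have eq: "wcong relE6 (rev (ewd (rev c @ eeps d))) (rev (phiw (wd s)))"
    using abs_brE6_wcong R unfolding RE6_act by metis
  have "eeps d @ c \<simeq> rev (eeps d) @ c"
    using econg_sym[OF econg_append[OF econg_left, OF LE6.eactn_rev_eeps, of d "[]" c]] assms(1) by auto
  then have "wcong relE6 (ewd (eeps d @ c)) (ewd (rev (rev c @ eeps d)))"
    by (simp add: econg_def)
  also have "wcong relE6 (ewd (rev (rev c @ eeps d))) (rev (ewd (rev c @ eeps d)))"
    by (rule wcong_sym[OF wcong_rev_ewd])
  also note eq
  also note wcong_rev_phiw
  finally show "inF4 (eeps d @ c)"
    unfolding inF4_def by blast
qed

section \<open>The diagram automorphism on the model\<close>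

fun sv :: "vec \<Rightarrow> vec" where
  "sv (Vec a b c d k l) = Vec l b k d c a"

lemma sv_sv [simp]: "sv (sv x) = x"
  by (cases x) simp

lemma sv_vadd: "sv (vadd x y) = vadd (sv x) (sv y)"
  by (cases x; cases y) simp

lemma form_sv: "form (sigma_node i) (sv x) \<longleftrightarrow> form i x"
  by (cases i; cases x) auto

lemma root_sigma: "root (sigma_node i) = sv (root i)"
  by (cases i) simp_all

lemma sv_eq_iff: "sv x = sv y \<longleftrightarrow> x = y"
  by (metis sv_sv)

lemma grel_sigma: "(sv x, sv y) \<in> grel (sigma_gen g) \<longleftrightarrow> (x, y) \<in> grel g"
  by (cases g) (simp_all add: reflect_def form_sv root_sigma sv_eq_iff flip: sv_vadd)

lemma wrel_sigma: "(sv x, sv y) \<in> wrel (map sigma_gen w) \<longleftrightarrow> (x, y) \<in> wrel w"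
proof (induction w arbitrary: y)
  case (Cons g w)
  have "(sv x, sv y) \<in> wrel (map sigma_gen (g # w)) \<longleftrightarrow>
      (\<exists>z. (sv x, sv z) \<in> wrel (map sigma_gen w) \<and> (sv z, sv y) \<in> grel (sigma_gen g))"
    by (simp add: relcomp_unfold) (metis sv_sv)
  also have "\<dots> \<longleftrightarrow> (x, y) \<in> wrel (g # w)"
    by (simp add: Cons.IH grel_sigma relcomp_unfold)
  finally show ?case .
qed (simp add: sv_eq_iff)

text \<open>Invariance of the correspondence alone. It follows from the invariance of the class
  modulo the ideal and can be tested on vectors.\<close>

definition sinv :: "E6gen list \<Rightarrow> bool" where
  "sinv w \<longleftrightarrow> wrel (map sigma_gen w) = wrel w"

lemma sinv_sv: "sinv w \<longleftrightarrow> (\<forall>x y. (sv x, sv y) \<in> wrel w \<longleftrightarrow> (x, y) \<in> wrel w)"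
proof
  assume "sinv w"
  then show "\<forall>x y. (sv x, sv y) \<in> wrel w \<longleftrightarrow> (x, y) \<in> wrel w"
    using wrel_sigma unfolding sinv_def by metis
next
  assume *: "\<forall>x y. (sv x, sv y) \<in> wrel w \<longleftrightarrow> (x, y) \<in> wrel w"
  have "(x, y) \<in> wrel (map sigma_gen w) \<longleftrightarrow> (x, y) \<in> wrel w" for x y
    using wrel_sigma[of "sv x" "sv y" w] * by (metis sv_sv)
  then show "sinv w"
    unfolding sinv_def by (rule rel_eqI)
qed

lemma sinv_Image:
  assumes "sinv w" "y \<in> wrel w `` {x}" shows "sv y \<in> wrel w `` {sv x}"
  using assms wrel_sigma[of x y w] unfolding sinv_def by simp

lemma sinv_append: "sinv u \<Longrightarrow> sinv v \<Longrightarrow> sinv (u @ v)"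
  by (simp add: sinv_def wrel_append)

lemma wrel_rev: "wrel (rev w) = (wrel w)\<inverse>"
proof (induction w)
  case (Cons g w)
  have "(x, y) \<in> grel g \<longleftrightarrow> (y, x) \<in> grel g" for x y
    by (cases g) (auto simp: reflect_def)
  then have "(grel g)\<inverse> = grel g"
    by auto
  then show ?case
    by (simp add: wrel_append Cons.IH converse_relcomp)
qed simp

lemma sinv_rev: "sinv w \<Longrightarrow> sinv (rev w)"
  by (simp add: sinv_def wrel_rev flip: rev_map)

lemma scal_dpow_1_nonzero: "scal (dpow k) (1 :: 'g falg) \<noteq> 0"
proof -
  have "Poly_Mapping.lookup (Poly_Mapping.lookup (mon [] k :: 'g falg) (Word [])) k \<noteq> 0"
    by (simp add: mon_def dpow_def)
  then show ?thesis
    using scal_mon[of k "[] :: 'g list" 0] by (auto simp: mon_Nil)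
qed

lemma IE6_wrel:
  assumes "mon u a - mon v b \<in> IE6" shows "wrel u = wrel v"
proof -
  have "coef (wrel u) (mon u a) = coef (wrel u) (mon v b)"
    using coef_IE6[OF assms, of "wrel u"] by (simp add: coef_def lin_diff)
  then show ?thesis
    using scal_dpow_1_nonzero by (auto simp: coef_mon split: if_splits)
qed

lemma wcong_wrel: "wcong relE6 u v \<Longrightarrow> wrel u = wrel v"
  unfolding wcong_def IE6_def[symmetric] using IE6_wrel by blast

lemma sigma_phi_word: "map sigma_gen (phi_word g) = rev (phi_word g)"
proof (cases g)
  case (Fr i)
  then show ?thesis
    by (cases i) (simp_all add: phi_word.simps)
next
  case (Fe i)
  then show ?thesis
    by (cases i) (simp_all add: phi_word.simps)
qed

lemma sinv_phiw: "sinv (phiw w)"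
proof (induction w)
  case (Cons g w)
  have "sinv (phi_word g)"
    unfolding sinv_def sigma_phi_word by (rule wcong_wrel[OF wcong_rev_phi_word])
  from sinv_append[OF this Cons.IH] show ?case
    by (simp add: phiw_def)
qed (simp add: sinv_def phiw_def)

section \<open>Executable tests of invariance\<close>

fun gimg :: "E6gen \<Rightarrow> vec list \<Rightarrow> vec list" where
  "gimg (ER i) L = map (reflect i) L"
| "gimg (EE i) L = (let M = filter (\<lambda>x. \<not> form i x) L in M @ map (vadd (root i)) M)"

primrec img :: "E6gen list \<Rightarrow> vec list \<Rightarrow> vec list" where
  "img [] L = L"
| "img (g # w) L = remdups (gimg g (img w L))"

lemma set_img: "set (img w L) = wrel w `` set L"
proof (induction w)
  case (Cons g w)
  have "set (gimg g M) = grel g `` set M" for M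
    by (cases g) (auto simp: Let_def)
  then show ?case
    by (simp add: Cons.IH relcomp_Image)
qed simp

text \<open>An invariant correspondence carries images of \<open>x\<close> to images of
  \<open>sv x\<close>. A single suitable vector gives a necessary condition that can be
  computed.\<close>

definition sv_ok :: "E6gen list \<Rightarrow> vec \<Rightarrow> bool" where
  "sv_ok w x \<longleftrightarrow> (\<forall>y\<in>set (img w [x]). sv y \<in> set (img w [sv x]))"

lemma sinv_sv_ok: "sinv w \<Longrightarrow> sv_ok w x"
  unfolding sv_ok_def set_img using sinv_Image by auto

text \<open>The probe is \<alpha>3 + \<alpha>4; it already excludes all nontrivial cosets of the
  Weyl group of type F4.\<close>

lemma C45_sv_ok_0: "\<forall>c\<in>set C45. sv_ok (ewd c) (Vec False False True True False False) \<longrightarrow> c = []"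
  by code_simp

text \<open>The image of 0 is the line of the transported highest root. Among the chosen
  representatives this line is \<sigma>-invariant only for those in the stabilizer of the highest
  root, whose letters commute with \<open>T\<close>.\<close>

lemma C45_sv_ok_1: "\<forall>c\<in>set C45. sv_ok (ewd (rev c @ eeps 1)) vzero \<longrightarrow> set c \<subseteq> {1,3,4,5,6}"
  by code_simp

lemma C45_sv_ok_1': "\<forall>c\<in>set C45. sv_ok (ewd (eeps 1 @ c)) (Vec True False False False True True) \<longrightarrow> c = []"
  by code_simp

text \<open>What remains are the cosets that take the two orthogonal roots to a \<sigma>-invariant
  plane; \<open>G2\<close> handles these, and \<open>G3\<close> the analogous cosets for three
  roots.\<close>

lemma C45_sv_ok_2: "\<forall>c\<in>set C45. sv_ok (ewd (rev c @ eeps 2)) vzero \<longrightarrow> c \<in> fst ` set G2"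
  by code_simp

lemma C45_sv_ok_3: "\<forall>c\<in>set C45. sv_ok (ewd (rev c @ eeps 3)) vzero \<longrightarrow> c \<in> fst ` set G3"
  by code_simp

lemma (in brauer_E6) eeps_idem:
  assumes "d \<in> {1,2,3}" shows "F.eqd (eactn (eeps d) (eactn (eeps d) x)) (eactn (eeps d) x)"
proof -
  have "eactn uword (eactn uword x) = dd (eactn uword x)" "eactn vword (eactn vword x) = dd (eactn vword x)" for x
    by (simp_all add: uword_def vword_def)
  then show ?thesis
    using assms by (auto simp: eeps_simps T_U T_V U_V)
qed

lemma econg_eeps_idem: assumes "d \<in> {1,2,3}" shows "eeps d @ eeps d \<simeq> eeps d"
proof -
  have "LE6.eactn (eeps d) (LE6.eactn (eeps d) (abs_brE6 1)) = abs_brE6 (mon (ewd (eeps d @ eeps d)) 0)"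
    using LE6_act[of "eeps d @ eeps d"] by simp
  then obtain k l where "((lmulE6 dl) ^^ k) (abs_brE6 (mon (ewd (eeps d @ eeps d)) 0)) = ((lmulE6 dl) ^^ l) (abs_brE6 (mon (ewd (eeps d)) 0))"
    using LE6.eeps_idem[OF assms, of "abs_brE6 1"] LE6_act[of "eeps d"] unfolding LE6.F.eqd_def by auto
  then show ?thesis
    unfolding funpow_dl_E6 econg_def by (rule abs_brE6_wcong)
qed

lemma inF4_rev_rdigits: "inF4 (rev (rdigits t))"
proof -
  obtain w where w: "ewd (rdigits t) = phiw w"
    using ewd_rdigits by blast
  have "wcong relE6 (ewd (rev (rdigits t))) (rev (phiw w))"
    using wcong_sym[OF wcong_rev_ewd[of "rdigits t"]] by (simp add: w)
  then show ?thesis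
    unfolding inF4_def using wcong_trans wcong_rev_phiw by blast
qed

lemma inF4_sinv: "inF4 n \<Longrightarrow> sinv (ewd n)"
  using sinv_phiw wcong_wrel wrel_sigma unfolding inF4_def by (metis sinv_sv sinv_def)

lemma wrel_R_rev:
  assumes "set u \<subseteq> {1,2,3,4,5,6}" shows "wrel (ewd (u @ rev u)) = Id"
  using assms
proof (induction u)
  case (Cons n u)
  then have "ewd [n] = [ER (node n)]"
    by (auto simp: ewd_def eletter_word_def)
  moreover have "wrel (ewd ([n] @ (u @ rev u) @ [n])) = wrel (ewd [n]) O wrel (ewd (u @ rev u)) O wrel (ewd [n])"
    by (simp only: ewd_append wrel_append O_assoc)
  moreover have "wrel [ER (node n)] O wrel [ER (node n)] = Id"
    by (auto simp: relcomp_unfold)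
  ultimately show ?case
    using Cons by simp
qed (simp add: ewd_def)

lemma set_rdigits: "set (rdigits t) \<subseteq> {1,2,3,4,5,6}"
  by (auto simp: rdigits_def split: if_splits)

lemma set_C45: "c \<in> set C45 \<Longrightarrow> set c \<subseteq> {1,2,3,4,5,6}"
proof -
  have "\<forall>c\<in>set C45. set c \<subseteq> {1,2,3,4,5,6}"
    by (simp add: C45_def)
  then show "c \<in> set C45 \<Longrightarrow> set c \<subseteq> {1,2,3,4,5,6}"
    by blast
qed

text \<open>Words from the Weyl group of type F4 act invertibly and commute with \<sigma>, so
  multiplying by their inverses removes them without disturbing invariance.\<close>

lemma sinv_cancel:
  assumes "sinv (ewd (rev (rdigits t) @ n @ rdigits t'))" shows "sinv (ewd n)"
proof -
  have "sinv (ewd (rdigits t @ (rev (rdigits t) @ n @ rdigits t') @ rev (rdigits t')))"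
    unfolding ewd_append
    by (intro sinv_append assms[unfolded ewd_append] inF4_sinv inF4_rdigits inF4_rev_rdigits)
  moreover have "wrel (ewd (rdigits t @ (rev (rdigits t) @ n @ rdigits t') @ rev (rdigits t'))) =
      wrel (ewd (rdigits t' @ rev (rdigits t'))) O wrel (ewd n) O wrel (ewd (rdigits t @ rev (rdigits t)))"
    by (simp only: ewd_append wrel_append O_assoc)
  ultimately show ?thesis
    by (simp add: wrel_R_rev[OF set_rdigits] sinv_sv del: ewd_append)
qed

lemma R_word_right:
  assumes "set u \<subseteq> {1,2,3,4,5,6}" shows "\<exists>c\<in>set C45. \<exists>t. u \<simeq> c @ rdigits t"
proof -
  obtain c t where "c \<in> set C45" "LE6.eactn u (abs_brE6 1) = LE6.eactn (c @ rdigits t) (abs_brE6 1)"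
    using LE6.C45_coset[OF assms, of "abs_brE6 1"] by auto
  then show ?thesis
    using econg_left by blast
qed

lemma R_word_left:
  assumes "set u \<subseteq> {1,2,3,4,5,6}" shows "\<exists>c\<in>set C45. \<exists>t. u \<simeq> rev (rdigits t) @ rev c"
proof -
  obtain c t where "c \<in> set C45" "RE6.eactn (rev u) (abs_brE6 1) = RE6.eactn (c @ rdigits t) (abs_brE6 1)"
    using RE6.C45_coset[of "rev u" "abs_brE6 1"] assms by auto
  then show ?thesis
    using econg_right[of "rev u" "c @ rdigits t"] by (auto simp: rev_append)
qed

lemma econg_sinv: "u \<simeq> v \<Longrightarrow> sinv (ewd u) \<longleftrightarrow> sinv (ewd v)"
  unfolding econg_def using wcong_wrel by (simp add: sinv_sv)

text \<open>Reflections fix 0, so the image of 0 under the whole word is that under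
  \<open>n\<close>; the factor \<open>c\<close> on the right disappears.\<close>

lemma sinv_left_ok:
  assumes "sinv (ewd (n @ c))" "set c \<subseteq> {1,2,3,4,5,6}" shows "sv_ok (ewd n) vzero"
proof -
  have "wrel (ewd c) `` {vzero} = {vzero}"
    using assms(2)
  proof (induction c)
    case (Cons m c)
    then have "ewd (m # c) = ER (node m) # ewd c"
      by (auto simp: ewd_def eletter_word_def)
    with Cons show ?case
      by (simp add: relcomp_Image)
  qed (simp add: ewd_def)
  then have "wrel (ewd (n @ c)) `` {vzero} = wrel (ewd n) `` {vzero}"
    by (simp add: wrel_append relcomp_Image)
  moreover have "sv vzero = vzero"
    by (simp add: vzero_def)
  ultimately show ?thesis
    using sinv_Image[OF assms(1), of _ vzero] unfolding sv_ok_def set_img by simp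
qed

text \<open>For two or three roots the images of 0 on either side already force both representatives
  into the lists. For one root the group commuting with the idempotent is large, and for none the
  idempotent is missing: there the representatives must be merged into one coset and tested on a
  further vector.\<close>

lemma sinv_inF4:
  assumes "d \<le> 3" "set u \<subseteq> {1,2,3,4,5,6}" "set v \<subseteq> {1,2,3,4,5,6}" "sinv (ewd (u @ eeps d @ v))"
  shows "inF4 (u @ eeps d @ v)"
proof (cases "d = 0")
  case True
  then have uv: "u @ eeps d @ v = u @ v"
    by (simp add: eeps_def)
  obtain c t where c: "c \<in> set C45" and eq: "u @ v \<simeq> c @ rdigits t"
    using R_word_right[of "u @ v"] assms by auto
  \<comment> \<open>The empty word on the left only gives the expression the shape that
    \<open>sinv_cancel\<close> expects.\<close>
  have "sinv (ewd (rev (rdigits []) @ c @ rdigits t))"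
    using assms(4) econg_sinv[OF eq] uv by (simp add: rdigits_def)
  then have "c = []"
    using C45_sv_ok_0 c sinv_cancel sinv_sv_ok by blast
  then show ?thesis
    using inF4_cong[OF eq] inF4_rdigits uv by simp
next
  case False
  with assms(1) have d: "d \<in> {1,2,3}"
    by auto
  obtain c t where c: "c \<in> set C45" and v: "v \<simeq> c @ rdigits t"
    using R_word_right[OF assms(3)] by blast
  obtain c' t' where c': "c' \<in> set C45" and u: "u \<simeq> rev (rdigits t') @ rev c'"
    using R_word_left[OF assms(2)] by blast
  let ?k = "rev c' @ eeps d @ c"
  have eq: "u @ eeps d @ v \<simeq> rev (rdigits t') @ ?k @ rdigits t"
    using econg_trans econg_append[OF u, of "[]" "eeps d @ v"] econg_append[OF v, of "rev (rdigits t') @ rev c' @ eeps d" "[]"]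
    by fastforce
  then have k: "sinv (ewd ?k)"
    using assms(4) econg_sinv sinv_cancel by blast
  have l: "sv_ok (ewd (rev c' @ eeps d)) vzero"
    using sinv_left_ok[of "rev c' @ eeps d" c] k set_C45[OF c] by simp
  show ?thesis
  proof (cases "d = 1")
    case True
    have c'_set: "set c' \<subseteq> {1,3,4,5,6}"
      using C45_sv_ok_1 c' l True by blast
    \<comment> \<open>The left representative commutes with the idempotent and crosses it, so that
      all Weyl letters stand on one side.\<close>
    have "LE6.eactn (rev c' @ [7]) (abs_brE6 1) = LE6.eactn ([7] @ rev c') (abs_brE6 1)"
      using LE6.T_comm[of "rev c'" "abs_brE6 1"] c'_set by simp
    then have eq1: "rev c' @ [7] \<simeq> [7] @ rev c'"
      by (rule econg_left)
    obtain b s where b: "b \<in> set C45" and v': "rev c' @ c \<simeq> b @ rdigits s"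
      using R_word_right[of "rev c' @ c"] set_C45[OF c] set_C45[OF c'] by auto
    have kb: "?k \<simeq> eeps 1 @ b @ rdigits s"
      using econg_trans econg_append[OF eq1, of "[]" c] econg_append[OF v', of "[7]" "[]"] True
      by (fastforce simp: eeps_def)
    then have "sinv (ewd (rev (rdigits []) @ (eeps 1 @ b) @ rdigits s))"
      using econg_sinv[OF kb] k by (simp add: rdigits_def)
    then have "b = []"
      using C45_sv_ok_1' b sinv_cancel sinv_sv_ok by blast
    moreover have "inF4 [7]"
      unfolding inF4_def by (rule exI[of _ tword]) (simp add: ewd_def eletter_word_def)
    then have "inF4 ([7] @ rdigits s)"
      by (rule inF4_append[OF _ inF4_rdigits])
    then have "inF4 (eeps 1 @ rdigits s)"
      by (simp add: eeps_def)
    ultimately have "inF4 ?k"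
      using inF4_cong[OF kb] by simp
    then show ?thesis
      by (intro inF4_cong[OF eq] inF4_append[OF inF4_rev_rdigits inF4_append[OF _ inF4_rdigits]])
  next
    case False
    with d have d': "d \<in> {2,3}"
      by auto
    \<comment> \<open>Reversal exchanges the two sides, so the test for left representatives also
      applies to \<open>c\<close>.\<close>
    have "rev c @ rev (eeps d) @ c' \<simeq> rev c @ eeps d @ c'"
      using econg_append[OF econg_left, OF LE6.eactn_rev_eeps] assms(1) by blast
    moreover have "sinv (ewd (rev ?k))"
      using sinv_rev[OF k] wcong_wrel[OF wcong_rev_ewd[of ?k]] by (simp add: sinv_sv del: ewd_append)
    ultimately have "sinv (ewd ((rev c @ eeps d) @ c'))"
      using econg_sinv by (simp del: ewd_append)
    then have r: "sv_ok (ewd (rev c @ eeps d)) vzero"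
      using sinv_left_ok set_C45[OF c'] by blast
    have "c \<in> fst ` set (if d = 2 then G2 else G3)" "c' \<in> fst ` set (if d = 2 then G2 else G3)"
      using C45_sv_ok_2 C45_sv_ok_3 c c' l r d' by auto
    then have "inF4 ((rev c' @ eeps d) @ (eeps d @ c))"
      using good_inF4[OF d'] inF4_append by blast
    \<comment> \<open>Doubling the idempotent, at the cost of a power of \<delta>, splits the word
      into two halves that each come from type F4.\<close>
    moreover have "?k \<simeq> (rev c' @ eeps d) @ (eeps d @ c)"
      using econg_sym[OF econg_append[OF econg_eeps_idem[OF d], of "rev c'" c]] by simp
    ultimately have "inF4 ?k"
      using inF4_cong by blast
    then show ?thesis
      by (intro inF4_cong[OF eq] inF4_append[OF inF4_rev_rdigits inF4_append[OF _ inF4_rdigits]])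
  qed
qed

lemma sinv_word_phiw:
  assumes "sinv w" shows "\<exists>v. wcong relE6 w (phiw v)"
proof -
  obtain d u v where *: "d \<le> 3" "set u \<subseteq> {1,2,3,4,5,6}" "set v \<subseteq> {1,2,3,4,5,6}"
    and eq: "wcong relE6 w (ewd (u @ eeps d @ v))"
    using E6_word_factored by blast
  have "sinv (ewd (u @ eeps d @ v))"
    using assms wcong_wrel[OF eq] by (simp add: sinv_sv)
  from sinv_inF4[OF * this] show ?thesis
    using wcong_trans[OF eq] unfolding inF4_def by blast
qed

section \<open>The isomorphism\<close>

lemma phi_gen_mon: "phi_gen g = mon (phi_word g) 0"
proof (cases g)
  case (Fr i)
  then show ?thesis
    by (cases i) (simp_all add: phi_word.simps R_def gen_mon mon_mult)
next
  case (Fe i)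
  then show ?thesis
    by (cases i) (simp_all add: phi_word.simps E_def gen_mon mon_mult)
qed

lemma phi_mon: "phi (mon w k) = mon (phiw w) k"
  unfolding phi_def phiw_def by (rule hom_mon) (rule phi_gen_mon)

lemma phi_mult: "phi (p * q) = phi p * phi q" and phi_diff: "phi (p - q) = phi p - phi q"
  and phi_add: "phi (p + q) = phi p + phi q" and phi_scal: "phi (scal c p) = scal c (phi p)"
  and phi_sum: "phi (\<Sum>i\<in>A. P i) = (\<Sum>i\<in>A. phi (P i))"
  by (simp_all add: phi_def hom_mult) (simp_all add: hom_lin lin_diff lin_add lin_scal lin_sum)

lemma phi_1: "phi 1 = 1"
  using phi_mon[of "[]" 0] by (simp add: mon_Nil phiw_def)

lemma phi_dl: "phi dl = dl"
  by (simp add: dl_def phi_scal phi_1)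

lemma lmulE6_mon: "lmulE6 (mon w 0) x = act (\<lambda>g. lmulE6 (gen g)) w x"
  by (induction w) (simp_all add: mon_Nil mon_Cons mulE6_mult)

lemma lmulE6_phi: "lmulE6 (phi (gen g)) x = act (\<lambda>g. lmulE6 (gen g)) (phi_word g) x"
  by (simp add: gen_mon[of g] phi_mon phiw_def lmulE6_mon)

text \<open>Relations are compared by applying them to the class of 1, where the identities of the
  sublocale \<open>LE6.F\<close> decide equality modulo the ideal.\<close>

lemma relF4_phi:
  assumes "s \<in> relF4" shows "phi s \<in> IE6"
proof -
  have main: "phi (a - b) \<in> IE6" if "lmulE6 (phi a) (abs_brE6 1) = lmulE6 (phi b) (abs_brE6 1)" for a b
    using that by (simp add: mulE6_abs phi_diff brE6.abs_eq_iff)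
  note [simp] = phi_mult phi_1 phi_dl mulE6_mult lmulE6_phi r_def e_def
    and F = LE6.F.rr LE6.F.re LE6.F.er LE6.F.ee_long LE6.F.ee_short
  show ?thesis
    using assms unfolding relF4_def
  proof (elim UnE, goal_cases)
    case 1
    then show ?case by (auto intro!: main simp: F simp del: LE6.F_gens)
  next
    case 2
    then show ?case by (auto intro!: main simp: F)
  next
    case 3
    then show ?case by (auto intro!: main simp: F)
  next
    case 4
    then show ?case by (auto intro!: main simp: F)
  next
    case 5
    then show ?case by (auto intro!: main simp: F)
  next
    case 6
    then obtain i j where ij: "(i, j) \<in> {(f1,f3),(f3,f1),(f1,f4),(f4,f1),(f2,f4),(f4,f2)}"
      and s: "s \<in> {r i * r j - r j * r i, e i * r j - r j * e i, e i * e j - e j * e i}"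
      by blast
    from s show ?case
      using LE6.F.comm[OF ij] by (elim insertE emptyE; hypsubst) (intro main; simp)+
  next
    case 7
    then obtain i j where ij: "(i, j) \<in> {(f1,f2),(f2,f1),(f3,f4),(f4,f3)}"
      and s: "s \<in> {r i * r j * r i - r j * r i * r j, r j * r i * e j - e i * e j, r i * e j * r i - r j * e i * r j}"
      by blast
    from s show ?case
      using LE6.F.braid[OF ij] by (elim insertE emptyE; hypsubst) (intro main; simp)+
  next
    case 8
    then show ?case
      by (elim insertE emptyE; hypsubst) (intro main; simp only: phi_mult phi_dl mulE6_mult lmulE6_phi r_def e_def;
        rule LE6.F.r2323 LE6.F.r23e2 LE6.F.r2e3r2e3 LE6.F.r232e3 LE6.F.e2r3e2 LE6.F.e2e3e2 LE6.F.e2r32 LE6.F.e2e3r2)+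
  qed
qed

lemma phi_IF4: "x \<in> IF4 \<Longrightarrow> phi x \<in> IE6"
  unfolding IF4_def IE6_def phi_def
  by (rule hom_ideal_gen[of relF4]) (use relF4_phi in \<open>simp_all add: phi_def IE6_def\<close>)

lemma wcong_phiw: "wcong relF4 u v \<Longrightarrow> wcong relE6 (phiw u) (phiw v)"
  unfolding wcong_def IF4_def[symmetric] IE6_def[symmetric]
  using phi_IF4 by (fastforce simp: phi_diff phi_mon)

section \<open>Correspondences of the normal forms\<close>

definition gam :: "nat list \<Rightarrow> (vec \<times> vec) set" where
  "gam n = wrel (phiw (wd n))"

lemma gam_append: "gam (u @ v) = gam v O gam u"
  by (simp add: gam_def wrel_append)

lemma gam_cong: "u \<approx> v \<Longrightarrow> gam u = gam v"
  unfolding gam_def ncong_def by (rule wcong_wrel[OF wcong_phiw])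

lemma gam_rev: "gam (rev u) = (gam u)\<inverse>"
  unfolding gam_def wd_rev wrel_rev[symmetric] by (rule wcong_wrel[OF wcong_sym[OF wcong_rev_phiw]])

lemma set_img_gam: "set (img (phiw (wd n)) L) = gam n `` set L"
  by (simp add: gam_def set_img)

text \<open>The reversed word serves as a one-sided inverse of a left representative next to the
  idempotent, even where the representative contains \<open>t\<close> and is not invertible.\<close>

lemma (in brauer_F4) eps_rev_lreps:
  assumes "d \<in> {1,2,3}" "b \<in> set (lreps d)"
  shows "actn (eps d) (actn (rev b) (actn b (actn (eps d) x))) \<sim> actn (eps d) x"
proof -
  have "\<forall>b\<in>set A1. t (actn (rev b) (actn b (t x))) \<sim> t x" "\<forall>b\<in>set A2. e1 (actn (rev b) (actn b (e1 x))) \<sim> e1 x"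
    "\<forall>b\<in>set A3. e1 (t (actn (rev b) (actn b (e1 (t x))))) \<sim> e1 (t x)"
    by (simp_all add: A1_def W24_def A2_def A3_def)
  then show ?thesis
    using assms by (auto simp: lreps_def eps_def)
qed

lemma (in brauer_F4) actn_r_rev: "set u \<subseteq> {1,2,3,4} \<Longrightarrow> actn (rev u) (actn u x) = x"
  by (induction u) auto

lemma eps_rev_lreps:
  assumes "d \<in> {1,2,3}" "b \<in> set (lreps d)" shows "eps d @ rev b @ b @ eps d \<approx> eps d"
  using LF4.eps_rev_lreps[OF assms, of "abs_brF4 1"] by (intro ncong_left) simp

lemma stab_comm:
  assumes "d \<in> {1,2,3}" "h \<in> set (stab d)" shows "h @ eps d \<approx> eps d @ h"
  using LF4.stab_comm[OF assms, of "abs_brF4 1"] by (intro ncong_left) simp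

lemma r_rev: "set u \<subseteq> {1,2,3,4} \<Longrightarrow> rev u @ u \<approx> []"
  using LF4.actn_r_rev[of u "abs_brF4 1"] by (intro ncong_left) simp

fun enc :: "vec \<Rightarrow> nat" where
  "enc (Vec a b c d k l) = (if a then 1 else 0) + (if b then 2 else 0) + (if c then 4 else 0)
     + (if d then 8 else 0) + (if k then 16 else 0) + (if l then 32 else 0)"

text \<open>A canonical encoding of a finite set of vectors, so that distinctness of images becomes
  distinctness of lists of numbers and can be evaluated.\<close>

definition key :: "vec list \<Rightarrow> nat list" where
  "key L = sort (remdups (map enc L))"

lemma key_cong: "set L = set M \<Longrightarrow> key L = key M"
  by (simp add: key_def flip: sorted_list_of_set_sort_remdups)

text \<open>The image of 0 attached to a stratum. Stratum 0 is separated because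
  \<open>eps 0\<close> falls into the default case of \<open>eps\<close>.\<close>

definition space :: "nat \<Rightarrow> vec list" where
  "space d = (if d = 0 then [vzero] else img (phiw (wd (eps d))) [vzero])"

text \<open>The space of a word of a stratum recovers its left representative.\<close>

definition slots :: "(nat \<times> nat list) list" where
  "slots = (0, []) # map (Pair 1) A1 @ map (Pair 2) A2 @ map (Pair 3) A3"

lemma slots_keys: "distinct (map (\<lambda>(d, b). key (img (phiw (wd b)) (space d))) slots)"
  by code_simp

text \<open>Whatever the right representative, the subspace has reached its standard position after
  the idempotent; so the image of 0 depends only on the left representative.\<close>

lemma lreps_space:
  "\<forall>d\<in>{1,2,3}. \<forall>b\<in>set (lreps d). set (img (phiw (wd (eps d @ rev b))) [vzero]) = set (space d)"
  by code_simp

lemma stab_space: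
  "\<forall>d\<in>{1,2,3}. \<forall>h\<in>set (stab d). set (img (phiw (wd h)) (space d)) = set (space d)
     \<and> set (img (phiw (wd (rev h))) (space d)) = set (space d)"
  by code_simp

text \<open>Modulo 2 the group of the \<open>A\<^sub>5\<close> spanned by the nodes \<open>1, 3, 4, 5, 6\<close> permutes these six vectors, which sum to the
  highest root.\<close>

definition singles :: "vec list" where
  "singles = [Vec True True False False False False, Vec False True True False False False,
     Vec True True True False False False, Vec True True False True False False,
     Vec True True False True True False, Vec True True False True True True]"

text \<open>Stability under \<open>C48\<close> makes the image of this set an invariant of a left
  coset; \<open>singles_W24\<close> shows that it separates the cosets.\<close>

lemma singles_C48: "\<forall>h\<in>set C48. set (img (phiw (wd h)) singles) = set singles"
  by code_simp

lemma singles_W24: "distinct (map (\<lambda>b. key (img (phiw (wd b)) singles)) W24)"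
  by code_simp

text \<open>Two test vectors suffice. As the group elements commute with \<sigma>, the images of
  \<alpha>1 and \<alpha>3 also determine those of \<alpha>6 and \<alpha>5.\<close>

lemma stab_keys_1: "distinct (map (\<lambda>h. map (\<lambda>x. key (img (phiw (wd (h @ eps 1))) [x])) [root n1, root n3]) C48)"
  by code_simp

lemma stab_keys_2: "distinct (map (\<lambda>h. map (\<lambda>x. key (img (phiw (wd (h @ eps 2))) [x])) [root n2, root n4]) S6)"
  by code_simp

definition ix :: "(nat \<times> nat list \<times> nat list \<times> nat list) set" where
  "ix = {0} \<times> set W24 \<times> set C48 \<times> {[]} \<union> (\<Union>d\<in>{1,2,3}. {d} \<times> set (lreps d) \<times> set (stab d) \<times> set (lreps d))"

fun nw :: "nat \<times> nat list \<times> nat list \<times> nat list \<Rightarrow> nat list" where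
  "nw (d, b, h, b') = (if d = 0 then b @ h else b @ h @ eps d @ rev b')"

lemma card_ix: "card ix = 14985"
proof -
  have "distinct W24" "distinct C48" "distinct A1" "distinct A2" "distinct A3" "distinct S6"
    by code_simp+
  note [simp] = this[THEN distinct_card]
  have [simp]: "length W24 = 24" "length C48 = 48" "length A1 = 12" "length A2 = 30" "length A3 = 39" "length S6 = 6"
    by (simp_all add: W24_def C48_def A1_def A2_def A3_def S6_def)
  have "card (\<Union>d\<in>{1,2,3::nat}. {d} \<times> set (lreps d) \<times> set (stab d) \<times> set (lreps d))
      = (\<Sum>d\<in>{1,2,3}. card ({d} \<times> set (lreps d) \<times> set (stab d) \<times> set (lreps d)))"
    by (intro card_UN_disjoint) auto
  also have "\<dots> = 12 * 48 * 12 + 30 * 6 * 30 + 39 * 39"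
    by (simp add: card_cartesian_product lreps_def stab_def)
  finally have "card (\<Union>d\<in>{1,2,3::nat}. {d} \<times> set (lreps d) \<times> set (stab d) \<times> set (lreps d)) = 13833"
    by simp
  moreover have "card ({0::nat} \<times> set W24 \<times> set C48 \<times> {[] :: nat list}) = 1152"
    by (simp add: card_cartesian_product)
  ultimately show ?thesis
    unfolding ix_def by (subst card_Un_disjoint) auto
qed

lemma finite_ix: "finite ix"
  using card_ix by (rule_tac card_ge_0_finite) simp

lemma nf_nw: "n \<in> nf0 \<union> nf 1 \<union> nf 2 \<union> nf 3 \<Longrightarrow> n \<in> nw ` ix"
proof -
  have "nf0 \<subseteq> nw ` ix"
    unfolding nf0_def ix_def by (auto simp: image_iff intro!: bexI[of _ "(0, _, _, [])"])
  moreover have "nf d \<subseteq> nw ` ix" if "d \<in> {1,2,3}" for d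
  proof
    fix n assume "n \<in> nf d"
    then obtain b h b' where "n = b @ h @ eps d @ rev b'" "b \<in> set (lreps d)" "h \<in> set (stab d)" "b' \<in> set (lreps d)"
      unfolding nf_def by blast
    then have "n = nw (d, b, h, b')" "(d, b, h, b') \<in> ix"
      using that unfolding ix_def by auto
    then show "n \<in> nw ` ix"
      by blast
  qed
  ultimately show "n \<in> nf0 \<union> nf 1 \<union> nf 2 \<union> nf 3 \<Longrightarrow> n \<in> nw ` ix"
    by blast
qed

lemma gam_eps_lreps:
  assumes "d \<in> {1,2,3}" "b \<in> set (lreps d)" shows "gam (eps d) `` (gam (rev b) `` {vzero}) = set (space d)"
proof -
  have "set (img (phiw (wd (eps d @ rev b))) [vzero]) = set (space d)"
    using lreps_space assms by blast
  then show ?thesis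
    unfolding set_img_gam gam_append by (simp add: relcomp_Image)
qed

lemma gam_stab_space:
  assumes "d \<in> {1,2,3}" "h \<in> set (stab d)" shows "gam h `` set (space d) = set (space d)" "gam (rev h) `` set (space d) = set (space d)"
  using stab_space assms unfolding set_img_gam by blast+

lemma slots_inj:
  assumes "(d, b) \<in> set slots" "(d', b') \<in> set slots" "gam b `` set (space d) = gam b' `` set (space d')"
  shows "(d, b) = (d', b')"
proof -
  have "key (img (phiw (wd b)) (space d)) = key (img (phiw (wd b')) (space d'))"
    using assms(3) by (intro key_cong) (simp add: set_img_gam)
  moreover have "inj_on (\<lambda>(d, b). key (img (phiw (wd b)) (space d))) (set slots)"
    using slots_keys by (simp add: distinct_map)
  ultimately show ?thesis
    using assms(1,2) by (elim inj_onD) simp_all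
qed

lemma slots_mem: "(d, b) \<in> set slots \<longleftrightarrow> d = 0 \<and> b = [] \<or> d \<in> {1,2,3} \<and> b \<in> set (lreps d)"
  by (auto simp: slots_def lreps_def)

text \<open>The image of 0 recovers the left representative, and the image of 0 under the converse
  the right one; the group element preserves the standard subspace and does not interfere.\<close>

lemma gam_nw_left:
  assumes "d \<in> {1,2,3}" "b \<in> set (lreps d)" "h \<in> set (stab d)" "b' \<in> set (lreps d)"
  shows "gam (nw (d, b, h, b')) `` {vzero} = gam b `` set (space d)"
    "gam (rev (nw (d, b, h, b'))) `` {vzero} = gam b' `` set (space d)"
proof -
  have d: "d \<noteq> 0"
    using assms(1) by auto
  show "gam (nw (d, b, h, b')) `` {vzero} = gam b `` set (space d)"
    using gam_eps_lreps[OF assms(1,4)] gam_stab_space[OF assms(1,3)] d by (simp add: gam_append relcomp_Image)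
  have "h @ eps d \<approx> rev (eps d) @ h"
    using ncong_trans[OF stab_comm[OF assms(1,3)] ncong_append[OF ncong_sym[OF rev_eps], of "[]" d h, simplified]] .
  from ncong_append[OF this, of b "rev b'"] have "gam (nw (d, b, h, b')) = gam (b @ rev (eps d) @ h @ rev b')"
    using d by (intro gam_cong) simp
  then have "gam (rev (nw (d, b, h, b'))) = gam (b' @ rev h @ eps d @ rev b)"
    unfolding gam_rev[of "nw _"] by (simp flip: gam_rev)
  then show "gam (rev (nw (d, b, h, b'))) `` {vzero} = gam b' `` set (space d)"
    using gam_eps_lreps[OF assms(1,2)] gam_stab_space[OF assms(1,3)] by (simp add: gam_append relcomp_Image)
qed

lemma gam_r_zero:
  assumes "set u \<subseteq> {1,2,3,4}" shows "gam u `` {vzero} = {vzero}"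
proof -
  have "\<forall>n\<in>{1,2,3,4}. set (img (phiw (wd [n])) [vzero]) = set [vzero]"
    by code_simp
  then have "gam [n] `` {vzero} = {vzero}" if "n \<in> {1,2,3,4}" for n
    using that unfolding set_img_gam by auto
  with assms show ?thesis
  proof (induction u)
    case Nil
    show ?case by (simp add: gam_def wd_def phiw_def)
  next
    case (Cons n u)
    then show ?case
      using gam_append[of "[n]" u] by (simp add: relcomp_Image)
  qed
qed

lemma W24_letters: "b \<in> set W24 \<Longrightarrow> set b \<subseteq> {1,2,3,4}" and C48_letters: "h \<in> set C48 \<Longrightarrow> set h \<subseteq> {1,2,3,4}"
proof -
  have "\<forall>b\<in>set W24. set b \<subseteq> {1,2,3,4}" "\<forall>h\<in>set C48. set h \<subseteq> {1,2,3,4}"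
    by code_simp+
  then show "b \<in> set W24 \<Longrightarrow> set b \<subseteq> {1,2,3,4}" "h \<in> set C48 \<Longrightarrow> set h \<subseteq> {1,2,3,4}"
    by blast+
qed

text \<open>Once both outer representatives are known, multiplication by their reversals isolates
  the group element, still attached to the idempotent.\<close>

lemma gam_middle:
  assumes "d \<in> {1,2,3}" "b \<in> set (lreps d)" "h \<in> set (stab d)" "b' \<in> set (lreps d)"
  shows "gam (eps d @ rev b @ nw (d, b, h, b') @ b' @ eps d) = gam (h @ eps d)"
proof (rule gam_cong)
  have d: "d \<noteq> 0"
    using assms(1) by auto
  have idem: "eps d @ eps d \<approx> eps d"
    using eps_rev_lreps[OF assms(1) LF4.lreps_Nil] by simp
  have "eps d @ rev b @ nw (d, b, h, b') @ b' @ eps d = (eps d @ rev b @ b @ h) @ (eps d @ rev b' @ b' @ eps d) @ []"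
    using d by simp
  also have "\<dots> \<approx> (eps d @ rev b @ b @ h) @ eps d @ []"
    by (rule ncong_append[OF eps_rev_lreps[OF assms(1,4)]])
  also have "(eps d @ rev b @ b @ h) @ eps d @ [] = (eps d @ rev b @ b) @ (h @ eps d) @ []"
    by simp
  also have "\<dots> \<approx> (eps d @ rev b @ b) @ (eps d @ h) @ []"
    by (rule ncong_append[OF stab_comm[OF assms(1,3)]])
  also have "(eps d @ rev b @ b) @ (eps d @ h) @ [] = [] @ (eps d @ rev b @ b @ eps d) @ h"
    by simp
  also have "\<dots> \<approx> [] @ eps d @ h"
    by (rule ncong_append[OF eps_rev_lreps[OF assms(1,2)]])
  also have "[] @ eps d @ h \<approx> h @ eps d"
    using ncong_sym[OF stab_comm[OF assms(1,3)]] by simp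
  finally show "eps d @ rev b @ nw (d, b, h, b') @ b' @ eps d \<approx> h @ eps d" .
qed

lemma stab_inj:
  assumes "d \<in> {1,2,3}" "h \<in> set (stab d)" "h' \<in> set (stab d)" "gam (h @ eps d) = gam (h' @ eps d)"
  shows "h = h'"
proof -
  have "key (img (phiw (wd (h @ eps d))) [x]) = key (img (phiw (wd (h' @ eps d))) [x])" for x
    by (intro key_cong) (simp only: set_img_gam assms(4))
  moreover have "inj_on (\<lambda>h. map (\<lambda>x. key (img (phiw (wd (h @ eps 1))) [x])) [root n1, root n3]) (set C48)"
    "inj_on (\<lambda>h. map (\<lambda>x. key (img (phiw (wd (h @ eps 2))) [x])) [root n2, root n4]) (set S6)"
    using stab_keys_1 stab_keys_2 unfolding distinct_map by blast+
  ultimately show ?thesis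
    using assms(1-3) by (auto simp: stab_def dest: inj_onD split: if_splits)
qed

text \<open>The image of 0 yields the stratum and, below the group, the left representative; the
  converse yields the right one, and \<open>gam_middle\<close> the group element. In stratum 0 the
  image of 0 carries no information, so \<open>singles\<close> identifies the coset and inversion
  isolates the rest.\<close>

lemma gam_inj: "inj_on (\<lambda>i. gam (nw i)) ix"
proof (rule inj_onI)
  fix i j assume ij: "i \<in> ix" "j \<in> ix" and eq: "gam (nw i) = gam (nw j)"
  obtain d b h c where i: "i = (d, b, h, c)"
    by (cases i)
  obtain d' b' h' c' where j: "j = (d', b', h', c')"
    by (cases j)
  have slot: "gam (nw (d, b, h, c)) `` {vzero} = gam (if d = 0 then [] else b) `` set (space d)"
    "(d, if d = 0 then [] else b) \<in> set slots" if "(d, b, h, c) \<in> ix" for d b h c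
  proof -
    have nil: "gam [] = Id"
      by (simp add: gam_def wd_def phiw_def)
    show "gam (nw (d, b, h, c)) `` {vzero} = gam (if d = 0 then [] else b) `` set (space d)"
    proof (cases "d = 0")
      case True
      with that have "set (b @ h) \<subseteq> {1,2,3,4}"
        using W24_letters C48_letters by (auto simp: ix_def)
      then show ?thesis
        using True gam_r_zero[of "b @ h"] by (simp add: nil space_def)
    next
      case False
      with that show ?thesis
        using gam_nw_left(1)[of d b h c] by (auto simp: ix_def)
    qed
    show "(d, if d = 0 then [] else b) \<in> set slots"
      using that by (auto simp: ix_def slots_mem)
  qed
  have "(d, if d = 0 then [] else b) = (d', if d' = 0 then [] else b')"
    using slots_inj[OF slot(2) slot(2)] ij eq slot(1) unfolding i j by metis
  then have d': "d' = d" and b: "d \<noteq> 0 \<Longrightarrow> b' = b"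
    by (auto split: if_splits)
  show "i = j"
  proof (cases "d = 0")
    case True
    then have mem: "b \<in> set W24" "h \<in> set C48" "c = []" "b' \<in> set W24" "h' \<in> set C48" "c' = []"
      using ij unfolding i j d' ix_def by auto
    have eq': "gam (b @ h) = gam (b' @ h')"
      using eq True by (simp add: i j d')
    have "gam (b @ h) `` set singles = gam b `` set singles" if "h \<in> set C48" for b h
      using singles_C48 that unfolding set_img_gam by (simp add: gam_append relcomp_Image)
    then have "gam b `` set singles = gam b' `` set singles"
      using eq' mem by metis
    then have "key (img (phiw (wd b)) singles) = key (img (phiw (wd b')) singles)"
      by (intro key_cong) (simp add: set_img_gam)
    then have "b = b'"
      using singles_W24 mem unfolding distinct_map by (auto dest: inj_onD)
    have "gam (rev b @ (b @ h)) = gam h" for h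
      using gam_cong[OF ncong_append[OF r_rev[OF W24_letters[OF mem(1)]], of "[]" h]] by simp
    then have "gam h = gam h'"
      using eq' \<open>b = b'\<close> by (metis gam_append)
    then have "gam (h @ eps 1) = gam (h' @ eps 1)"
      by (simp add: gam_append)
    then have "h = h'"
      using stab_inj[of 1 h h'] mem by (simp add: stab_def)
    then show ?thesis
      using mem \<open>b = b'\<close> by (simp add: i j d')
  next
    case False
    then have d: "d \<in> {1,2,3}" and mem: "b \<in> set (lreps d)" "h \<in> set (stab d)" "c \<in> set (lreps d)"
      "h' \<in> set (stab d)" "c' \<in> set (lreps d)"
      using ij unfolding i j d' ix_def by auto
    have eq': "gam (nw (d, b, h, c)) = gam (nw (d, b, h', c'))"
      using eq b[OF False] by (simp only: i j d')
    then have "gam (rev (nw (d, b, h, c))) = gam (rev (nw (d, b, h', c')))"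
      by (simp only: gam_rev)
    then have "gam c `` set (space d) = gam c' `` set (space d)"
      using gam_nw_left(2)[OF d mem(1) mem(2,3)] gam_nw_left(2)[OF d mem(1) mem(4,5)] by simp
    then have "c = c'"
      using slots_inj[of d c d c'] d mem slots_mem by blast
    have "gam (h @ eps d) = gam (h' @ eps d)"
      using gam_middle[OF d mem(1) mem(2,3)] gam_middle[OF d mem(1) mem(4,5)] eq' \<open>c = c'\<close>
      by (metis gam_append)
    then have "h = h'"
      using stab_inj[OF d] mem by blast
    then show ?thesis
      using b[OF False] \<open>c = c'\<close> by (simp add: i j d')
  qed
qed

section \<open>The image of \<phi>, spanning and independence\<close>

lemma phi_SBrE6: "phi x \<in> SBrE6"
proof -
  have gen: "phi_gen g \<in> SBrE6" for g
  proof -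
    \<comment> \<open>The automorphism reverses the word of a generator, and its letters commute
      modulo the ideal.\<close>
    have "abs_brE6 (mon (rev (phi_word g)) 0) = abs_brE6 (mon (phi_word g) 0)"
      using LE6.act_rev_phi_word[of g "abs_brE6 (mon [] 0)"] by (simp only: act_lmulE6 append_Nil2)
    moreover have "sigma (mon w 0) = mon (map sigma_gen w) 0" for w
      unfolding sigma_def using hom_mon[of "\<lambda>x. gen (sigma_gen x)" "\<lambda>x. [sigma_gen x]" w 0] by (simp add: gen_mon)
    ultimately have "sigma (phi_gen g) - phi_gen g \<in> IE6"
      by (simp add: phi_gen_mon sigma_phi_word brE6.abs_eq_iff)
    moreover have "phi_gen g \<in> monomials"
      unfolding phi_gen_mon monomials_def mon_def by blast
    ultimately show ?thesis
      unfolding SBrE6_def by (intro subalg_gen.base_in) simp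
  qed
  have "prod_list (map phi_gen w) \<in> SBrE6" for w
    by (induction w) (use gen in \<open>auto simp: SBrE6_def intro: subalg_gen.one_in subalg_gen.mult_in\<close>)
  then have "scal c (prod_list (map phi_gen w)) \<in> SBrE6" for c w
    unfolding SBrE6_def by (blast intro: subalg_gen.scal_in)
  moreover have "0 \<in> SBrE6"
    unfolding SBrE6_def using subalg_gen.scal_in[OF subalg_gen.one_in, of 0] by simp
  then have sum: "(\<Sum>w\<in>A. f w) \<in> SBrE6" if "\<And>w. f w \<in> SBrE6" for A :: "F4gen word set" and f
    using that by (induction A rule: infinite_finite_induct) (auto simp: SBrE6_def intro: subalg_gen.add_in)
  ultimately show ?thesis
    unfolding phi_def hom_def by (intro sum)
qed

text \<open>An invariant monomial is proportional to the image of a word, and the power of \<delta>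
  can be absorbed into the preimage. All other cases say that the image is a subalgebra.\<close>

lemma SBrE6_phi:
  assumes "y \<in> SBrE6" shows "\<exists>x. phi x - y \<in> IE6"
  using assms unfolding SBrE6_def
proof induction
  case one_in
  show ?case
    by (rule exI[of _ 1]) (simp add: phi_1 IE6_def ideal_gen.zero_in)
next
  case (base_in m)
  then obtain W k where "m = Poly_Mapping.single W (dpow k)" and s: "sigma m - m \<in> IE6"
    unfolding monomials_def by blast
  then obtain w where m: "m = mon w k"
    unfolding mon_def by (metis word.exhaust)
  have "sigma (mon w k) = mon (map sigma_gen w) k"
    unfolding sigma_def using hom_mon[of "\<lambda>x. gen (sigma_gen x)" "\<lambda>x. [sigma_gen x]" w k] by (simp add: gen_mon)
  then have "sinv w"
    using IE6_wrel s unfolding m sinv_def by metis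
  then obtain v where "wcong relE6 w (phiw v)"
    using sinv_word_phiw by blast
  then obtain l where "mon w k - mon (phiw v) l \<in> IE6"
    unfolding IE6_def using wcong_mon by blast
  from ideal_gen.neg_in[OF this[unfolded IE6_def]] show ?case
    by (intro exI[of _ "mon v l"]) (simp add: m phi_mon IE6_def)
next
  case (add_in y z)
  then obtain a b where "phi a - y \<in> IE6" "phi b - z \<in> IE6"
    by blast
  then have "(phi a - y) + (phi b - z) \<in> IE6"
    unfolding IE6_def by (rule ideal_gen.add_in)
  then show ?case
    by (intro exI[of _ "a + b"]) (simp add: phi_add algebra_simps)
next
  case (scal_in y c)
  then obtain a where "phi a - y \<in> IE6"
    by blast
  then have "scal c (phi a - y) \<in> IE6"
    unfolding IE6_def by (rule ideal_gen_scal)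
  then show ?case
    by (intro exI[of _ "scal c a"]) (simp add: phi_scal scal_diff)
next
  case (mult_in y z)
  then obtain a b where "phi a - y \<in> IE6" "phi b - z \<in> IE6"
    by blast
  then have "phi a * (phi b - z) + (phi a - y) * z \<in> IE6"
    unfolding IE6_def by (intro ideal_gen.add_in ideal_gen_mult)
  then show ?case
    by (intro exI[of _ "a * b"]) (simp add: phi_mult algebra_simps)
qed

lemma F4_spanning:
  fixes N :: nat
  assumes "bij_betw p {..<N} ix"
  shows "\<exists>c. x - (\<Sum>i<N. scal (c i) (mon (wd (nw (p i))) 0)) \<in> IF4"
proof -
  let ?b = "\<lambda>i. mon (wd (nw (p i))) 0"
  define Z where "Z = {x. \<exists>c. x - (\<Sum>i<N. scal (c i) (?b i)) \<in> IF4}"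
  have zero: "0 \<in> Z"
    unfolding Z_def by (intro CollectI exI[of _ "\<lambda>_. 0"]) (simp add: IF4_def ideal_gen.zero_in)
  have add: "x + y \<in> Z" if "x \<in> Z" "y \<in> Z" for x y
  proof -
    obtain c c' where "x - (\<Sum>i<N. scal (c i) (?b i)) \<in> IF4" "y - (\<Sum>i<N. scal (c' i) (?b i)) \<in> IF4"
      using \<open>x \<in> Z\<close> \<open>y \<in> Z\<close> unfolding Z_def by blast
    then have "(x - (\<Sum>i<N. scal (c i) (?b i))) + (y - (\<Sum>i<N. scal (c' i) (?b i))) \<in> IF4"
      unfolding IF4_def by (rule ideal_gen.add_in)
    then have "x + y - (\<Sum>i<N. scal (c i + c' i) (?b i)) \<in> IF4"
      by (simp add: scal_add_left sum.distrib algebra_simps)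
    then show ?thesis
      unfolding Z_def by (intro CollectI exI[of _ "\<lambda>i. c i + c' i"])
  qed
  have scal: "scal a x \<in> Z" if "x \<in> Z" for a x
  proof -
    obtain c where "x - (\<Sum>i<N. scal (c i) (?b i)) \<in> IF4"
      using \<open>x \<in> Z\<close> unfolding Z_def by blast
    then have "scal a (x - (\<Sum>i<N. scal (c i) (?b i))) \<in> IF4"
      unfolding IF4_def by (rule ideal_gen_scal)
    then have "scal a x - (\<Sum>i<N. scal (a * c i) (?b i)) \<in> IF4"
      by (simp add: scal_diff scal_sum)
    then show ?thesis
      unfolding Z_def by (intro CollectI exI[of _ "\<lambda>i. a * c i"])
  qed
  have word: "mon w 0 \<in> Z" for w
  proof -
    obtain n where "n \<in> nf0 \<union> nf 1 \<union> nf 2 \<union> nf 3" "wcong relF4 w (wd n)"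
      using F4_word_normal_form by blast
    moreover from this nf_nw obtain i where "i \<in> ix" "n = nw i"
      by blast
    moreover from this assms obtain j where j: "j < N" "i = p j"
      unfolding bij_betw_def by (metis imageE lessThan_iff)
    ultimately obtain k where "mon w 0 - mon (wd (nw (p j))) k \<in> IF4"
      unfolding wcong_def IF4_def by blast
    moreover have "(\<Sum>i<N. scal (if i = j then dpow k else 0) (?b i)) = (\<Sum>i<N. if i = j then scal (dpow k) (?b j) else 0)"
      by (intro sum.cong) auto
    then have "(\<Sum>i<N. scal (if i = j then dpow k else 0) (?b i)) = mon (wd (nw (p j))) k"
      using j by (subst (asm) sum.delta) (simp_all add: scal_mon)
    ultimately show ?thesis
      unfolding Z_def by (intro CollectI exI[of _ "\<lambda>i. if i = j then dpow k else 0"]) simp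
  qed
  have "(\<Sum>w\<in>A. f w) \<in> Z" if "\<And>w. f w \<in> Z" for A :: "F4gen word set" and f
    using that by (induction A rule: infinite_finite_induct) (auto simp: zero add)
  from this[OF scal[OF word]] have "x \<in> Z"
    by (subst falg_mon_expand)
  then show ?thesis
    unfolding Z_def by blast
qed

text \<open>Distinct correspondences let the functional of the \<open>j\<close>-th one select a
  single term, whose coefficient is multiplied by the unit \<delta>^k. As the hypothesis lives in
  type E6, the lemma serves both injectivity and freeness.\<close>

lemma F4_independent:
  fixes N :: nat
  assumes "bij_betw p {..<N} ix" "phi (\<Sum>i<N. scal (c i) (mon (wd (nw (p i))) 0)) \<in> IE6" "j < N"
  shows "c j = 0"
proof -
  let ?F = "\<lambda>i. gam (nw (p i))"
  let ?k = "wexp (phiw (wd (nw (p j)))) {vzero}"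
  have inj: "?F i = ?F j \<longleftrightarrow> i = j" if "i < N" for i
    using assms(1,3) that gam_inj unfolding bij_betw_def inj_on_def by (metis imageI lessThan_iff)
  have "0 = coef (?F j) (phi (\<Sum>i<N. scal (c i) (mon (wd (nw (p i))) 0)))"
    using coef_IE6[OF assms(2)] by simp
  also have "\<dots> = (\<Sum>i<N. scal (c i) (coef (?F j) (mon (phiw (wd (nw (p i)))) 0)))"
    by (simp add: phi_sum phi_scal phi_mon coef_def lin_sum lin_scal)
  also have "\<dots> = (\<Sum>i<N. if i = j then scal (c j * dpow ?k) 1 else 0)"
    by (intro sum.cong) (auto simp: coef_mon inj simp flip: gam_def)
  also have "\<dots> = scal (c j * dpow ?k) (1 :: E6gen falg)"
    using assms(3) by (subst sum.delta) simp_all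
  finally have "scal (c j * dpow ?k) (1 :: E6gen falg) = 0"
    by simp
  then have "c j * dpow ?k = 0"
    unfolding scal_def by (metis lookup_single_eq lookup_zero mult_1_right)
  then have "c j * dpow ?k * dpow (- ?k) = 0"
    by simp
  then show ?thesis
    by (simp add: mult.assoc flip: dpow_add)
qed

theorem theorem1p2:
  shows "(\<forall>x \<in> IF4. phi x \<in> IE6)
       \<and> (\<forall>x. phi x \<in> IE6 \<longrightarrow> x \<in> IF4)
       \<and> (\<forall>x. \<exists>y \<in> SBrE6. phi x - y \<in> IE6)
       \<and> (\<forall>y \<in> SBrE6. \<exists>x. phi x - y \<in> IE6)
       \<and> (\<exists>b :: nat \<Rightarrow> F4gen falg.
            (\<forall>x. \<exists>c :: nat \<Rightarrow> laurent. x - (\<Sum>i<14985. scal (c i) (b i)) \<in> IF4)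
          \<and> (\<forall>c :: nat \<Rightarrow> laurent. (\<Sum>i<14985. scal (c i) (b i)) \<in> IF4 \<longrightarrow> (\<forall>i<14985. c i = 0)))"
proof (intro conjI)
  obtain p where p: "bij_betw p {..<14985::nat} ix"
    using ex_bij_betw_nat_finite[OF finite_ix] unfolding card_ix atLeast0LessThan by blast
  show "\<forall>x\<in>IF4. phi x \<in> IE6"
    using phi_IF4 by blast
  show "\<forall>x. phi x \<in> IE6 \<longrightarrow> x \<in> IF4"
  proof (intro allI impI)
    fix x assume x: "phi x \<in> IE6"
    \<comment> \<open>Modulo the ideal \<open>x\<close> is a combination of normal forms. Its image
      vanishes in type E6, so all coefficients vanish and \<open>x\<close> itself lies in the
      ideal.\<close>
    obtain c where c: "x - (\<Sum>i<14985. scal (c i) (mon (wd (nw (p i))) 0)) \<in> IF4"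
      using F4_spanning[OF p] by blast
    then have "phi x - phi (x - (\<Sum>i<14985. scal (c i) (mon (wd (nw (p i))) 0))) \<in> IE6"
      using x phi_IF4 unfolding IE6_def by (blast intro: ideal_gen_diff)
    then have "phi (\<Sum>i<14985. scal (c i) (mon (wd (nw (p i))) 0)) \<in> IE6"
      by (simp add: phi_diff)
    from F4_independent[OF p this] show "x \<in> IF4"
      using c by simp
  qed
  show "\<forall>x. \<exists>y\<in>SBrE6. phi x - y \<in> IE6"
    using phi_SBrE6 by (metis IE6_def diff_self ideal_gen.zero_in)
  show "\<forall>y\<in>SBrE6. \<exists>x. phi x - y \<in> IE6"
    using SBrE6_phi by blast
  show "\<exists>b :: nat \<Rightarrow> F4gen falg.
            (\<forall>x. \<exists>c :: nat \<Rightarrow> laurent. x - (\<Sum>i<14985. scal (c i) (b i)) \<in> IF4)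
          \<and> (\<forall>c :: nat \<Rightarrow> laurent. (\<Sum>i<14985. scal (c i) (b i)) \<in> IF4 \<longrightarrow> (\<forall>i<14985. c i = 0))"
    using F4_spanning[OF p] F4_independent[OF p] phi_IF4
    by (intro exI[of _ "\<lambda>i. mon (wd (nw (p i))) 0"]) blast
qed

end
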